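(* Let $n\ge 1$. (a) Let $\mathbb{K}$ be an algebraically closed field of characteristic zero. Every cocommutative and cosemisimple Hopf algebra quotient of $A_s(n,\mathbb{K})$ is isomorphic to a group algebra $\mathbb{K}[G]$, where the group $G$ is a quotient of a free product of transitive abelian groups. (b) Every cocommutative Hopf $*$-algebra quotient of $A_s(n,\mathbb{C})$ is isomorphic to a group algebra $\mathbb{C}[G]$, where the group $G$ is a quotient of a free product of transitive abelian groups.
   Context: $A_s(n,\mathbb{K})$ is the $\mathbb{K}$-algebra presented by generators $u_{ij}$, $1\le i,j\le n$, and relations, for all $i,j,k$: $u_{ki}u_{kj}=\delta_{ij}u_{ki}$, $\sum_{l=1}^n u_{il}=1$, $u_{ik}u_{jk}=\delta_{ij}u_{ik}$, $\sum_{l=1}^n u_{li}=1$. It is a Hopf algebra with $\Delta(u_{ij})=\sum_k u_{ik}\otimes u_{kj}$, $\varepsilon(u_{ij})=\delta_{ij}$, $S(u_{ij})=u_{ji}$; over $\mathbb{C}$ it is a Hopf $*$-algebra with $u_{ij}^*=u_{ij}$. A Hopf algebra is cosemisimple if its category of comodules is semisimple. A transitive abelian group is an abelian subgroup of a symmetric group $S_m$ (for some $m\geq 1$) acting transitively on $\{1,\dots,m\}$. $\mathbb{K}[G]$ is the group algebra with its usual Hopf algebra structure (each $g\in G$ group-like); over $\mathbb{C}$ its $*$-structure is $g^*=g^{-1}$. *)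

theory Defs
  imports
    "HOL-Computational_Algebra.Fundamental_Theorem_Algebra"
    "HOL-Library.Poly_Mapping"
    "HOL-Algebra.Algebraic_Closure_Type"
    "HOL-Algebra.Sym_Groups"
begin

section \<open>Vector spaces and algebras over a field\<close>

text \<open>
  The field of scalars is a type \<open>'k\<close>. Vector spaces and algebras over it are records of type
  \<^type>\<open>module\<close> with an explicit carrier; for a mere vector space the components \<open>mult\<close> and
  \<open>one\<close> of the record are irrelevant.
\<close>

definition scalars :: "('k::field, 'k) module" where
  "scalars = ring.extend ring_of_type_algebra (module.fields (*))"

abbreviation vspace :: "('k::field, 'a, 'm) module_scheme \<Rightarrow> bool" where
  "vspace V \<equiv> module (ring_of_type_algebra :: 'k ring) V"

definition linear_maps ::
  "('k::field, 'a, 'm) module_scheme \<Rightarrow> ('k, 'b, 'n) module_scheme \<Rightarrow> ('a \<Rightarrow> 'b) set" where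
  "linear_maps V W = {f \<in> carrier V \<rightarrow> carrier W.
     (\<forall>x\<in>carrier V. \<forall>y\<in>carrier V. f (x \<oplus>\<^bsub>V\<^esub> y) = f x \<oplus>\<^bsub>W\<^esub> f y) \<and>
     (\<forall>c. \<forall>x\<in>carrier V. f (c \<odot>\<^bsub>V\<^esub> x) = c \<odot>\<^bsub>W\<^esub> f x)}"

definition unital_algebra :: "('k::field, 'a, 'm) module_scheme \<Rightarrow> bool" where
  "unital_algebra A \<longleftrightarrow> ring A \<and> vspace A \<and>
     (\<forall>c. \<forall>x\<in>carrier A. \<forall>y\<in>carrier A.
        (c \<odot>\<^bsub>A\<^esub> x) \<otimes>\<^bsub>A\<^esub> y = c \<odot>\<^bsub>A\<^esub> (x \<otimes>\<^bsub>A\<^esub> y) \<and>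
        x \<otimes>\<^bsub>A\<^esub> (c \<odot>\<^bsub>A\<^esub> y) = c \<odot>\<^bsub>A\<^esub> (x \<otimes>\<^bsub>A\<^esub> y))"

definition algebra_homs ::
  "('k::field, 'a, 'm) module_scheme \<Rightarrow> ('k, 'b, 'n) module_scheme \<Rightarrow> ('a \<Rightarrow> 'b) set" where
  "algebra_homs A B = ring_hom A B \<inter> linear_maps A B"

definition monoid_algebra :: "('g, 'm) monoid_scheme \<Rightarrow> ('k::field, 'g \<Rightarrow>\<^sub>0 'k) module" where
  "monoid_algebra G =
     \<lparr>carrier = {f. Poly_Mapping.keys f \<subseteq> carrier G},
      monoid.mult = (\<lambda>f h. \<Sum>x\<in>Poly_Mapping.keys f. \<Sum>y\<in>Poly_Mapping.keys h.
                Poly_Mapping.single (x \<otimes>\<^bsub>G\<^esub> y) (Poly_Mapping.lookup f x * Poly_Mapping.lookup h y)),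
      one = Poly_Mapping.single \<one>\<^bsub>G\<^esub> 1,
      zero = 0,
      add = (+),
      module.smult = (\<lambda>c. Poly_Mapping.map ((*) c))\<rparr>"

definition gen_submodule :: "('k::field, 'a, 'm) module_scheme \<Rightarrow> 'a set \<Rightarrow> 'a set" where
  "gen_submodule V S = \<Inter>{U. submodule U (ring_of_type_algebra :: 'k ring) V \<and> S \<subseteq> U}"

definition quot_alg ::
  "('k::field, 'a, 'm) module_scheme \<Rightarrow> 'a set \<Rightarrow> ('k, 'a set) module" where
  "quot_alg A I = ring.extend (A Quot I)
     (module.fields (\<lambda>c C. \<Union>x\<in>C. I +>\<^bsub>A\<^esub> (c \<odot>\<^bsub>A\<^esub> x)))"

text \<open>
  \<open>lin_ext M \<phi>\<close> is the linear extension to formal linear combinations of a map \<open>\<phi>\<close> given on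
  basis elements; \<open>induced M \<phi>\<close> is the map which it induces on cosets of formal linear
  combinations (as in \<open>FactRing_iso\<close>, via \<^const>\<open>the_elem\<close>), provided that it is constant on them.
\<close>

definition lin_ext :: "('k::field, 'b, 'm) module_scheme \<Rightarrow> ('x \<Rightarrow> 'b) \<Rightarrow> ('x \<Rightarrow>\<^sub>0 'k) \<Rightarrow> 'b" where
  "lin_ext M \<phi> t = (\<Oplus>\<^bsub>M\<^esub>p\<in>Poly_Mapping.keys t. Poly_Mapping.lookup t p \<odot>\<^bsub>M\<^esub> \<phi> p)"

definition induced ::
  "('k::field, 'b, 'm) module_scheme \<Rightarrow> ('x \<Rightarrow> 'b) \<Rightarrow> ('x \<Rightarrow>\<^sub>0 'k) set \<Rightarrow> 'b" where
  "induced M \<phi> C = the_elem (lin_ext M \<phi> ` C)"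

text \<open>The antilinear counterpart of \<^const>\<open>induced\<close>.\<close>

definition induced_cnj ::
  "(complex, 'b, 'm) module_scheme \<Rightarrow> ('x \<Rightarrow> 'b) \<Rightarrow> ('x \<Rightarrow>\<^sub>0 complex) set \<Rightarrow> 'b" where
  "induced_cnj M \<phi> C = the_elem ((\<lambda>t. lin_ext M \<phi> (Poly_Mapping.map cnj t)) ` C)"


section \<open>Tensor products\<close>

text \<open>
  The tensor product is the free vector space on \<open>carrier V \<times> carrier W\<close> modulo the
  subspace spanned by the bilinearity relations. Using the monoid algebra of the (multiplicative)
  product \<open>V \<times>\<times> W\<close> as free vector space equips it, when \<open>V\<close> and \<open>W\<close> are algebras, with the
  multiplication \<open>(x \<otimes> y)(x' \<otimes> y') = xx' \<otimes> yy'\<close>.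
\<close>

definition bilinear_rels ::
  "('k::field, 'a, 'm) module_scheme \<Rightarrow> ('k, 'b, 'n) module_scheme \<Rightarrow> ('a \<times> 'b \<Rightarrow>\<^sub>0 'k) set" where
  "bilinear_rels V W =
     {Poly_Mapping.single (x \<oplus>\<^bsub>V\<^esub> x', y) 1 - Poly_Mapping.single (x, y) 1 - Poly_Mapping.single (x', y) 1
        | x x' y. x \<in> carrier V \<and> x' \<in> carrier V \<and> y \<in> carrier W} \<union>
     {Poly_Mapping.single (x, y \<oplus>\<^bsub>W\<^esub> y') 1 - Poly_Mapping.single (x, y) 1 - Poly_Mapping.single (x, y') 1
        | x y y'. x \<in> carrier V \<and> y \<in> carrier W \<and> y' \<in> carrier W} \<union>
     {Poly_Mapping.single (c \<odot>\<^bsub>V\<^esub> x, y) 1 - Poly_Mapping.single (x, y) c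
        | c x y. x \<in> carrier V \<and> y \<in> carrier W} \<union>
     {Poly_Mapping.single (x, c \<odot>\<^bsub>W\<^esub> y) 1 - Poly_Mapping.single (x, y) c
        | c x y. x \<in> carrier V \<and> y \<in> carrier W}"

definition tensor_kernel ::
  "('k::field, 'a, 'm) module_scheme \<Rightarrow> ('k, 'b, 'n) module_scheme \<Rightarrow> ('a \<times> 'b \<Rightarrow>\<^sub>0 'k) set" where
  "tensor_kernel V W = gen_submodule (monoid_algebra (V \<times>\<times> W)) (bilinear_rels V W)"

definition tensor ::
  "('k::field, 'a, 'm) module_scheme \<Rightarrow> ('k, 'b, 'n) module_scheme \<Rightarrow>
   ('k, ('a \<times> 'b \<Rightarrow>\<^sub>0 'k) set) module" where
  "tensor V W = quot_alg (monoid_algebra (V \<times>\<times> W)) (tensor_kernel V W)"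

definition tensor_class ::
  "('k::field, 'a, 'm) module_scheme \<Rightarrow> ('k, 'b, 'n) module_scheme \<Rightarrow>
   ('a \<times> 'b \<Rightarrow>\<^sub>0 'k) \<Rightarrow> ('a \<times> 'b \<Rightarrow>\<^sub>0 'k) set" where
  "tensor_class V W t = tensor_kernel V W +>\<^bsub>monoid_algebra (V \<times>\<times> W)\<^esub> t"

definition pure_tensor ::
  "('k::field, 'a, 'm) module_scheme \<Rightarrow> ('k, 'b, 'n) module_scheme \<Rightarrow>
   'a \<Rightarrow> 'b \<Rightarrow> ('a \<times> 'b \<Rightarrow>\<^sub>0 'k) set" where
  "pure_tensor V W x y = tensor_class V W (Poly_Mapping.single (x, y) 1)"

text \<open>\<open>f \<otimes> g\<close>, with values in \<open>V \<otimes> W\<close>.\<close>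

definition tensor_map ::
  "('k::field, 'a, 'm) module_scheme \<Rightarrow> ('k, 'b, 'n) module_scheme \<Rightarrow>
   ('c \<Rightarrow> 'a) \<Rightarrow> ('d \<Rightarrow> 'b) \<Rightarrow> ('c \<times> 'd \<Rightarrow>\<^sub>0 'k) set \<Rightarrow> ('a \<times> 'b \<Rightarrow>\<^sub>0 'k) set" where
  "tensor_map V W f g = induced (tensor V W) (\<lambda>(x, y). pure_tensor V W (f x) (g y))"

text \<open>The associativity isomorphism \<open>(U \<otimes> V) \<otimes> W \<rightarrow> U \<otimes> (V \<otimes> W)\<close>.\<close>

definition tensor_assoc ::
  "('k::field, 'a, 'l) module_scheme \<Rightarrow> ('k, 'b, 'm) module_scheme \<Rightarrow> ('k, 'c, 'n) module_scheme \<Rightarrow>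
   (('a \<times> 'b \<Rightarrow>\<^sub>0 'k) set \<times> 'c \<Rightarrow>\<^sub>0 'k) set \<Rightarrow> ('a \<times> ('b \<times> 'c \<Rightarrow>\<^sub>0 'k) set \<Rightarrow>\<^sub>0 'k) set" where
  "tensor_assoc U V W =
     induced (tensor U (tensor V W))
       (\<lambda>(C, z). induced (tensor U (tensor V W))
          (\<lambda>(x, y). pure_tensor U (tensor V W) x (pure_tensor V W y z)) C)"


section \<open>Hopf algebras\<close>

record (overloaded) ('k::zero, 'a) hopf = "('k, 'a) module" +
  comult :: "'a \<Rightarrow> ('a \<times> 'a \<Rightarrow>\<^sub>0 'k) set"
  counit :: "'a \<Rightarrow> 'k"
  antipode :: "'a \<Rightarrow> 'a"

definition hopf_algebra :: "('k::field, 'a, 'm) hopf_scheme \<Rightarrow> bool" where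
  "hopf_algebra H \<longleftrightarrow>
     unital_algebra H \<and>
     comult H \<in> algebra_homs H (tensor H H) \<and>
     counit H \<in> algebra_homs H scalars \<and>
     antipode H \<in> linear_maps H H \<and>
     (\<forall>x\<in>carrier H.
        tensor_assoc H H H (tensor_map (tensor H H) H (comult H) id (comult H x)) =
          tensor_map H (tensor H H) id (comult H) (comult H x) \<and>
        induced H (\<lambda>(y, z). counit H y \<odot>\<^bsub>H\<^esub> z) (comult H x) = x \<and>
        induced H (\<lambda>(y, z). counit H z \<odot>\<^bsub>H\<^esub> y) (comult H x) = x \<and>
        induced H (\<lambda>(y, z). antipode H y \<otimes>\<^bsub>H\<^esub> z) (comult H x) = counit H x \<odot>\<^bsub>H\<^esub> \<one>\<^bsub>H\<^esub> \<and>
        induced H (\<lambda>(y, z). y \<otimes>\<^bsub>H\<^esub> antipode H z) (comult H x) = counit H x \<odot>\<^bsub>H\<^esub> \<one>\<^bsub>H\<^esub>)"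

definition hopf_homs ::
  "('k::field, 'a, 'm) hopf_scheme \<Rightarrow> ('k, 'b, 'n) hopf_scheme \<Rightarrow> ('a \<Rightarrow> 'b) set" where
  "hopf_homs H L = {f \<in> algebra_homs H L. \<forall>x\<in>carrier H.
     comult L (f x) = tensor_map L L f f (comult H x) \<and>
     counit L (f x) = counit H x \<and>
     f (antipode H x) = antipode L (f x)}"

definition hopf_quotient ::
  "('k::field, 'a, 'm) hopf_scheme \<Rightarrow> ('k, 'b, 'n) hopf_scheme \<Rightarrow> bool" where
  "hopf_quotient A H \<longleftrightarrow> hopf_algebra H \<and> (\<exists>f\<in>hopf_homs A H. f ` carrier A = carrier H)"

definition hopf_iso ::
  "('k::field, 'a, 'm) hopf_scheme \<Rightarrow> ('k, 'b, 'n) hopf_scheme \<Rightarrow> bool" where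
  "hopf_iso H L \<longleftrightarrow> (\<exists>f\<in>hopf_homs H L. bij_betw f (carrier H) (carrier L))"

definition cocommutative :: "('k::field, 'a, 'm) hopf_scheme \<Rightarrow> bool" where
  "cocommutative H \<longleftrightarrow>
     (\<forall>x\<in>carrier H. induced (tensor H H) (\<lambda>(y, z). pure_tensor H H z y) (comult H x) = comult H x)"


subsection \<open>Comodules and cosemisimplicity\<close>

definition comodule ::
  "('k::field, 'a, 'm) hopf_scheme \<Rightarrow> ('k, 'v, 'n) module_scheme \<Rightarrow>
   ('v \<Rightarrow> ('v \<times> 'a \<Rightarrow>\<^sub>0 'k) set) \<Rightarrow> bool" where
  "comodule H V \<rho> \<longleftrightarrow>
     vspace V \<and> \<rho> \<in> linear_maps V (tensor V H) \<and>
     (\<forall>v\<in>carrier V.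
        tensor_assoc V H H (tensor_map (tensor V H) H \<rho> id (\<rho> v)) =
          tensor_map V (tensor H H) id (comult H) (\<rho> v) \<and>
        induced V (\<lambda>(w, h). counit H h \<odot>\<^bsub>V\<^esub> w) (\<rho> v) = v)"

text \<open>A subcomodule is a subspace \<open>W\<close> such that \<open>\<rho>\<close> maps \<open>W\<close> into the image of \<open>W \<otimes> H\<close> in \<open>V \<otimes> H\<close>.\<close>

definition subcomodule ::
  "('k::field, 'a, 'm) hopf_scheme \<Rightarrow> ('k, 'v, 'n) module_scheme \<Rightarrow>
   ('v \<Rightarrow> ('v \<times> 'a \<Rightarrow>\<^sub>0 'k) set) \<Rightarrow> 'v set \<Rightarrow> bool" where
  "subcomodule H V \<rho> W \<longleftrightarrow>
     submodule W (ring_of_type_algebra :: 'k ring) V \<and>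
     (\<forall>w\<in>W. \<exists>t. Poly_Mapping.keys t \<subseteq> W \<times> carrier H \<and> \<rho> w = tensor_class V H t)"

definition simple_subcomodule ::
  "('k::field, 'a, 'm) hopf_scheme \<Rightarrow> ('k, 'v, 'n) module_scheme \<Rightarrow>
   ('v \<Rightarrow> ('v \<times> 'a \<Rightarrow>\<^sub>0 'k) set) \<Rightarrow> 'v set \<Rightarrow> bool" where
  "simple_subcomodule H V \<rho> W \<longleftrightarrow>
     subcomodule H V \<rho> W \<and> W \<noteq> {\<zero>\<^bsub>V\<^esub>} \<and>
     (\<forall>W'. subcomodule H V \<rho> W' \<and> W' \<subseteq> W \<longrightarrow> W' = {\<zero>\<^bsub>V\<^esub>} \<or> W' = W)"

text \<open>\<open>V\<close> is the (internal) direct sum of a set of simple subcomodules.\<close>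

definition semisimple_comodule ::
  "('k::field, 'a, 'm) hopf_scheme \<Rightarrow> ('k, 'v, 'n) module_scheme \<Rightarrow>
   ('v \<Rightarrow> ('v \<times> 'a \<Rightarrow>\<^sub>0 'k) set) \<Rightarrow> bool" where
  "semisimple_comodule H V \<rho> \<longleftrightarrow>
     (\<exists>\<S>. (\<forall>W\<in>\<S>. simple_subcomodule H V \<rho> W) \<and>
        (\<forall>v\<in>carrier V. \<exists>F s. finite F \<and> F \<subseteq> \<S> \<and> (\<forall>W\<in>F. s W \<in> W) \<and> v = (\<Oplus>\<^bsub>V\<^esub>W\<in>F. s W)) \<and>
        (\<forall>F s. finite F \<and> F \<subseteq> \<S> \<and> (\<forall>W\<in>F. s W \<in> W) \<and> (\<Oplus>\<^bsub>V\<^esub>W\<in>F. s W) = \<zero>\<^bsub>V\<^esub> \<longrightarrow>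
           (\<forall>W\<in>F. s W = \<zero>\<^bsub>V\<^esub>)))"

text \<open>
  The category of comodules is semisimple: every comodule is a direct sum of simple ones. A
  universe for the underlying sets of the comodules must be fixed: they range over all
  subsets of the type \<open>'a\<close> carrying \<open>H\<close>, with arbitrary vector space structures on them. This
  comprises the regular comodule \<open>H\<close> itself and, up to isomorphism, all comodules of cardinality at
  most that of \<open>H\<close>; semisimplicity of the regular comodule already implies that of all others.
\<close>

definition cosemisimple :: "('k::field, 'a, 'm) hopf_scheme \<Rightarrow> bool" where
  "cosemisimple H \<longleftrightarrow>
     (\<forall>(V :: ('k, 'a) module) \<rho>. comodule H V \<rho> \<longrightarrow> semisimple_comodule H V \<rho>)"


subsection \<open>Hopf *-algebras\<close>

record (overloaded) 'a hopf_star = "(complex, 'a) hopf" +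
  star :: "'a \<Rightarrow> 'a"

definition hopf_star_algebra :: "('a, 'm) hopf_star_scheme \<Rightarrow> bool" where
  "hopf_star_algebra H \<longleftrightarrow>
     hopf_algebra H \<and>
     star H \<in> carrier H \<rightarrow> carrier H \<and>
     (\<forall>x\<in>carrier H. \<forall>y\<in>carrier H.
        star H (x \<oplus>\<^bsub>H\<^esub> y) = star H x \<oplus>\<^bsub>H\<^esub> star H y \<and>
        star H (x \<otimes>\<^bsub>H\<^esub> y) = star H y \<otimes>\<^bsub>H\<^esub> star H x) \<and>
     (\<forall>c. \<forall>x\<in>carrier H. star H (c \<odot>\<^bsub>H\<^esub> x) = cnj c \<odot>\<^bsub>H\<^esub> star H x) \<and>
     (\<forall>x\<in>carrier H. star H (star H x) = x) \<and>
     (\<forall>x\<in>carrier H. comult H (star H x) =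
        induced_cnj (tensor H H) (\<lambda>(y, z). pure_tensor H H (star H y) (star H z)) (comult H x))"

definition hopf_star_homs ::
  "('a, 'm) hopf_star_scheme \<Rightarrow> ('b, 'n) hopf_star_scheme \<Rightarrow> ('a \<Rightarrow> 'b) set" where
  "hopf_star_homs H L = {f \<in> hopf_homs H L. \<forall>x\<in>carrier H. f (star H x) = star L (f x)}"

definition hopf_star_quotient ::
  "('a, 'm) hopf_star_scheme \<Rightarrow> ('b, 'n) hopf_star_scheme \<Rightarrow> bool" where
  "hopf_star_quotient A H \<longleftrightarrow>
     hopf_star_algebra H \<and> (\<exists>f\<in>hopf_star_homs A H. f ` carrier A = carrier H)"

definition hopf_star_iso ::
  "('a, 'm) hopf_star_scheme \<Rightarrow> ('b, 'n) hopf_star_scheme \<Rightarrow> bool" where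
  "hopf_star_iso H L \<longleftrightarrow> (\<exists>f\<in>hopf_star_homs H L. bij_betw f (carrier H) (carrier L))"


section \<open>Group algebras\<close>

definition group_hopf :: "('g, 'm) monoid_scheme \<Rightarrow> ('k::field, 'g \<Rightarrow>\<^sub>0 'k) hopf" where
  "group_hopf G =
     (let A = monoid_algebra G; \<delta> = (\<lambda>g. Poly_Mapping.single g 1) in
      module.extend A
        (hopf.fields
          (lin_ext (tensor A A) (\<lambda>g. pure_tensor A A (\<delta> g) (\<delta> g)))
          (lin_ext scalars (\<lambda>g. 1))
          (lin_ext A (\<lambda>g. \<delta> (inv\<^bsub>G\<^esub> g)))))"

definition group_hopf_star :: "('g, 'm) monoid_scheme \<Rightarrow> ('g \<Rightarrow>\<^sub>0 complex) hopf_star" where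
  "group_hopf_star G = hopf.extend (group_hopf G)
     (hopf_star.fields
       (\<lambda>f. lin_ext (monoid_algebra G) (\<lambda>g. Poly_Mapping.single (inv\<^bsub>G\<^esub> g) (1 :: complex))
          (Poly_Mapping.map cnj f)))"


section \<open>The algebra of the quantum permutation group\<close>

definition free_monoid :: "'x set \<Rightarrow> 'x list monoid" where
  "free_monoid L = \<lparr>carrier = lists L, monoid.mult = (@), one = []\<rparr>"

definition free_algebra :: "'x set \<Rightarrow> ('k::field, 'x list \<Rightarrow>\<^sub>0 'k) module" where
  "free_algebra L = monoid_algebra (free_monoid L)"

text \<open>The letter \<open>(i, j)\<close> stands for the generator \<open>u\<^sub>i\<^sub>j\<close>.\<close>

abbreviation As_letters :: "nat \<Rightarrow> (nat \<times> nat) set" where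
  "As_letters n \<equiv> {1..n} \<times> {1..n}"

definition As_rels :: "nat \<Rightarrow> ((nat \<times> nat) list \<Rightarrow>\<^sub>0 'k::field) set" where
  "As_rels n = (let m = (\<lambda>w. Poly_Mapping.single w 1) in
     {m [(k, i), (k, j)] - (if i = j then m [(k, i)] else 0) | i j k.
        i \<in> {1..n} \<and> j \<in> {1..n} \<and> k \<in> {1..n}} \<union>
     {(\<Sum>l\<in>{1..n}. m [(i, l)]) - m [] | i. i \<in> {1..n}} \<union>
     {m [(i, k), (j, k)] - (if i = j then m [(i, k)] else 0) | i j k.
        i \<in> {1..n} \<and> j \<in> {1..n} \<and> k \<in> {1..n}} \<union>
     {(\<Sum>l\<in>{1..n}. m [(l, i)]) - m [] | i. i \<in> {1..n}})"

definition As_ideal :: "nat \<Rightarrow> ((nat \<times> nat) list \<Rightarrow>\<^sub>0 'k::field) set" where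
  "As_ideal n = Idl\<^bsub>free_algebra (As_letters n)\<^esub> (As_rels n)"

definition As_algebra :: "nat \<Rightarrow> ('k::field, ((nat \<times> nat) list \<Rightarrow>\<^sub>0 'k) set) module" where
  "As_algebra n = quot_alg (free_algebra (As_letters n)) (As_ideal n)"

definition As_word :: "nat \<Rightarrow> (nat \<times> nat) list \<Rightarrow> ((nat \<times> nat) list \<Rightarrow>\<^sub>0 'k::field) set" where
  "As_word n w = As_ideal n +>\<^bsub>free_algebra (As_letters n)\<^esub> Poly_Mapping.single w 1"

definition As_gen :: "nat \<Rightarrow> nat \<Rightarrow> nat \<Rightarrow> ((nat \<times> nat) list \<Rightarrow>\<^sub>0 'k::field) set" where
  "As_gen n i j = As_word n [(i, j)]"

text \<open>
  \<open>comult\<close> and \<open>counit\<close> are the algebra homomorphisms and \<open>antipode\<close> (resp. \<open>star\<close>) is the linear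
  (resp. antilinear) antihomomorphism with the prescribed values on the generators; they are given
  by their values on words.
\<close>

definition As :: "nat \<Rightarrow> ('k::field, ((nat \<times> nat) list \<Rightarrow>\<^sub>0 'k) set) hopf" where
  "As n =
     (let A = As_algebra n; T = tensor A A in
      module.extend A
        (hopf.fields
          (induced T (\<lambda>w. foldr (\<lambda>(i, j) C.
             (\<Oplus>\<^bsub>T\<^esub>k\<in>{1..n}. pure_tensor A A (As_gen n i k) (As_gen n k j)) \<otimes>\<^bsub>T\<^esub> C) w \<one>\<^bsub>T\<^esub>))
          (induced scalars (\<lambda>w. \<Prod>(i, j)\<leftarrow>w. if i = j then 1 else 0))
          (induced A (\<lambda>w. As_word n (rev (map prod.swap w))))))"

definition As_star :: "nat \<Rightarrow> ((nat \<times> nat) list \<Rightarrow>\<^sub>0 complex) set hopf_star" where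
  "As_star n = hopf.extend (As n)
     (hopf_star.fields (induced_cnj (As_algebra n) (\<lambda>w. As_word n (rev w))))"


section \<open>Free products of transitive abelian groups\<close>

text \<open>
  The free product of the groups \<open>G i\<close>, \<open>i \<in> I\<close>: words in the disjoint union of the carriers,
  modulo the congruence which deletes identity letters and multiplies
  adjacent letters from the same factor.
\<close>

definition fp_words :: "'i set \<Rightarrow> ('i \<Rightarrow> ('g, 'm) monoid_scheme) \<Rightarrow> ('i \<times> 'g) list set" where
  "fp_words I G = lists (SIGMA i:I. carrier (G i))"

inductive fp_step :: "'i set \<Rightarrow> ('i \<Rightarrow> ('g, 'm) monoid_scheme) \<Rightarrow>
    ('i \<times> 'g) list \<Rightarrow> ('i \<times> 'g) list \<Rightarrow> bool" for I G where
  "\<lbrakk>u \<in> fp_words I G; v \<in> fp_words I G; i \<in> I\<rbrakk>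
     \<Longrightarrow> fp_step I G (u @ [(i, \<one>\<^bsub>G i\<^esub>)] @ v) (u @ v)"
| "\<lbrakk>u \<in> fp_words I G; v \<in> fp_words I G; i \<in> I; a \<in> carrier (G i); b \<in> carrier (G i)\<rbrakk>
     \<Longrightarrow> fp_step I G (u @ [(i, a), (i, b)] @ v) (u @ [(i, a \<otimes>\<^bsub>G i\<^esub> b)] @ v)"

definition fp_rel :: "'i set \<Rightarrow> ('i \<Rightarrow> ('g, 'm) monoid_scheme) \<Rightarrow> ('i \<times> 'g) list rel" where
  "fp_rel I G = {(u, v). u \<in> fp_words I G \<and> v \<in> fp_words I G \<and> equivclp (fp_step I G) u v}"

definition free_product ::
  "'i set \<Rightarrow> ('i \<Rightarrow> ('g, 'm) monoid_scheme) \<Rightarrow> ('i \<times> 'g) list set monoid" where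
  "free_product I G =
     \<lparr>carrier = fp_words I G // fp_rel I G,
      monoid.mult = (\<lambda>U V. \<Union>x\<in>U. \<Union>y\<in>V. fp_rel I G `` {x @ y}),
      one = fp_rel I G `` {[]}\<rparr>"

definition transitive_abelian :: "nat \<Rightarrow> (nat \<Rightarrow> nat) set \<Rightarrow> bool" where
  "transitive_abelian m T \<longleftrightarrow>
     m \<ge> 1 \<and> subgroup T (sym_group m) \<and> comm_group (sym_group m \<lparr>carrier := T\<rparr>) \<and>
     (\<forall>i\<in>{1..m}. \<forall>j\<in>{1..m}. \<exists>p\<in>T. p i = j)"

definition quotient_of_free_product_of_transitive_abelian :: "('g, 'm) monoid_scheme \<Rightarrow> bool" where
  "quotient_of_free_product_of_transitive_abelian G \<longleftrightarrow>
     (\<exists>(r :: nat) (m :: nat \<Rightarrow> nat) (T :: nat \<Rightarrow> (nat \<Rightarrow> nat) set) N.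
        let F = free_product {1..r} (\<lambda>i. sym_group (m i) \<lparr>carrier := T i\<rparr>) in
        (\<forall>i\<in>{1..r}. transitive_abelian (m i) (T i)) \<and> N \<lhd> F \<and> F Mod N \<cong> G)"

end

theory Submission
  imports Defs
begin

text \<open>
  Let \<open>H\<close> be a quotient as in (a) or (b), and \<open>u\<^sub>i\<^sub>j \<in> H\<close> the images of the generators. The dual of \<open>H\<close> is a
  commutative algebra acting on \<open>H\<close>. In case (a) every functional acts by a scalar on each simple
  subcomodule of \<open>H\<close>, which is therefore spanned by a group-like element; so \<open>H\<close> is spanned by group-like
  elements. In case (b) the functionals \<open>f\<close> act on \<open>\<complex>\<^sup>n\<close> by the commuting matrices \<open>(f(u\<^sub>i\<^sub>j))\<close>, a set closed
  under adjoints because \<open>S(u\<^sub>i\<^sub>j) = u\<^sub>j\<^sub>i\<close> and \<open>u\<^sub>i\<^sub>j\<close> is self-adjoint; diagonalising them simultaneously expresses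
  the \<open>u\<^sub>i\<^sub>j\<close> by group-like elements. As group-like elements are linearly independent, \<open>H = \<bbbK>[G]\<close>.

  The \<open>i\<close>-th row consists of orthogonal idempotents with sum \<open>1\<close>, so it spans a commutative unital
  subalgebra; being invariant under the action of the dual, this is spanned by the group-like elements which it
  contains. These form a finite abelian group \<open>G\<^sub>i\<close>, which acts transitively on itself by translation. Since
  the \<open>u\<^sub>i\<^sub>j\<close> generate \<open>H\<close>, the groups \<open>G\<^sub>1, \<dots>, G\<^sub>n\<close> generate \<open>G\<close>.
\<close>

text \<open>Two obstacles shape the proof. A tensor is a coset of formal combinations, so identities
  in \<open>tensor H H\<close> are not directly accessible; they are tested with the functionals f
  \<otimes> g, which separate tensors over any field. In this way \<Delta> becomes a convolution
  product on the dual and the action x_1 f(x_2) on H; coassociativity and cocommutativity say that a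
  commutative algebra acts, and the group-like elements are its common eigenvectors of counit 1.
  Secondly, H may be infinite-dimensional: but \<Delta>(x) is a finite sum, so the orbit of x spans
  a finite-dimensional space, annihilating polynomials exist, and algebraic closedness yields
  eigenvectors. The groups G_i are finite because group-like elements are linearly independent and
  the i-th row is an image of K^n; so |G_i| is at most n, and G_i is realised on |G_i| points. In
  (b) the star has to match as well: the coordinates of an element of G_i along the nonzero u_ij
  have modulus one, so its star is its inverse.\<close>

abbreviation "keys \<equiv> Poly_Mapping.keys"
abbreviation "lookup \<equiv> Poly_Mapping.lookup"
abbreviation "single \<equiv> Poly_Mapping.single"

section \<open>Vector spaces\<close>

lemma ring_of_type_algebra_simps [simp]:
  "carrier (ring_of_type_algebra :: 'k::field ring) = UNIV"
  "x \<otimes>\<^bsub>(ring_of_type_algebra :: 'k ring)\<^esub> y = x * y"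
  "\<one>\<^bsub>(ring_of_type_algebra :: 'k ring)\<^esub> = 1"
  "\<zero>\<^bsub>(ring_of_type_algebra :: 'k ring)\<^esub> = 0"
  "x \<oplus>\<^bsub>(ring_of_type_algebra :: 'k ring)\<^esub> y = x + y"
  by (simp_all add: ring_of_type_algebra_def)

lemma a_inv_ring_of_type_algebra [simp]:
  "\<ominus>\<^bsub>(ring_of_type_algebra :: 'k::field ring)\<^esub> x = - x"
proof -
  interpret ring "ring_of_type_algebra :: 'k ring" by (rule ring_from_type_algebra)
  show ?thesis by (rule minus_equality) simp_all
qed

lemma vspaceI:
  fixes V :: "('k::field, 'a, 'm) module_scheme"
  assumes "abelian_group V"
    and "\<And>c x. x \<in> carrier V \<Longrightarrow> c \<odot>\<^bsub>V\<^esub> x \<in> carrier V"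
    and "\<And>c d x. x \<in> carrier V \<Longrightarrow> (c + d) \<odot>\<^bsub>V\<^esub> x = c \<odot>\<^bsub>V\<^esub> x \<oplus>\<^bsub>V\<^esub> d \<odot>\<^bsub>V\<^esub> x"
    and "\<And>c x y. x \<in> carrier V \<Longrightarrow> y \<in> carrier V \<Longrightarrow>
           c \<odot>\<^bsub>V\<^esub> (x \<oplus>\<^bsub>V\<^esub> y) = c \<odot>\<^bsub>V\<^esub> x \<oplus>\<^bsub>V\<^esub> c \<odot>\<^bsub>V\<^esub> y"
    and "\<And>c d x. x \<in> carrier V \<Longrightarrow> (c * d) \<odot>\<^bsub>V\<^esub> x = c \<odot>\<^bsub>V\<^esub> (d \<odot>\<^bsub>V\<^esub> x)"
    and "\<And>x. x \<in> carrier V \<Longrightarrow> 1 \<odot>\<^bsub>V\<^esub> x = x"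
  shows "vspace V"
  using assms by (intro moduleI cring_from_type_algebra) simp_all

locale vec_space = Module.module "ring_of_type_algebra :: 'k::field ring" V
  for V :: "('k::field, 'a, 'm) module_scheme" (structure)
begin

lemma scale_closed [simp, intro]: "x \<in> carrier V \<Longrightarrow> c \<odot> x \<in> carrier V"
  by simp

lemma scale_left_distrib: "x \<in> carrier V \<Longrightarrow> (c + d) \<odot> x = c \<odot> x \<oplus> d \<odot> x"
  using smult_l_distr[of c d x] by simp

lemma scale_right_distrib: "x \<in> carrier V \<Longrightarrow> y \<in> carrier V \<Longrightarrow> c \<odot> (x \<oplus> y) = c \<odot> x \<oplus> c \<odot> y"
  using smult_r_distr[of c x y] by simp

lemma scale_assoc: "x \<in> carrier V \<Longrightarrow> c \<odot> (d \<odot> x) = (c * d) \<odot> x"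
  using smult_assoc1[of c d x] by simp

lemma scale_one [simp]: "x \<in> carrier V \<Longrightarrow> 1 \<odot> x = x"
  using smult_one[of x] by simp

lemma scale_zero_left [simp]: "x \<in> carrier V \<Longrightarrow> 0 \<odot> x = \<zero>"
  using smult_l_null[of x] by simp

lemma scale_zero_right [simp]: "c \<odot> \<zero> = \<zero>"
  using smult_r_null[of c] by simp

lemma minus_eq_scale: "x \<in> carrier V \<Longrightarrow> \<ominus> x = (- 1) \<odot> x"
  using smult_l_minus[of 1 x] by simp

lemma scale_eq_zero_cancel: "x \<in> carrier V \<Longrightarrow> c \<odot> x = \<zero> \<Longrightarrow> c \<noteq> 0 \<Longrightarrow> x = \<zero>"
  by (metis left_inverse scale_assoc scale_one scale_zero_right)

lemma scale_finsum: "finite A \<Longrightarrow> f \<in> A \<rightarrow> carrier V \<Longrightarrow> c \<odot> (\<Oplus>i\<in>A. f i) = (\<Oplus>i\<in>A. c \<odot> f i)"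
  using finsum_smult_ldistr[of A c f] by simp

lemma finsum_swap:
  assumes "finite A" "finite B" "\<And>i j. i \<in> A \<Longrightarrow> j \<in> B \<Longrightarrow> f i j \<in> carrier V"
  shows "(\<Oplus>i\<in>A. \<Oplus>j\<in>B. f i j) = (\<Oplus>j\<in>B. \<Oplus>i\<in>A. f i j)"
  using assms(1,3)
proof (induction A rule: finite_induct)
  case (insert a A)
  then show ?case
    using assms(2) finsum_cong'[of B B "\<lambda>j. f a j \<oplus> (\<Oplus>i\<in>A. f i j)" "\<lambda>j. \<Oplus>i\<in>insert a A. f i j"]
    by (simp add: Pi_iff finsum_addf)
qed (simp add: finsum_zero)

lemma finsum_mono_neutral:
  assumes "finite B" "A \<subseteq> B" "f \<in> A \<rightarrow> carrier V" "\<And>i. i \<in> B - A \<Longrightarrow> f i = \<zero>"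
  shows "(\<Oplus>i\<in>A. f i) = (\<Oplus>i\<in>B. f i)"
  using assms by (intro add.finprod_mono_neutral_cong_left) auto

lemma finsum_delta:
  assumes "finite A" "a \<in> A" "f a \<in> carrier V"
  shows "(\<Oplus>i\<in>A. if i = a then f i else \<zero>) = f a"
proof -
  have "(\<Oplus>i\<in>A. if i = a then f i else \<zero>) = (\<Oplus>i\<in>{a}. f i)"
    using assms by (intro finsum_mono_neutral[symmetric] trans[OF add.finprod_mono_neutral_cong_right[of A "{a}" _ f]]) auto
  then show ?thesis using assms(3) by simp
qed

lemma subspaceI:
  assumes "U \<subseteq> carrier V" "\<zero> \<in> U" "\<And>x y. x \<in> U \<Longrightarrow> y \<in> U \<Longrightarrow> x \<oplus> y \<in> U"
    "\<And>c x. x \<in> U \<Longrightarrow> c \<odot> x \<in> U"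
  shows "submodule U ring_of_type_algebra V"
  using assms by (intro submoduleI) (auto simp: minus_eq_scale subset_iff)

lemma subspaceD:
  assumes "submodule U ring_of_type_algebra V"
  shows "U \<subseteq> carrier V" "\<zero> \<in> U" "\<And>x y. x \<in> U \<Longrightarrow> y \<in> U \<Longrightarrow> x \<oplus> y \<in> U"
    "\<And>c x. x \<in> U \<Longrightarrow> c \<odot> x \<in> U" "\<And>x. x \<in> U \<Longrightarrow> \<ominus> x \<in> U" "\<And>x y. x \<in> U \<Longrightarrow> y \<in> U \<Longrightarrow> x \<ominus> y \<in> U"
proof -
  note E = submoduleE[OF assms]
  show "U \<subseteq> carrier V" "\<And>x y. x \<in> U \<Longrightarrow> y \<in> U \<Longrightarrow> x \<oplus> y \<in> U" "\<And>x. x \<in> U \<Longrightarrow> \<ominus> x \<in> U"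
    "\<And>c x. x \<in> U \<Longrightarrow> c \<odot> x \<in> U"
    using E by auto
  show "\<zero> \<in> U" using E by (metis all_not_in_conv scale_zero_left subset_iff UNIV_I ring_of_type_algebra_simps(1))
  show "x \<ominus> y \<in> U" if "x \<in> U" "y \<in> U" for x y using E(3,5) that by (simp add: a_minus_def)
qed

lemma subspace_finsum:
  assumes "submodule U ring_of_type_algebra V" "f \<in> A \<rightarrow> U"
  shows "(\<Oplus>i\<in>A. f i) \<in> U"
  using assms(2)
proof (induction A rule: infinite_finite_induct)
  case (insert a A)
  moreover have "f \<in> A \<rightarrow> carrier V" "f a \<in> carrier V" using insert.prems subspaceD(1)[OF assms(1)] by auto
  ultimately show ?case using subspaceD[OF assms(1)] by (simp add: Pi_iff)
qed (use subspaceD[OF assms(1)] in auto)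

text \<open>Terms outside the support vanish. A common finite index set for several formal
  combinations makes linearity in t a termwise statement.\<close>

lemma lin_ext_superset:
  assumes "finite B" "keys t \<subseteq> B" "\<phi> \<in> B \<rightarrow> carrier V"
  shows "lin_ext V \<phi> t = (\<Oplus>p\<in>B. lookup t p \<odot> \<phi> p)"
  unfolding lin_ext_def using assms
  by (intro finsum_mono_neutral) (auto simp: Pi_iff subset_iff in_keys_iff)

lemma lin_ext_closed:
  assumes "keys t \<subseteq> Y" "\<phi> \<in> Y \<rightarrow> carrier V"
  shows "lin_ext V \<phi> t \<in> carrier V"
  unfolding lin_ext_def using assms by (auto intro!: finsum_closed)

lemma lin_ext_single [simp]: "\<phi> x \<in> carrier V \<Longrightarrow> lin_ext V \<phi> (single x c) = c \<odot> \<phi> x"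
  by (simp add: lin_ext_def)

lemma lin_ext_zero [simp]: "lin_ext V \<phi> 0 = \<zero>"
  by (simp add: lin_ext_def)

lemma lin_ext_add:
  assumes "keys s \<subseteq> Y" "keys t \<subseteq> Y" "\<phi> \<in> Y \<rightarrow> carrier V"
  shows "lin_ext V \<phi> (s + t) = lin_ext V \<phi> s \<oplus> lin_ext V \<phi> t"
proof -
  let ?B = "keys s \<union> keys t"
  have B: "\<phi> \<in> ?B \<rightarrow> carrier V" using assms by auto
  have "lin_ext V \<phi> (s + t) = (\<Oplus>p\<in>?B. lookup (s + t) p \<odot> \<phi> p)"
    using B Poly_Mapping.keys_add[of s t] by (intro lin_ext_superset) auto
  also have "\<dots> = (\<Oplus>p\<in>?B. lookup s p \<odot> \<phi> p \<oplus> lookup t p \<odot> \<phi> p)"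
    using B by (intro finsum_cong') (auto simp: lookup_add scale_left_distrib dest: funcset_mem)
  also have "\<dots> = lin_ext V \<phi> s \<oplus> lin_ext V \<phi> t"
    using B by (subst finsum_addf) (auto simp: lin_ext_superset[of ?B])
  finally show ?thesis .
qed

lemma lin_ext_scale:
  assumes "keys t \<subseteq> Y" "\<phi> \<in> Y \<rightarrow> carrier V"
  shows "lin_ext V \<phi> (Poly_Mapping.map ((*) c) t) = c \<odot> lin_ext V \<phi> t"
proof -
  let ?B = "keys t"
  have B: "\<phi> \<in> ?B \<rightarrow> carrier V" using assms by auto
  have "lin_ext V \<phi> (Poly_Mapping.map ((*) c) t) =
      (\<Oplus>p\<in>?B. lookup (Poly_Mapping.map ((*) c) t) p \<odot> \<phi> p)"
    using B by (intro lin_ext_superset) (auto simp: in_keys_iff Poly_Mapping.map.rep_eq when_def)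
  also have "\<dots> = (\<Oplus>p\<in>?B. c \<odot> (lookup t p \<odot> \<phi> p))"
    using B by (intro finsum_cong') (auto simp: Poly_Mapping.map.rep_eq when_def scale_assoc Pi_iff in_keys_iff)
  also have "\<dots> = c \<odot> lin_ext V \<phi> t"
    unfolding lin_ext_def using B by (subst scale_finsum) auto
  finally show ?thesis .
qed

lemma lin_ext_cong:
  assumes "\<And>x. x \<in> keys t \<Longrightarrow> \<phi> x = \<psi> x" "\<psi> \<in> keys t \<rightarrow> carrier V"
  shows "lin_ext V \<phi> t = lin_ext V \<psi> t"
  unfolding lin_ext_def using assms by (intro finsum_cong') (auto simp: Pi_iff)

end

lemma vec_space_iff: "vec_space V \<longleftrightarrow> vspace V"
  by (simp add: vec_space_def)

lemma linear_mapsI: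
  assumes "\<And>x. x \<in> carrier V \<Longrightarrow> f x \<in> carrier W"
    "\<And>x y. x \<in> carrier V \<Longrightarrow> y \<in> carrier V \<Longrightarrow> f (x \<oplus>\<^bsub>V\<^esub> y) = f x \<oplus>\<^bsub>W\<^esub> f y"
    "\<And>c x. x \<in> carrier V \<Longrightarrow> f (c \<odot>\<^bsub>V\<^esub> x) = c \<odot>\<^bsub>W\<^esub> f x"
  shows "f \<in> linear_maps V W"
  using assms by (auto simp: linear_maps_def)

lemma linear_mapsD:
  assumes "f \<in> linear_maps V W"
  shows "x \<in> carrier V \<Longrightarrow> f x \<in> carrier W"
    "x \<in> carrier V \<Longrightarrow> y \<in> carrier V \<Longrightarrow> f (x \<oplus>\<^bsub>V\<^esub> y) = f x \<oplus>\<^bsub>W\<^esub> f y"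
    "x \<in> carrier V \<Longrightarrow> f (c \<odot>\<^bsub>V\<^esub> x) = c \<odot>\<^bsub>W\<^esub> f x"
  using assms by (auto simp: linear_maps_def)

lemma linear_maps_comp:
  "f \<in> linear_maps U V \<Longrightarrow> g \<in> linear_maps V W \<Longrightarrow> (\<lambda>x. g (f x)) \<in> linear_maps U W"
  by (auto simp: linear_maps_def Pi_iff)

lemma linear_maps_id: "id \<in> linear_maps V V" "(\<lambda>x. x) \<in> linear_maps V V"
  by (auto simp: linear_maps_def)

context
  fixes V :: "('k::field, 'a, 'm) module_scheme" and W :: "('k, 'b, 'n) module_scheme"
  assumes V: "vspace V" and W: "vspace W"
begin

interpretation V: vec_space V using V by (simp add: vec_space_iff)
interpretation W: vec_space W using W by (simp add: vec_space_iff)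

lemma linear_maps_zero: "f \<in> linear_maps V W \<Longrightarrow> f \<zero>\<^bsub>V\<^esub> = \<zero>\<^bsub>W\<^esub>"
  by (metis V.scale_zero_left V.zero_closed W.scale_zero_left linear_mapsD(1) linear_mapsD(3))

lemma linear_maps_minus: "f \<in> linear_maps V W \<Longrightarrow> x \<in> carrier V \<Longrightarrow> f (\<ominus>\<^bsub>V\<^esub> x) = \<ominus>\<^bsub>W\<^esub> f x"
  by (simp add: V.minus_eq_scale W.minus_eq_scale linear_mapsD)

lemma linear_maps_diff:
  "f \<in> linear_maps V W \<Longrightarrow> x \<in> carrier V \<Longrightarrow> y \<in> carrier V \<Longrightarrow> f (x \<ominus>\<^bsub>V\<^esub> y) = f x \<ominus>\<^bsub>W\<^esub> f y"
  by (simp add: a_minus_def linear_mapsD linear_maps_minus)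

lemma linear_maps_finsum:
  assumes "f \<in> linear_maps V W" "\<phi> \<in> A \<rightarrow> carrier V"
  shows "f (\<Oplus>\<^bsub>V\<^esub>i\<in>A. \<phi> i) = (\<Oplus>\<^bsub>W\<^esub>i\<in>A. f (\<phi> i))"
  using assms(2)
proof (induction A rule: infinite_finite_induct)
  case (insert a A)
  then have "\<phi> \<in> A \<rightarrow> carrier V" "\<phi> a \<in> carrier V" by auto
  with insert show ?case
    using linear_mapsD[OF assms(1)] by (simp add: Pi_iff)
qed (use linear_maps_zero[OF assms(1)] in auto)

lemma linear_maps_lin_ext:
  assumes "f \<in> linear_maps V W" "\<phi> \<in> keys t \<rightarrow> carrier V"
  shows "f (lin_ext V \<phi> t) = lin_ext W (\<lambda>x. f (\<phi> x)) t"
  unfolding lin_ext_def using assms linear_mapsD[OF assms(1)]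
  by (subst linear_maps_finsum[OF assms(1)]) (auto intro!: W.finsum_cong' simp: Pi_iff)

text \<open>Stated for preimages of subspaces: U = {0} gives kernels, while in
  \<open>star_u_spanned\<close> U is the span of the group-like elements.\<close>

lemma kernel_subspace:
  assumes "f \<in> linear_maps V W" "submodule U ring_of_type_algebra W"
  shows "submodule {x \<in> carrier V. f x \<in> U} ring_of_type_algebra V"
  using W.subspaceD[OF assms(2)] linear_mapsD[OF assms(1)] linear_maps_zero[OF assms(1)]
  by (intro V.subspaceI) auto

end

lemma scalars_simps [simp]:
  "carrier scalars = UNIV" "x \<oplus>\<^bsub>scalars\<^esub> y = x + y" "\<zero>\<^bsub>scalars\<^esub> = 0" "x \<otimes>\<^bsub>scalars\<^esub> y = x * y"
  "\<one>\<^bsub>scalars\<^esub> = 1" "c \<odot>\<^bsub>scalars\<^esub> x = c * x"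
  by (simp_all add: scalars_def module.defs ring_of_type_algebra_def ring.defs)

lemma vspace_scalars: "vspace (scalars :: ('k::field, 'k) module)"
proof (rule vspaceI)
  show "abelian_group (scalars :: ('k::field, 'k) module)"
    by (rule abelian_groupI) (auto simp: algebra_simps intro: exI[of _ "- _"] left_minus)
qed (auto simp: algebra_simps)

interpretation scalars: vec_space "scalars :: ('k::field, 'k) module"
  by (simp add: vec_space_iff vspace_scalars)

lemma finsum_scalars: "(\<Oplus>\<^bsub>scalars\<^esub>i\<in>A. f i) = (\<Sum>i\<in>A. f i :: 'k::field)"
  by (induction A rule: infinite_finite_induct) auto

lemma minus_scalars [simp]: "\<ominus>\<^bsub>scalars\<^esub> x = - (x :: 'k::field)"
  by (simp add: scalars.minus_eq_scale)

lemma diff_scalars [simp]: "x \<ominus>\<^bsub>scalars\<^esub> y = x - (y :: 'k::field)"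
  by (simp add: a_minus_def)

lemma singleton_zero_subspace: "vspace V \<Longrightarrow> submodule {\<zero>\<^bsub>V\<^esub>} ring_of_type_algebra V"
proof -
  assume "vspace V"
  then interpret vec_space V by (simp add: vec_space_iff)
  show ?thesis by (intro subspaceI) auto
qed

lemma submodule_Inter:
  assumes V: "vspace V" and "\<U> \<noteq> {}" "\<And>U. U \<in> \<U> \<Longrightarrow> submodule U ring_of_type_algebra V"
  shows "submodule (\<Inter>\<U>) ring_of_type_algebra V"
proof -
  interpret vec_space V using V by (simp add: vec_space_iff)
  show ?thesis
  proof (rule subspaceI)
    show "\<Inter>\<U> \<subseteq> carrier V" using assms(2) subspaceD(1)[OF assms(3)] by blast
  qed (use subspaceD(2-4)[OF assms(3)] in blast)+
qed

lemma gen_submodule_submodule: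
  assumes "vspace V" "S \<subseteq> carrier V"
  shows "submodule (gen_submodule V S) ring_of_type_algebra V"
  unfolding gen_submodule_def
proof (rule submodule_Inter[OF assms(1)])
  interpret vec_space V using assms(1) by (simp add: vec_space_iff)
  show "{U. submodule U ring_of_type_algebra V \<and> S \<subseteq> U} \<noteq> {}"
    using carrier_is_submodule assms(2) by blast
qed auto

lemma gen_submodule_incl: "S \<subseteq> gen_submodule V S"
  unfolding gen_submodule_def by blast

lemma gen_submodule_least:
  "submodule U ring_of_type_algebra V \<Longrightarrow> S \<subseteq> U \<Longrightarrow> gen_submodule V S \<subseteq> U"
  unfolding gen_submodule_def by blast

section \<open>Monoid algebras\<close>

lemma monoid_algebra_simps [simp]:
  "carrier (monoid_algebra G) = {f. keys f \<subseteq> carrier G}"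
  "\<zero>\<^bsub>monoid_algebra G\<^esub> = 0" "s \<oplus>\<^bsub>monoid_algebra G\<^esub> t = s + t"
  "c \<odot>\<^bsub>monoid_algebra G\<^esub> t = Poly_Mapping.map ((*) c) t"
  "\<one>\<^bsub>monoid_algebra G\<^esub> = single \<one>\<^bsub>G\<^esub> 1"
  by (simp_all add: monoid_algebra_def)

lemma lookup_map_times [simp]: "lookup (Poly_Mapping.map ((*) c) t) x = c * (lookup t x :: 'k::field)"
  by (simp add: Poly_Mapping.map.rep_eq when_def)

lemma keys_map_times: "keys (Poly_Mapping.map ((*) c) (t :: 'a \<Rightarrow>\<^sub>0 'k::field)) \<subseteq> keys t"
  by (auto simp: in_keys_iff)

lemma poly_mapping_sum_single: "(t :: 'a \<Rightarrow>\<^sub>0 'b::comm_monoid_add) = (\<Sum>p\<in>keys t. single p (lookup t p))"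
proof (rule poly_mapping_eqI)
  fix k
  have "(\<Sum>p\<in>keys t. lookup (single p (lookup t p)) k) =
      (\<Sum>p\<in>keys t. if p = k then lookup t k else 0)"
    by (intro sum.cong) (auto simp: lookup_single when_def)
  also have "\<dots> = lookup t k"
    by (auto simp: in_keys_iff)
  finally show "lookup t k = lookup
      (\<Sum>p\<in>keys t. single p (lookup t p)) k"
    by (simp add: lookup_sum)
qed

text \<open>The monomials of t are added one at a time. Carrying the support along keeps every
  partial sum supported in Y, so the side conditions of the \<open>add\<close> case hold.\<close>

lemma poly_mapping_induct [consumes 1, case_names zero single add]:
  assumes "keys (t :: 'a \<Rightarrow>\<^sub>0 'b::comm_monoid_add) \<subseteq> Y" "P 0" "\<And>x c. x \<in> Y \<Longrightarrow> P (single x c)"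
    "\<And>s t. keys s \<subseteq> Y \<Longrightarrow> keys t \<subseteq> Y \<Longrightarrow> P s \<Longrightarrow> P t \<Longrightarrow> P (s + t)"
  shows "P t"
proof -
  have "keys (\<Sum>p\<in>B. single p (lookup t p)) \<subseteq> Y \<and>
      P (\<Sum>p\<in>B. single p (lookup t p))"
    if "finite B" "B \<subseteq> Y" for B
    using that
  proof (induction B rule: finite_induct)
    case (insert b B)
    then have "keys (single b (lookup t b)) \<subseteq> Y" by simp
    with insert show ?case
      using Poly_Mapping.keys_add[of "single b (lookup t b)"]
      by (auto intro!: assms(3,4))
  qed (use assms(2) in auto)
  from this[OF _ assms(1)] show ?thesis using poly_mapping_sum_single[of t] by auto
qed

lemma keys_add_subset: "keys s \<subseteq> Y \<Longrightarrow> keys t \<subseteq> Y \<Longrightarrow> keys (s + t) \<subseteq> Y"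
  by (rule subset_trans[OF Poly_Mapping.keys_add]) simp

lemma keys_diff_subset:
  "keys s \<subseteq> Y \<Longrightarrow> keys t \<subseteq> Y \<Longrightarrow> keys (s - t :: _ \<Rightarrow>\<^sub>0 'k::field) \<subseteq> Y"
  by (rule subset_trans[OF Poly_Mapping.keys_diff]) simp

lemma keys_sum_subset:
  "(\<And>i. i \<in> A \<Longrightarrow> keys (f i) \<subseteq> Y) \<Longrightarrow> keys (sum f A) \<subseteq> Y"
  by (induction A rule: infinite_finite_induct) (simp_all add: keys_add_subset)

lemma vspace_monoid_algebra: "vspace (monoid_algebra G :: ('k::field, 'g \<Rightarrow>\<^sub>0 'k) module)"
proof (rule vspaceI)
  show "abelian_group (monoid_algebra G :: ('k::field, 'g \<Rightarrow>\<^sub>0 'k) module)"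
  proof (rule abelian_groupI)
    fix x :: "'g \<Rightarrow>\<^sub>0 'k" assume "x \<in> carrier (monoid_algebra G)"
    then show "\<exists>y\<in>carrier (monoid_algebra G). y \<oplus>\<^bsub>monoid_algebra G\<^esub> x = \<zero>\<^bsub>monoid_algebra G\<^esub>"
      by (intro bexI[of _ "- x"]) (auto simp: in_keys_iff)
  qed (auto simp: algebra_simps dest: subsetD[OF Poly_Mapping.keys_add])
  show "c \<odot>\<^bsub>monoid_algebra G\<^esub> x \<in> carrier (monoid_algebra G)" if "x \<in> carrier (monoid_algebra G)"
    for c :: 'k and x using that keys_map_times[of c x] by auto
qed (auto intro!: poly_mapping_eqI simp: lookup_add algebra_simps)

interpretation monoid_algebra: vec_space "monoid_algebra G :: ('k::field, 'g \<Rightarrow>\<^sub>0 'k) module" for G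
  by (simp add: vec_space_iff vspace_monoid_algebra)

lemma minus_monoid_algebra [simp]: "keys t \<subseteq> carrier G \<Longrightarrow> \<ominus>\<^bsub>monoid_algebra G\<^esub> t = - (t :: 'g \<Rightarrow>\<^sub>0 'k::field)"
  by (subst monoid_algebra.minus_eq_scale) (auto intro!: poly_mapping_eqI)

lemma diff_monoid_algebra [simp]:
  "keys t \<subseteq> carrier G \<Longrightarrow> s \<ominus>\<^bsub>monoid_algebra G\<^esub> t = s - (t :: 'g \<Rightarrow>\<^sub>0 'k::field)"
  by (simp add: a_minus_def)

lemma finsum_monoid_algebra:
  "(\<And>i. i \<in> A \<Longrightarrow> keys (f i) \<subseteq> carrier G) \<Longrightarrow>
   (\<Oplus>\<^bsub>monoid_algebra G\<^esub>i\<in>A. f i) = (\<Sum>i\<in>A. f i :: 'g \<Rightarrow>\<^sub>0 'k::field)"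
  by (induction A rule: infinite_finite_induct) (auto simp: Pi_iff)

lemma lin_ext_linear:
  assumes "vspace M" "\<phi> \<in> carrier G \<rightarrow> carrier M"
  shows "lin_ext M \<phi> \<in> linear_maps (monoid_algebra G) M"
proof -
  interpret vec_space M using assms(1) by (simp add: vec_space_iff)
  show ?thesis
    using assms(2) by (intro linear_mapsI) (auto simp: lin_ext_closed lin_ext_add lin_ext_scale)
qed

text \<open>Uniqueness half of the universal property of the free vector space,
  \<open>lin_ext_linear\<close> being the existence half.\<close>

lemma linear_maps_eq_lin_ext:
  assumes "vspace M" "f \<in> linear_maps (monoid_algebra G) M" "keys t \<subseteq> carrier G"
  shows "f t = lin_ext M (\<lambda>x. f (single x 1)) t"
proof -
  interpret vec_space M using assms(1) by (simp add: vec_space_iff)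
  have *: "f (single x c) = c \<odot>\<^bsub>M\<^esub> f (single x 1)" if "x \<in> carrier G" for x c
    using linear_mapsD(3)[OF assms(2), of "single x 1" c] that by simp
  have **: "(\<lambda>x. f (single x 1)) \<in> carrier G \<rightarrow> carrier M"
    using linear_mapsD(1)[OF assms(2)] by auto
  show ?thesis
    using assms(3)
  proof (induction t rule: poly_mapping_induct)
    case zero show ?case using linear_maps_zero[OF vspace_monoid_algebra assms(1,2)] by simp
  next
    case (single x c)
    then have "lin_ext M (\<lambda>x. f (single x 1)) (single x c) = c \<odot>\<^bsub>M\<^esub> f (single x 1)"
      using ** by (intro lin_ext_single) auto
    with *[OF single] show ?case by metis
  next
    case (add s t) then show ?case
      using linear_mapsD(2)[OF assms(2), of s t] by (simp add: lin_ext_add[OF _ _ **])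
  qed
qed

lemma linear_maps_eq_on_singles:
  assumes "vspace M" "f \<in> linear_maps (monoid_algebra G) M" "g \<in> linear_maps (monoid_algebra G) M"
    "\<And>x. x \<in> carrier G \<Longrightarrow> f (single x 1) = g (single x 1)"
    "keys t \<subseteq> carrier G"
  shows "f t = g t"
proof -
  interpret vec_space M using assms(1) by (simp add: vec_space_iff)
  show ?thesis
    using assms linear_mapsD(1)[OF assms(3)]
    by (subst (1 2) linear_maps_eq_lin_ext[OF assms(1) _ assms(5)]) (auto intro!: lin_ext_cong)
qed

section \<open>Quotients\<close>

text \<open>\<open>quot_alg\<close> extends the record \<open>A Quot I\<close>, so the two have
  different types and the ring axioms must be transported through the common fields.\<close>

lemma ring_cong:
  assumes "ring S" "carrier R = carrier S" "monoid.mult R = monoid.mult S" "one R = one S"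
    "zero R = zero S" "add R = add S"
  shows "ring R"
proof -
  interpret S: ring S by fact
  have "abelian_group R"
    using assms(2-6) S.a_assoc S.a_comm S.add.l_inv_ex by (intro abelian_groupI) simp_all
  moreover have "monoid R"
    using assms(2-6) S.m_assoc by (intro monoidI) simp_all
  ultimately show ?thesis
    using assms(2-6) S.l_distr S.r_distr by (intro ringI) simp_all
qed

lemma quot_alg_simps:
  "carrier (quot_alg A I) = (\<lambda>t. I +>\<^bsub>A\<^esub> t) ` carrier A"
  "\<zero>\<^bsub>quot_alg A I\<^esub> = I" "\<one>\<^bsub>quot_alg A I\<^esub> = I +>\<^bsub>A\<^esub> \<one>\<^bsub>A\<^esub>"
  "C \<oplus>\<^bsub>quot_alg A I\<^esub> D = C <+>\<^bsub>A\<^esub> D" "C \<otimes>\<^bsub>quot_alg A I\<^esub> D = rcoset_mult A I C D"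
  "c \<odot>\<^bsub>quot_alg A I\<^esub> C = (\<Union>x\<in>C. I +>\<^bsub>A\<^esub> (c \<odot>\<^bsub>A\<^esub> x))"
  by (auto simp: quot_alg_def FactRing_def ring.defs module.defs A_RCOSETS_def' UNION_singleton_eq_range)

text \<open>The multiplicative structure of A is left open: the locale serves tensor products of
  mere vector spaces as well as \<open>As_algebra\<close>, and the lemmas on products add
  \<open>ideal I A\<close>.\<close>

locale quotient_space = vec_space A for A :: "('k::field, 'a, 'm) module_scheme" (structure) +
  fixes I assumes subspace: "submodule I (ring_of_type_algebra :: 'k ring) A"
begin

sublocale abelian_subgroup I A
  using subspace abelian_group_axioms
  by (intro abelian_subgroupI3) (simp_all add: additive_subgroup_def submodule_def)

lemmas subspace_props = subspaceD[OF subspace]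

lemma coset_eq_iff: "s \<in> carrier A \<Longrightarrow> t \<in> carrier A \<Longrightarrow> I +> s = I +> t \<longleftrightarrow> s \<ominus> t \<in> I"
  using a_rcos_module[of t s] a_repr_independence[OF _ _ a_subgroup, of s t] a_rcos_self[of s]
  unfolding a_minus_def by metis

lemma coset_eq_zero_iff: "t \<in> carrier A \<Longrightarrow> I +> t = I \<longleftrightarrow> t \<in> I"
  using coset_eq_iff[of t \<zero>] subspace_props(1) by (simp add: a_minus_def minus_eq_scale)

lemma quot_add: "s \<in> carrier A \<Longrightarrow> t \<in> carrier A \<Longrightarrow> (I +> s) \<oplus>\<^bsub>quot_alg A I\<^esub> (I +> t) = I +> (s \<oplus> t)"
  by (simp add: quot_alg_simps a_rcos_sum)

lemma quot_scale:
  assumes "t \<in> carrier A" shows "c \<odot>\<^bsub>quot_alg A I\<^esub> (I +> t) = I +> (c \<odot> t)"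
proof -
  \<comment> \<open>The scalar multiple is defined as a union over the whole coset; it is a single
    coset because all representatives yield the same one.\<close>
  have "I +> (c \<odot> x) = I +> (c \<odot> t)" if "x \<in> I +> t" for x
  proof -
    from that obtain i where i: "i \<in> I" "x = i \<oplus> t" by (auto simp: a_r_coset_def')
    then have "i \<in> carrier A" using subspace_props(1) by auto
    then have "c \<odot> x \<ominus> c \<odot> t = c \<odot> i"
      using assms i by (simp add: scale_right_distrib a_minus_def a_assoc r_neg)
    then show ?thesis using i assms subspace_props(4) \<open>i \<in> carrier A\<close> by (subst coset_eq_iff) auto
  qed
  moreover have "t \<in> I +> t" using assms by (rule a_rcos_self)
  ultimately have "(\<Union>x\<in>I +> t. I +> (c \<odot> x)) = (\<Union>x\<in>I +> t. I +> (c \<odot> t))" "I +> t \<noteq> {}"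
    by (blast, blast)
  then show ?thesis unfolding quot_alg_simps by simp
qed

lemma quot_closed: "t \<in> carrier A \<Longrightarrow> I +> t \<in> carrier (quot_alg A I)"
  by (simp add: quot_alg_simps)

lemma quot_cases:
  assumes "C \<in> carrier (quot_alg A I)" obtains t where "t \<in> carrier A" "C = I +> t"
  using assms by (auto simp: quot_alg_simps)

lemma quot_zero: "\<zero>\<^bsub>quot_alg A I\<^esub> = I +> \<zero>"
  using subspace_props(1) by (simp add: quot_alg_simps)

lemma vspace_quot: "vspace (quot_alg A I)"
proof (rule vspaceI)
  show "abelian_group (quot_alg A I)"
  proof (rule abelian_groupI)
    fix x assume "x \<in> carrier (quot_alg A I)"
    then obtain t where "t \<in> carrier A" "x = I +> t" by (rule quot_cases)
    then show "\<exists>y\<in>carrier (quot_alg A I). y \<oplus>\<^bsub>quot_alg A I\<^esub> x = \<zero>\<^bsub>quot_alg A I\<^esub>"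
      by (intro bexI[of _ "I +> \<ominus> t"]) (simp_all add: quot_add quot_zero quot_closed l_neg)
  next
    fix x y z
    assume "x \<in> carrier (quot_alg A I)" "y \<in> carrier (quot_alg A I)" "z \<in> carrier (quot_alg A I)"
    then show "x \<oplus>\<^bsub>quot_alg A I\<^esub> y \<oplus>\<^bsub>quot_alg A I\<^esub> z = x \<oplus>\<^bsub>quot_alg A I\<^esub> (y \<oplus>\<^bsub>quot_alg A I\<^esub> z)"
      by (elim quot_cases) (simp add: quot_add a_assoc)
  next
    fix x y assume "x \<in> carrier (quot_alg A I)" "y \<in> carrier (quot_alg A I)"
    then show "x \<oplus>\<^bsub>quot_alg A I\<^esub> y = y \<oplus>\<^bsub>quot_alg A I\<^esub> x"
      "x \<oplus>\<^bsub>quot_alg A I\<^esub> y \<in> carrier (quot_alg A I)"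
      by (elim quot_cases, simp add: quot_add quot_closed a_comm)+
  next
    fix x assume "x \<in> carrier (quot_alg A I)"
    then show "\<zero>\<^bsub>quot_alg A I\<^esub> \<oplus>\<^bsub>quot_alg A I\<^esub> x = x"
      by (elim quot_cases) (simp add: quot_add quot_zero del: a_coset_add_zero)
  qed (simp add: quot_zero quot_closed del: a_coset_add_zero)
next
  fix c d x assume "x \<in> carrier (quot_alg A I)"
  then obtain t where t: "t \<in> carrier A" "x = I +> t" by (rule quot_cases)
  then show "c \<odot>\<^bsub>quot_alg A I\<^esub> x \<in> carrier (quot_alg A I)" "1 \<odot>\<^bsub>quot_alg A I\<^esub> x = x"
    "(c + d) \<odot>\<^bsub>quot_alg A I\<^esub> x = c \<odot>\<^bsub>quot_alg A I\<^esub> x \<oplus>\<^bsub>quot_alg A I\<^esub> d \<odot>\<^bsub>quot_alg A I\<^esub> x"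
    "(c * d) \<odot>\<^bsub>quot_alg A I\<^esub> x = c \<odot>\<^bsub>quot_alg A I\<^esub> (d \<odot>\<^bsub>quot_alg A I\<^esub> x)"
    by (simp_all add: quot_add quot_scale quot_closed scale_left_distrib scale_assoc)
next
  fix c x y assume "x \<in> carrier (quot_alg A I)" "y \<in> carrier (quot_alg A I)"
  then show "c \<odot>\<^bsub>quot_alg A I\<^esub> (x \<oplus>\<^bsub>quot_alg A I\<^esub> y) = c \<odot>\<^bsub>quot_alg A I\<^esub> x \<oplus>\<^bsub>quot_alg A I\<^esub> c \<odot>\<^bsub>quot_alg A I\<^esub> y"
    by (elim quot_cases) (simp add: quot_add quot_scale quot_closed scale_right_distrib)
qed

lemma coset_linear: "(\<lambda>t. I +> t) \<in> linear_maps A (quot_alg A I)"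
  by (intro linear_mapsI) (auto simp: quot_add quot_scale quot_closed)

lemma quot_mult_ideal:
  assumes "ideal I A" "s \<in> carrier A" "t \<in> carrier A"
  shows "(I +> s) \<otimes>\<^bsub>quot_alg A I\<^esub> (I +> t) = I +> (s \<otimes> t)"
  using ideal.rcoset_mult_add[OF assms] by (simp add: quot_alg_simps)

lemma ring_quot:
  assumes "ideal I A" shows "ring (quot_alg A I)"
proof -
  have "ring (A Quot I)" using assms by (rule ideal.quotient_is_ring)
  moreover have "carrier (quot_alg A I) = carrier (A Quot I)" "monoid.mult (quot_alg A I) = monoid.mult (A Quot I)"
    "one (quot_alg A I) = one (A Quot I)" "zero (quot_alg A I) = zero (A Quot I)"
    "add (quot_alg A I) = add (A Quot I)"
    by (simp_all add: quot_alg_def ring.defs)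
  ultimately show ?thesis by (rule ring_cong)
qed

lemma unital_algebra_quot:
  assumes "unital_algebra A" "ideal I A" shows "unital_algebra (quot_alg A I)"
proof -
  interpret ring A using assms(1) by (simp add: unital_algebra_def)
  have *: "\<And>c x y. x \<in> carrier A \<Longrightarrow> y \<in> carrier A \<Longrightarrow> (c \<odot> x) \<otimes> y = c \<odot> (x \<otimes> y) \<and> x \<otimes> (c \<odot> y) = c \<odot> (x \<otimes> y)"
    using assms(1) by (simp add: unital_algebra_def)
  show ?thesis
    unfolding unital_algebra_def
  proof (intro conjI allI ballI)
    fix c x y assume "x \<in> carrier (quot_alg A I)" "y \<in> carrier (quot_alg A I)"
    then obtain s t where st: "s \<in> carrier A" "x = I +> s" "t \<in> carrier A" "y = I +> t" by (metis quot_cases)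
    then show "(c \<odot>\<^bsub>quot_alg A I\<^esub> x) \<otimes>\<^bsub>quot_alg A I\<^esub> y = c \<odot>\<^bsub>quot_alg A I\<^esub> (x \<otimes>\<^bsub>quot_alg A I\<^esub> y)"
      "x \<otimes>\<^bsub>quot_alg A I\<^esub> (c \<odot>\<^bsub>quot_alg A I\<^esub> y) = c \<odot>\<^bsub>quot_alg A I\<^esub> (x \<otimes>\<^bsub>quot_alg A I\<^esub> y)"
      using * by (simp_all add: quot_scale quot_mult_ideal[OF assms(2)])
  qed (use ring_quot[OF assms(2)] vspace_quot in auto)
qed

end

lemma the_elem_image_constant: "x \<in> C \<Longrightarrow> (\<And>y. y \<in> C \<Longrightarrow> f y = f x) \<Longrightarrow> the_elem (f ` C) = f x"
proof -
  assume "x \<in> C" "\<And>y. y \<in> C \<Longrightarrow> f y = f x"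
  then have "f ` C = {f x}" by blast
  then show ?thesis by simp
qed

text \<open>Two representatives of the coset differ by an element of K, on which the linear
  extension vanishes. The image of the coset is therefore a singleton and \<open>the_elem\<close>
  returns its member.\<close>

lemma induced_coset:
  assumes "vspace M" "\<phi> \<in> carrier G \<rightarrow> carrier M" "submodule K ring_of_type_algebra (monoid_algebra G)"
    "\<And>k. k \<in> K \<Longrightarrow> lin_ext M \<phi> k = \<zero>\<^bsub>M\<^esub>" "keys t \<subseteq> carrier G"
  shows "induced M \<phi> (K +>\<^bsub>monoid_algebra G\<^esub> t) = lin_ext M \<phi> t"
  unfolding induced_def
proof (rule the_elem_image_constant)
  interpret M: vec_space M using assms(1) by (simp add: vec_space_iff)
  interpret Q: quotient_space "monoid_algebra G" K
    using assms(3) monoid_algebra.vec_space_axioms by (simp add: quotient_space_def quotient_space_axioms_def)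
  show "t \<in> K +>\<^bsub>monoid_algebra G\<^esub> t" using assms(5) by (intro Q.a_rcos_self) simp
  fix y assume "y \<in> K +>\<^bsub>monoid_algebra G\<^esub> t"
  then obtain k where "k \<in> K" "y = k + t" by (auto simp: a_r_coset_def')
  then show "lin_ext M \<phi> y = lin_ext M \<phi> t"
    using Q.subspace_props(1) assms(4,5) M.lin_ext_closed[OF assms(5,2)]
    by (auto simp: M.lin_ext_add[OF _ assms(5,2)] subset_iff)
qed

lemma (in abelian_group) add_minus_minus:
  "a \<in> carrier G \<Longrightarrow> b \<in> carrier G \<Longrightarrow> a \<oplus> b \<ominus> a \<ominus> b = \<zero>"
  by (simp add: minus_eq a_comm[of a b] a_assoc r_neg)

lemma (in vec_space) lin_ext_diff:
  assumes "keys s \<subseteq> Y" "keys t \<subseteq> Y" "\<phi> \<in> Y \<rightarrow> carrier V"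
  shows "lin_ext V \<phi> (s - t) = lin_ext V \<phi> s \<ominus> lin_ext V \<phi> t"
proof -
  have "s - t = s + Poly_Mapping.map ((*) (-1)) t"
    by (rule poly_mapping_eqI) (simp add: lookup_minus lookup_add)
  then have "lin_ext V \<phi> (s - t) = lin_ext V \<phi> s \<oplus> (-1) \<odot> lin_ext V \<phi> t"
    using lin_ext_add[OF assms(1) order_trans[OF keys_map_times assms(2)] assms(3), of "-1"]
    by (simp only: lin_ext_scale[OF assms(2,3)])
  then show ?thesis
    using lin_ext_closed[OF assms(2,3)] by (simp only: minus_eq minus_eq_scale)
qed

section \<open>Functionals\<close>

lemma map_times_single [simp]: "Poly_Mapping.map ((*) c) (single x a) = single x (c * a :: 'k::field)"
  by (rule poly_mapping_eqI) (simp add: lookup_single when_def)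

text \<open>Extend a basis B of U by x, which stays independent because x is outside the span, and
  prescribe 1 at x and 0 on B.\<close>

lemma (in vector_space) exists_separating_functional:
  assumes "subspace U" "x \<notin> U"
  shows "\<exists>g. Vector_Spaces.linear scale (*) g \<and> g x = 1 \<and> (\<forall>u\<in>U. g u = 0)"
proof -
  interpret K: vector_space "(*) :: 'a \<Rightarrow> 'a \<Rightarrow> 'a"
    by unfold_locales (simp_all add: algebra_simps)
  interpret P: vector_space_pair scale "(*) :: 'a \<Rightarrow> 'a \<Rightarrow> 'a" ..
  obtain B where B: "B \<subseteq> U" "independent B" "U \<subseteq> span B"
    using maximal_independent_subset[of U] by blast
  have "span B = U"
    using B(1,3) assms(1) by (metis span_minimal subset_antisym)
  then have x: "x \<notin> span B" using assms(2) by simp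
  then have "independent (insert x B)"
    using B(2) by (rule independent_insertI)
  from P.linear_independent_extend[OF this, of "\<lambda>b. if b = x then 1 else 0"]
  obtain g where g: "Vector_Spaces.linear scale (*) g" "\<forall>b\<in>insert x B. g b = (if b = x then 1 else 0)"
    by blast
  have "x \<notin> B" using x span_base by blast
  then have "\<And>b. b \<in> B \<Longrightarrow> g b = 0" using g(2) by auto
  then have "\<And>u. u \<in> span B \<Longrightarrow> g u = 0"
    using P.linear_eq_0_on_span[OF g(1)] by blast
  then show ?thesis using g \<open>span B = U\<close> by (intro exI[of _ g]) auto
qed

interpretation poly_mapping: vector_space "\<lambda>c. Poly_Mapping.map ((*) (c :: 'k::field)) :: ('a \<Rightarrow>\<^sub>0 'k) \<Rightarrow> _"
  by unfold_locales (auto intro!: poly_mapping_eqI simp: lookup_add algebra_simps)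

abbreviation dual :: "('k::field, 'a, 'm) module_scheme \<Rightarrow> ('a \<Rightarrow> 'k) set" where
  "dual V \<equiv> linear_maps V scalars"

lemma dual_simps:
  assumes "f \<in> dual V"
  shows "x \<in> carrier V \<Longrightarrow> y \<in> carrier V \<Longrightarrow> f (x \<oplus>\<^bsub>V\<^esub> y) = f x + f y"
    "x \<in> carrier V \<Longrightarrow> f (c \<odot>\<^bsub>V\<^esub> x) = c * f x"
  using linear_mapsD[OF assms] by auto

lemma dual_finsum:
  "vspace V \<Longrightarrow> f \<in> dual V \<Longrightarrow> \<phi> \<in> A \<rightarrow> carrier V \<Longrightarrow> f (\<Oplus>\<^bsub>V\<^esub>i\<in>A. \<phi> i) = (\<Sum>i\<in>A. f (\<phi> i))"
  using linear_maps_finsum[OF _ vspace_scalars] by (simp add: finsum_scalars)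

lemma dual_zero: "vspace V \<Longrightarrow> f \<in> dual V \<Longrightarrow> f \<zero>\<^bsub>V\<^esub> = 0"
  using linear_maps_zero[OF _ vspace_scalars] by simp

text \<open>The functional is constructed on the free vector space on \<open>'a\<close>, which has full carrier, so
  that the type-based theory of vector spaces applies.\<close>

lemma exists_separating_dual:
  fixes V :: "('k::field, 'a, 'm) module_scheme"
  assumes V: "vspace V" and U: "submodule U ring_of_type_algebra V" and x: "x \<in> carrier V" "x \<notin> U"
  shows "\<exists>f\<in>dual V. f x = 1 \<and> (\<forall>u\<in>U. f u = 0)"
proof -
  interpret V: vec_space V using V by (simp add: vec_space_iff)
  note U' = V.subspaceD[OF U]
  \<comment> \<open>The preimage of U under evaluation of formal combinations in V. It contains the
    relations that express additivity and homogeneity, so a functional vanishing on N descends to a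
    linear functional on V.\<close>
  define N where "N = {t. keys t \<subseteq> carrier V \<and> lin_ext V (\<lambda>x. x) t \<in> U}"
  have id: "(\<lambda>x. x) \<in> carrier V \<rightarrow> carrier V" by simp
  have N: "poly_mapping.subspace N"
    unfolding N_def using U'(2-4)
    by (intro poly_mapping.subspaceI)
      (simp_all add: V.lin_ext_add[OF _ _ id] V.lin_ext_scale[OF _ id] keys_add_subset
        order_trans[OF keys_map_times])
  have "single x 1 \<notin> N" using x by (simp add: N_def)
  from poly_mapping.exists_separating_functional[OF N this]
  obtain g where g: "Vector_Spaces.linear (\<lambda>c. Poly_Mapping.map ((*) c)) (*) g"
    "g (single x 1) = 1" "\<And>t. t \<in> N \<Longrightarrow> g t = 0" by blast
  interpret g: Vector_Spaces.linear "\<lambda>c. Poly_Mapping.map ((*) (c :: 'k))" "(*)" g by (rule g(1))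
  define f where "f y = g (single y 1)" for y
  have f_add: "f (y \<oplus>\<^bsub>V\<^esub> z) = f y + f z" if yz: "y \<in> carrier V" "z \<in> carrier V" for y z
  proof -
    let ?s = "single y (1::'k) + single z 1"
    have "lin_ext V (\<lambda>x. x) (single (y \<oplus>\<^bsub>V\<^esub> z) 1 - ?s) = \<zero>\<^bsub>V\<^esub>"
      using yz by (simp add: V.lin_ext_add[OF _ _ id] V.lin_ext_diff[OF _ _ id] keys_add_subset
         V.minus_eq V.r_neg)
    then have "single (y \<oplus>\<^bsub>V\<^esub> z) 1 - ?s \<in> N"
      using yz U'(2) by (simp add: N_def keys_add_subset keys_diff_subset)
    from g(3)[OF this] show ?thesis by (simp only: g.add g.diff f_def) simp
  qed
  have f_scale: "f (c \<odot>\<^bsub>V\<^esub> y) = c * f y" if y: "y \<in> carrier V" for c y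
  proof -
    let ?t = "single (c \<odot>\<^bsub>V\<^esub> y) 1 - Poly_Mapping.map ((*) c) (single y 1)"
    have "lin_ext V (\<lambda>x. x) ?t = \<zero>\<^bsub>V\<^esub>"
      using y by (simp add: V.lin_ext_diff[OF _ _ id] V.minus_eq V.r_neg)
    then have "?t \<in> N" unfolding N_def
      using y U'(2) by (simp add: keys_diff_subset)
    from g(3)[OF this] show ?thesis by (simp only: g.diff g.scale f_def) simp
  qed
  have "f u = 0" if "u \<in> U" for u
    unfolding f_def using that U'(1) by (intro g(3)) (auto simp: N_def)
  then show ?thesis
    using f_add f_scale g(2) by (intro bexI[of _ f]) (auto simp: f_def intro!: linear_mapsI)
qed

text \<open>If x and y differed, \<open>exists_separating_dual\<close> for the zero subspace would
  give a functional with value 1 at their difference.\<close>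

lemma dual_separates:
  assumes V: "vspace V" and "x \<in> carrier V" "y \<in> carrier V" "\<And>f. f \<in> dual V \<Longrightarrow> f x = f y"
  shows "x = y"
proof (rule ccontr)
  interpret V: vec_space V using V by (simp add: vec_space_iff)
  assume "x \<noteq> y"
  then have "x \<ominus>\<^bsub>V\<^esub> y \<notin> {\<zero>\<^bsub>V\<^esub>}" using assms V.minus_equality by (auto simp: a_minus_def)
      (metis V.add.inv_closed V.add.inv_inv V.minus_equality)
  then obtain f where f: "f \<in> dual V" "f (x \<ominus>\<^bsub>V\<^esub> y) = 1"
    using exists_separating_dual[OF V singleton_zero_subspace[OF V]] assms by (meson V.minus_closed)
  then have "f x - f y = 1"
    using linear_maps_diff[OF V vspace_scalars f(1)] assms by simp
  then show False using assms(4)[OF f(1)] by simp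
qed

section \<open>The multiplication of monoid algebras\<close>

text \<open>The defining sum runs over the supports of the factors, which change under addition.
  With larger finite index sets several products share one index set, and the distributive laws
  become termwise.\<close>

lemma monoid_algebra_mult:
  assumes "finite A" "finite B" "keys s \<subseteq> A" "keys t \<subseteq> B"
  shows "s \<otimes>\<^bsub>monoid_algebra G\<^esub> t = (\<Sum>x\<in>A. \<Sum>y\<in>B.
    single (x \<otimes>\<^bsub>G\<^esub> y) (lookup s x * lookup t y :: 'k::field))"
proof -
  have "s \<otimes>\<^bsub>monoid_algebra G\<^esub> t = (\<Sum>x\<in>keys s. \<Sum>y\<in>B.
    single (x \<otimes>\<^bsub>G\<^esub> y) (lookup s x * lookup t y :: 'k::field))"
    unfolding monoid_algebra_def using assms
    by (simp, intro sum.cong refl sum.mono_neutral_left) (auto simp: in_keys_iff)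
  also have "\<dots> = (\<Sum>x\<in>A. \<Sum>y\<in>B.
    single (x \<otimes>\<^bsub>G\<^esub> y) (lookup s x * lookup t y :: 'k::field))"
    using assms by (intro sum.mono_neutral_left) (auto simp: in_keys_iff)
  finally show ?thesis .
qed

lemma monoid_algebra_mult_single [simp]:
  "single x a \<otimes>\<^bsub>monoid_algebra G\<^esub> single y b =
   single (x \<otimes>\<^bsub>G\<^esub> y) (a * b :: 'k::field)"
  by (subst monoid_algebra_mult[of "{x}" "{y}"]) auto

lemma monoid_algebra_l_distr:
  "(s + s') \<otimes>\<^bsub>monoid_algebra G\<^esub> t = s \<otimes>\<^bsub>monoid_algebra G\<^esub> t + s' \<otimes>\<^bsub>monoid_algebra G\<^esub> (t :: 'g \<Rightarrow>\<^sub>0 'k::field)"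
proof -
  let ?A = "keys s \<union> keys s'" and ?B = "keys t"
  show ?thesis
    using Poly_Mapping.keys_add[of s s']
    by (simp add: monoid_algebra_mult[of ?A ?B] lookup_add distrib_right single_add sum.distrib)
qed

lemma monoid_algebra_r_distr:
  "t \<otimes>\<^bsub>monoid_algebra G\<^esub> (s + s') = t \<otimes>\<^bsub>monoid_algebra G\<^esub> s + t \<otimes>\<^bsub>monoid_algebra G\<^esub> (s' :: 'g \<Rightarrow>\<^sub>0 'k::field)"
proof -
  let ?A = "keys s \<union> keys s'" and ?B = "keys t"
  show ?thesis
    using Poly_Mapping.keys_add[of s s']
    by (simp add: monoid_algebra_mult[of ?B ?A] lookup_add distrib_left single_add sum.distrib)
qed

lemma map_times_sum:
  "Poly_Mapping.map ((*) c) (sum f A) = (\<Sum>i\<in>A. Poly_Mapping.map ((*) c) (f i :: 'g \<Rightarrow>\<^sub>0 'k::field))"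
  by (rule poly_mapping_eqI) (simp add: lookup_sum sum_distrib_left)

lemma monoid_algebra_scale_mult:
  "Poly_Mapping.map ((*) c) s \<otimes>\<^bsub>monoid_algebra G\<^esub> t = Poly_Mapping.map ((*) c) (s \<otimes>\<^bsub>monoid_algebra G\<^esub> (t :: 'g \<Rightarrow>\<^sub>0 'k::field))"
  "s \<otimes>\<^bsub>monoid_algebra G\<^esub> Poly_Mapping.map ((*) c) t = Poly_Mapping.map ((*) c) (s \<otimes>\<^bsub>monoid_algebra G\<^esub> t)"
  using keys_map_times[of c s] keys_map_times[of c t]
  by (simp_all add: monoid_algebra_mult[of "keys s" "keys t"] map_times_sum mult_ac)

lemma monoid_algebra_zero_mult [simp]:
  "0 \<otimes>\<^bsub>monoid_algebra G\<^esub> t = (0 :: 'g \<Rightarrow>\<^sub>0 'k::field)" "t \<otimes>\<^bsub>monoid_algebra G\<^esub> 0 = (0 :: 'g \<Rightarrow>\<^sub>0 'k::field)"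
  by (simp_all add: monoid_algebra_def)

lemma ring_monoid_algebra:
  assumes "monoid G" shows "ring (monoid_algebra G :: ('k::field, 'g \<Rightarrow>\<^sub>0 'k) module)"
proof -
  interpret G: monoid G by fact
  let ?A = "monoid_algebra G :: ('k::field, 'g \<Rightarrow>\<^sub>0 'k) module"
  have closed: "keys (s \<otimes>\<^bsub>?A\<^esub> t) \<subseteq> carrier G"
    if s: "keys s \<subseteq> carrier G" and t: "keys t \<subseteq> carrier G" for s t
    unfolding monoid_algebra_mult[OF finite_keys finite_keys order_refl order_refl]
    using s t by (intro keys_sum_subset) auto
  have one: "single \<one>\<^bsub>G\<^esub> 1 \<otimes>\<^bsub>?A\<^esub> t = t \<and> t \<otimes>\<^bsub>?A\<^esub> single \<one>\<^bsub>G\<^esub> 1 = t"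
    if "keys t \<subseteq> carrier G" for t
    using that by (induction t rule: poly_mapping_induct) (auto simp: monoid_algebra_l_distr monoid_algebra_r_distr)
  \<comment> \<open>Both sides are additive in each factor, so nested inductions reduce
    associativity to basis elements, where it is that of G.\<close>
  have assoc: "(r \<otimes>\<^bsub>?A\<^esub> s) \<otimes>\<^bsub>?A\<^esub> t = r \<otimes>\<^bsub>?A\<^esub> (s \<otimes>\<^bsub>?A\<^esub> t)"
    if r: "keys r \<subseteq> carrier G" and s: "keys s \<subseteq> carrier G"
      and t: "keys t \<subseteq> carrier G" for r s t
    using r
  proof (induction r rule: poly_mapping_induct)
    case (single x c)
    show ?case using s
    proof (induction s rule: poly_mapping_induct)
      case (single y d)
      show ?case using t
        by (induction t rule: poly_mapping_induct)
          (use \<open>x \<in> carrier G\<close> single in \<open>auto simp: monoid_algebra_l_distr monoid_algebra_r_distr G.m_assoc mult.assoc\<close>)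
    qed (auto simp: monoid_algebra_l_distr monoid_algebra_r_distr)
  qed (auto simp: monoid_algebra_l_distr monoid_algebra_r_distr)
  have "monoid ?A"
    using closed one assoc by (intro monoidI) auto
  with monoid_algebra.abelian_group_axioms show ?thesis
    by (intro ringI) (auto simp: monoid_algebra_l_distr monoid_algebra_r_distr)
qed

lemma unital_algebra_monoid_algebra:
  "monoid G \<Longrightarrow> unital_algebra (monoid_algebra G :: ('k::field, 'g \<Rightarrow>\<^sub>0 'k) module)"
  unfolding unital_algebra_def
  by (intro conjI ring_monoid_algebra vspace_monoid_algebra) (simp_all add: monoid_algebra_scale_mult)

section \<open>Tensor products\<close>

text \<open>The map takes a pair because \<open>lin_ext\<close> and \<open>induced\<close> are
  applied to families indexed by the basis of pairs of the free vector space.\<close>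

definition bilinear_map ::
  "('k::field, 'a, 'm) module_scheme \<Rightarrow> ('k, 'b, 'n) module_scheme \<Rightarrow> ('k, 'c, 'l) module_scheme \<Rightarrow>
   ('a \<times> 'b \<Rightarrow> 'c) \<Rightarrow> bool" where
  "bilinear_map V W M \<phi> \<longleftrightarrow> (\<forall>y\<in>carrier W. (\<lambda>x. \<phi> (x, y)) \<in> linear_maps V M) \<and>
     (\<forall>x\<in>carrier V. (\<lambda>y. \<phi> (x, y)) \<in> linear_maps W M)"

lemma carrier_DirProd [simp]: "carrier (V \<times>\<times> W) = carrier V \<times> carrier W"
  by (simp add: DirProd_def)

lemma mult_DirProd' [simp]: "(x, y) \<otimes>\<^bsub>V \<times>\<times> W\<^esub> (x', y') = (x \<otimes>\<^bsub>V\<^esub> x', y \<otimes>\<^bsub>W\<^esub> y')"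
  by (simp add: DirProd_def)

context
  fixes V :: "('k::field, 'a, 'm) module_scheme" and W :: "('k, 'b, 'n) module_scheme"
  assumes V: "vspace V" and W: "vspace W"
begin

interpretation V: vec_space V using V by (simp add: vec_space_iff)
interpretation W: vec_space W using W by (simp add: vec_space_iff)

lemma bilinear_rels_subset: "bilinear_rels V W \<subseteq> carrier (monoid_algebra (V \<times>\<times> W))"
  unfolding bilinear_rels_def by (rule subsetI) (elim UnE CollectE exE conjE; simp add: keys_diff_subset)

lemma tensor_kernel_submodule:
  "submodule (tensor_kernel V W) ring_of_type_algebra (monoid_algebra (V \<times>\<times> W))"
  unfolding tensor_kernel_def by (rule gen_submodule_submodule[OF vspace_monoid_algebra bilinear_rels_subset])

interpretation Q: quotient_space "monoid_algebra (V \<times>\<times> W)" "tensor_kernel V W"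
  using tensor_kernel_submodule monoid_algebra.vec_space_axioms
  by (simp add: quotient_space_def quotient_space_axioms_def)

lemma vspace_tensor: "vspace (tensor V W)"
  unfolding tensor_def by (rule Q.vspace_quot)

interpretation T: vec_space "tensor V W" using vspace_tensor by (simp add: vec_space_iff)

lemma tensor_class_linear: "tensor_class V W \<in> linear_maps (monoid_algebra (V \<times>\<times> W)) (tensor V W)"
  using Q.coset_linear unfolding tensor_class_def[abs_def] tensor_def .

lemma tensor_class_eq_iff:
  "keys s \<subseteq> carrier V \<times> carrier W \<Longrightarrow> keys t \<subseteq> carrier V \<times> carrier W \<Longrightarrow>
   tensor_class V W s = tensor_class V W t \<longleftrightarrow> s - t \<in> tensor_kernel V W"
  unfolding tensor_class_def by (subst Q.coset_eq_iff) auto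

lemma tensor_cases:
  assumes "C \<in> carrier (tensor V W)"
  obtains t where "keys t \<subseteq> carrier V \<times> carrier W" "C = tensor_class V W t"
  using assms unfolding tensor_def tensor_class_def by (elim Q.quot_cases) auto

lemma pure_tensor_closed [simp]:
  "x \<in> carrier V \<Longrightarrow> y \<in> carrier W \<Longrightarrow> pure_tensor V W x y \<in> carrier (tensor V W)"
  unfolding pure_tensor_def by (rule linear_mapsD(1)[OF tensor_class_linear]) simp

lemma tensor_class_lin_ext:
  "keys t \<subseteq> carrier V \<times> carrier W \<Longrightarrow>
   tensor_class V W t = lin_ext (tensor V W) (\<lambda>(x, y). pure_tensor V W x y) t"
  using linear_maps_eq_lin_ext[OF vspace_tensor tensor_class_linear, of t]
  by (simp add: pure_tensor_def case_prod_unfold)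

lemma tensor_class_single_scale:
  "x \<in> carrier V \<Longrightarrow> y \<in> carrier W \<Longrightarrow> tensor_class V W (single (x, y) c) = c \<odot>\<^bsub>tensor V W\<^esub> pure_tensor V W x y"
  using linear_mapsD(3)[OF tensor_class_linear, of "single (x, y) 1" c] by (simp add: pure_tensor_def)

lemma tensor_class_diff:
  "keys s \<subseteq> carrier V \<times> carrier W \<Longrightarrow> keys t \<subseteq> carrier V \<times> carrier W \<Longrightarrow>
   tensor_class V W (s - t) = tensor_class V W s \<ominus>\<^bsub>tensor V W\<^esub> tensor_class V W t"
  using linear_maps_diff[OF vspace_monoid_algebra vspace_tensor tensor_class_linear, of s t] by simp

text \<open>A bilinear map kills the four families of relations, and the kernel of its linear
  extension is a subspace; hence it contains the subspace which they span. This makes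
  \<open>induced\<close> well defined on tensors.\<close>

lemma lin_ext_bilinear_kernel:
  assumes M: "vspace M" and \<phi>: "bilinear_map V W M \<phi>" and "k \<in> tensor_kernel V W"
  shows "lin_ext M \<phi> k = \<zero>\<^bsub>M\<^esub>"
proof -
  interpret M: vec_space M using M by (simp add: vec_space_iff)
  have \<phi>_closed: "\<phi> \<in> carrier (V \<times>\<times> W) \<rightarrow> carrier M"
    using \<phi> by (auto simp: bilinear_map_def linear_maps_def)
  note lin = lin_ext_linear[OF M \<phi>_closed]
  note diff = M.lin_ext_diff[OF _ _ \<phi>_closed]
  let ?U = "{t \<in> carrier (monoid_algebra (V \<times>\<times> W)). lin_ext M \<phi> t \<in> {\<zero>\<^bsub>M\<^esub>}}"
  have sub: "submodule ?U ring_of_type_algebra (monoid_algebra (V \<times>\<times> W))"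
    by (rule kernel_subspace[OF vspace_monoid_algebra M lin singleton_zero_subspace[OF M]])
  have cl: "\<phi> (x, y) \<in> carrier M" if "x \<in> carrier V" "y \<in> carrier W" for x y
    using \<phi>_closed that by auto
  have "bilinear_rels V W \<subseteq> ?U"
  proof
    fix r assume r: "r \<in> bilinear_rels V W"
    then have "r \<in> carrier (monoid_algebra (V \<times>\<times> W))" using bilinear_rels_subset by blast
    moreover have "lin_ext M \<phi> r = \<zero>\<^bsub>M\<^esub>"
      using r[unfolded bilinear_rels_def]
    proof (elim UnE CollectE exE conjE)
      fix x x' y assume r: "r = single (x \<oplus>\<^bsub>V\<^esub> x', y) 1 - single (x, y) 1 - single (x', y) 1"
        and x: "x \<in> carrier V" "x' \<in> carrier V" "y \<in> carrier W"
      then have "\<phi> (x \<oplus>\<^bsub>V\<^esub> x', y) = \<phi> (x, y) \<oplus>\<^bsub>M\<^esub> \<phi> (x', y)"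
        using \<phi> by (simp add: bilinear_map_def linear_maps_def)
      then show "lin_ext M \<phi> r = \<zero>\<^bsub>M\<^esub>" using x cl
        by (simp add: r diff keys_diff_subset M.add_minus_minus)
    next
      fix x y y' assume r: "r = single (x, y \<oplus>\<^bsub>W\<^esub> y') 1 - single (x, y) 1 - single (x, y') 1"
        and x: "x \<in> carrier V" "y \<in> carrier W" "y' \<in> carrier W"
      then have "\<phi> (x, y \<oplus>\<^bsub>W\<^esub> y') = \<phi> (x, y) \<oplus>\<^bsub>M\<^esub> \<phi> (x, y')"
        using \<phi> by (simp add: bilinear_map_def linear_maps_def)
      then show "lin_ext M \<phi> r = \<zero>\<^bsub>M\<^esub>" using x cl
        by (simp add: r diff keys_diff_subset M.add_minus_minus)
    next
      fix c x y assume r: "r = single (c \<odot>\<^bsub>V\<^esub> x, y) 1 - single (x, y) c"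
        and x: "x \<in> carrier V" "y \<in> carrier W"
      then have "\<phi> (c \<odot>\<^bsub>V\<^esub> x, y) = c \<odot>\<^bsub>M\<^esub> \<phi> (x, y)"
        using \<phi> by (simp add: bilinear_map_def linear_maps_def)
      then show "lin_ext M \<phi> r = \<zero>\<^bsub>M\<^esub>" using x cl by (simp add: r diff M.minus_eq M.r_neg)
    next
      fix c x y assume r: "r = single (x, c \<odot>\<^bsub>W\<^esub> y) 1 - single (x, y) c"
        and x: "x \<in> carrier V" "y \<in> carrier W"
      then have "\<phi> (x, c \<odot>\<^bsub>W\<^esub> y) = c \<odot>\<^bsub>M\<^esub> \<phi> (x, y)"
        using \<phi> by (simp add: bilinear_map_def linear_maps_def)
      then show "lin_ext M \<phi> r = \<zero>\<^bsub>M\<^esub>" using x cl by (simp add: r diff M.minus_eq M.r_neg)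
    qed
    ultimately show "r \<in> ?U" by simp
  qed
  then have "tensor_kernel V W \<subseteq> ?U"
    unfolding tensor_kernel_def by (rule gen_submodule_least[OF sub])
  with assms(3) show ?thesis by auto
qed

lemma induced_class:
  assumes M: "vspace M" and \<phi>: "bilinear_map V W M \<phi>" and t: "keys t \<subseteq> carrier V \<times> carrier W"
  shows "induced M \<phi> (tensor_class V W t) = lin_ext M \<phi> t"
  unfolding tensor_class_def
proof (rule induced_coset[OF M _ tensor_kernel_submodule])
  show "\<phi> \<in> carrier (V \<times>\<times> W) \<rightarrow> carrier M"
    using \<phi> by (auto simp: bilinear_map_def linear_maps_def)
qed (use t lin_ext_bilinear_kernel[OF M \<phi>] in auto)

lemma induced_linear:
  assumes M: "vspace M" and \<phi>: "bilinear_map V W M \<phi>"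
  shows "induced M \<phi> \<in> linear_maps (tensor V W) M"
proof -
  interpret M: vec_space M using M by (simp add: vec_space_iff)
  have \<phi>_closed: "\<phi> \<in> carrier V \<times> carrier W \<rightarrow> carrier M"
    using \<phi> by (auto simp: bilinear_map_def linear_maps_def)
  show ?thesis
  proof (rule linear_mapsI)
    fix C assume "C \<in> carrier (tensor V W)"
    then obtain t where t: "keys t \<subseteq> carrier V \<times> carrier W" "C = tensor_class V W t" by (rule tensor_cases)
    then show "induced M \<phi> C \<in> carrier M"
      using M.lin_ext_closed \<phi>_closed by (simp add: induced_class[OF M \<phi>])
    fix c
    have "c \<odot>\<^bsub>tensor V W\<^esub> C = tensor_class V W (Poly_Mapping.map ((*) c) t)"
      using linear_mapsD(3)[OF tensor_class_linear, of t c] t by simp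
    then show "induced M \<phi> (c \<odot>\<^bsub>tensor V W\<^esub> C) = c \<odot>\<^bsub>M\<^esub> induced M \<phi> C"
      using t M.lin_ext_scale[OF _ \<phi>_closed] keys_map_times[of c t]
      by (simp add: induced_class[OF M \<phi>])
  next
    fix C D assume "C \<in> carrier (tensor V W)" "D \<in> carrier (tensor V W)"
    then obtain s t where t: "keys t \<subseteq> carrier V \<times> carrier W" "C = tensor_class V W t"
      "keys s \<subseteq> carrier V \<times> carrier W" "D = tensor_class V W s" by (metis tensor_cases)
    have "C \<oplus>\<^bsub>tensor V W\<^esub> D = tensor_class V W (t + s)"
      using linear_mapsD(2)[OF tensor_class_linear, of t s] t by simp
    then show "induced M \<phi> (C \<oplus>\<^bsub>tensor V W\<^esub> D) = induced M \<phi> C \<oplus>\<^bsub>M\<^esub> induced M \<phi> D"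
      using t M.lin_ext_add[OF _ _ \<phi>_closed] by (simp add: induced_class[OF M \<phi>] keys_add_subset)
  qed
qed

lemma induced_pure:
  assumes M: "vspace M" and \<phi>: "bilinear_map V W M \<phi>" and "x \<in> carrier V" "y \<in> carrier W"
  shows "induced M \<phi> (pure_tensor V W x y) = \<phi> (x, y)"
proof -
  interpret M: vec_space M using M by (simp add: vec_space_iff)
  have "\<phi> (x, y) \<in> carrier M"
    using \<phi> assms(3,4) by (auto simp: bilinear_map_def linear_maps_def)
  then show ?thesis
    using assms by (simp add: pure_tensor_def induced_class[OF M \<phi>])
qed

text \<open>A tensor is the class of a formal combination, so a test on basis pairs suffices. The
  identities for \<Delta> below are obtained by applying this to suitable composites of linear
  maps.\<close>

lemma linear_maps_tensor_eq:
  assumes M: "vspace M" and f: "f \<in> linear_maps (tensor V W) M" and g: "g \<in> linear_maps (tensor V W) M"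
    and eq: "\<And>x y. x \<in> carrier V \<Longrightarrow> y \<in> carrier W \<Longrightarrow> f (pure_tensor V W x y) = g (pure_tensor V W x y)"
    and C: "C \<in> carrier (tensor V W)"
  shows "f C = g C"
proof -
  from C obtain t where t: "keys t \<subseteq> carrier V \<times> carrier W" "C = tensor_class V W t"
    by (rule tensor_cases)
  have "f (tensor_class V W t) = g (tensor_class V W t)"
    by (rule linear_maps_eq_on_singles[OF M linear_maps_comp[OF tensor_class_linear f]
        linear_maps_comp[OF tensor_class_linear g]])
      (use t eq in \<open>auto simp: pure_tensor_def\<close>)
  with t show ?thesis by simp
qed

lemma bilinear_pure: "bilinear_map V W (tensor V W) (\<lambda>(x, y). pure_tensor V W x y)"
proof -
  have in_kernel: "r \<in> tensor_kernel V W" if "r \<in> bilinear_rels V W" for r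
    unfolding tensor_kernel_def by (rule subsetD[OF gen_submodule_incl that])
  have cl: "tensor_class V W r = \<zero>\<^bsub>tensor V W\<^esub>" if "r \<in> bilinear_rels V W" for r
    using Q.coset_eq_zero_iff[of r] in_kernel[OF that] bilinear_rels_subset that
    unfolding tensor_class_def by (auto simp: tensor_def quot_alg_simps)
  have eqI: "a = b" if "a \<ominus>\<^bsub>tensor V W\<^esub> b = \<zero>\<^bsub>tensor V W\<^esub>" "a \<in> carrier (tensor V W)" "b \<in> carrier (tensor V W)" for a b
    using that by (simp add: T.minus_eq T.add.inv_solve_right')
  have 1: "pure_tensor V W (x \<oplus>\<^bsub>V\<^esub> x') y = pure_tensor V W x y \<oplus>\<^bsub>tensor V W\<^esub> pure_tensor V W x' y"
    if x: "x \<in> carrier V" "x' \<in> carrier V" "y \<in> carrier W" for x x' y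
  proof (rule eqI)
    let ?r = "single (x \<oplus>\<^bsub>V\<^esub> x', y) 1 - single (x, y) 1 - single (x', y) (1::'k)"
    have "?r \<in> bilinear_rels V W" unfolding bilinear_rels_def using x by blast
    from cl[OF this] show "pure_tensor V W (x \<oplus>\<^bsub>V\<^esub> x') y \<ominus>\<^bsub>tensor V W\<^esub> (pure_tensor V W x y \<oplus>\<^bsub>tensor V W\<^esub> pure_tensor V W x' y) = \<zero>\<^bsub>tensor V W\<^esub>"
      using x by (simp add: tensor_class_diff keys_diff_subset T.minus_eq T.minus_add T.a_assoc flip: pure_tensor_def)
  qed (use x in auto)
  have 2: "pure_tensor V W x (y \<oplus>\<^bsub>W\<^esub> y') = pure_tensor V W x y \<oplus>\<^bsub>tensor V W\<^esub> pure_tensor V W x y'"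
    if x: "x \<in> carrier V" "y' \<in> carrier W" "y \<in> carrier W" for x y y'
  proof (rule eqI)
    let ?r = "single (x, y \<oplus>\<^bsub>W\<^esub> y') 1 - single (x, y) 1 - single (x, y') (1::'k)"
    have "?r \<in> bilinear_rels V W" unfolding bilinear_rels_def using x by blast
    from cl[OF this] show "pure_tensor V W x (y \<oplus>\<^bsub>W\<^esub> y') \<ominus>\<^bsub>tensor V W\<^esub> (pure_tensor V W x y \<oplus>\<^bsub>tensor V W\<^esub> pure_tensor V W x y') = \<zero>\<^bsub>tensor V W\<^esub>"
      using x by (simp add: tensor_class_diff keys_diff_subset T.minus_eq T.minus_add T.a_assoc flip: pure_tensor_def)
  qed (use x in auto)
  have 3: "pure_tensor V W (c \<odot>\<^bsub>V\<^esub> x) y = c \<odot>\<^bsub>tensor V W\<^esub> pure_tensor V W x y"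
    if x: "x \<in> carrier V" "y \<in> carrier W" for c x y
  proof (rule eqI)
    let ?r = "single (c \<odot>\<^bsub>V\<^esub> x, y) 1 - single (x, y) c"
    have "?r \<in> bilinear_rels V W" unfolding bilinear_rels_def using x by blast
    from cl[OF this] show "pure_tensor V W (c \<odot>\<^bsub>V\<^esub> x) y \<ominus>\<^bsub>tensor V W\<^esub> c \<odot>\<^bsub>tensor V W\<^esub> pure_tensor V W x y = \<zero>\<^bsub>tensor V W\<^esub>"
      using x by (simp add: tensor_class_diff tensor_class_single_scale)
  qed (use x in auto)
  have 4: "pure_tensor V W x (c \<odot>\<^bsub>W\<^esub> y) = c \<odot>\<^bsub>tensor V W\<^esub> pure_tensor V W x y"
    if x: "x \<in> carrier V" "y \<in> carrier W" for c x y
  proof (rule eqI)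
    let ?r = "single (x, c \<odot>\<^bsub>W\<^esub> y) 1 - single (x, y) c"
    have "?r \<in> bilinear_rels V W" unfolding bilinear_rels_def using x by blast
    from cl[OF this] show "pure_tensor V W x (c \<odot>\<^bsub>W\<^esub> y) \<ominus>\<^bsub>tensor V W\<^esub> c \<odot>\<^bsub>tensor V W\<^esub> pure_tensor V W x y = \<zero>\<^bsub>tensor V W\<^esub>"
      using x by (simp add: tensor_class_diff tensor_class_single_scale)
  qed (use x in auto)
  show ?thesis unfolding bilinear_map_def using 1 2 3 4 by (auto intro!: linear_mapsI)
qed

lemma pure_add_left: "x \<in> carrier V \<Longrightarrow> x' \<in> carrier V \<Longrightarrow> y \<in> carrier W \<Longrightarrow>
    pure_tensor V W (x \<oplus>\<^bsub>V\<^esub> x') y = pure_tensor V W x y \<oplus>\<^bsub>tensor V W\<^esub> pure_tensor V W x' y"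
  and pure_add_right: "x \<in> carrier V \<Longrightarrow> y \<in> carrier W \<Longrightarrow> y' \<in> carrier W \<Longrightarrow>
    pure_tensor V W x (y \<oplus>\<^bsub>W\<^esub> y') = pure_tensor V W x y \<oplus>\<^bsub>tensor V W\<^esub> pure_tensor V W x y'"
  and pure_scale_left: "x \<in> carrier V \<Longrightarrow> y \<in> carrier W \<Longrightarrow>
    pure_tensor V W (c \<odot>\<^bsub>V\<^esub> x) y = c \<odot>\<^bsub>tensor V W\<^esub> pure_tensor V W x y"
  and pure_scale_right: "x \<in> carrier V \<Longrightarrow> y \<in> carrier W \<Longrightarrow>
    pure_tensor V W x (c \<odot>\<^bsub>W\<^esub> y) = c \<odot>\<^bsub>tensor V W\<^esub> pure_tensor V W x y"
  using bilinear_pure by (auto simp: bilinear_map_def linear_maps_def)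

lemma pure_linear_left: "y \<in> carrier W \<Longrightarrow> (\<lambda>x. pure_tensor V W x y) \<in> linear_maps V (tensor V W)"
  and pure_linear_right: "x \<in> carrier V \<Longrightarrow> pure_tensor V W x \<in> linear_maps W (tensor V W)"
  using bilinear_pure by (auto simp: bilinear_map_def)

end

section \<open>Contractions of tensors, product functionals and separation\<close>

lemma linear_maps_add:
  assumes "vspace W" "f \<in> linear_maps V W" "g \<in> linear_maps V W"
  shows "(\<lambda>x. f x \<oplus>\<^bsub>W\<^esub> g x) \<in> linear_maps V W"
proof -
  interpret vec_space W using assms(1) by (simp add: vec_space_iff)
  show ?thesis
    using linear_mapsD[OF assms(2)] linear_mapsD[OF assms(3)]
    by (intro linear_mapsI) (simp_all add: scale_right_distrib a_ac)
qed

lemma linear_maps_scale: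
  assumes "vspace W" "f \<in> linear_maps V W"
  shows "(\<lambda>x. c \<odot>\<^bsub>W\<^esub> f x) \<in> linear_maps V W"
proof -
  interpret vec_space W using assms(1) by (simp add: vec_space_iff)
  show ?thesis
    using linear_mapsD[OF assms(2)]
    by (intro linear_mapsI) (simp_all add: scale_right_distrib scale_assoc mult.commute)
qed

lemma dual_scale_vector:
  assumes "vspace V" "f \<in> dual W" "v \<in> carrier V"
  shows "(\<lambda>x. f x \<odot>\<^bsub>V\<^esub> v) \<in> linear_maps W V"
proof -
  interpret vec_space V using assms(1) by (simp add: vec_space_iff)
  show ?thesis
    using dual_simps[OF assms(2)] assms(3) by (intro linear_mapsI) (simp_all add: scale_left_distrib scale_assoc)
qed

lemma bilinear_mapI:
  assumes "\<And>y. y \<in> carrier W \<Longrightarrow> (\<lambda>x. \<phi> (x, y)) \<in> linear_maps V M"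
    "\<And>x. x \<in> carrier V \<Longrightarrow> (\<lambda>y. \<phi> (x, y)) \<in> linear_maps W M"
  shows "bilinear_map V W M \<phi>"
  using assms by (simp add: bilinear_map_def)

text \<open>This is id \<otimes> g followed by the identification of V \<otimes> K with V.\<close>

definition contract_right ::
  "('k::field, 'a, 'm) module_scheme \<Rightarrow> ('b \<Rightarrow> 'k) \<Rightarrow> ('a \<times> 'b \<Rightarrow>\<^sub>0 'k) set \<Rightarrow> 'a" where
  "contract_right V g = induced V (\<lambda>(x, y). g y \<odot>\<^bsub>V\<^esub> x)"

definition tensor_functional ::
  "('a \<Rightarrow> 'k) \<Rightarrow> ('b \<Rightarrow> 'k) \<Rightarrow> ('a \<times> 'b \<Rightarrow>\<^sub>0 'k::field) set \<Rightarrow> 'k" where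
  "tensor_functional f g = induced scalars (\<lambda>(x, y). f x * g y)"

context
  fixes V :: "('k::field, 'a, 'm) module_scheme" and W :: "('k, 'b, 'n) module_scheme"
  assumes V: "vspace V" and W: "vspace W"
begin

interpretation V: vec_space V using V by (simp add: vec_space_iff)
interpretation W: vec_space W using W by (simp add: vec_space_iff)
interpretation T: vec_space "tensor V W" using vspace_tensor[OF V W] by (simp add: vec_space_iff)

lemma bilinear_contract_right: "g \<in> dual W \<Longrightarrow> bilinear_map V W V (\<lambda>(x, y). g y \<odot>\<^bsub>V\<^esub> x)"
  using V by (auto intro!: bilinear_mapI dual_scale_vector linear_maps_scale linear_maps_id)

lemma contract_right_linear: "g \<in> dual W \<Longrightarrow> contract_right V g \<in> linear_maps (tensor V W) V"
  unfolding contract_right_def by (rule induced_linear[OF V W V bilinear_contract_right])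

lemma contract_right_pure:
  "g \<in> dual W \<Longrightarrow> x \<in> carrier V \<Longrightarrow> y \<in> carrier W \<Longrightarrow> contract_right V g (pure_tensor V W x y) = g y \<odot>\<^bsub>V\<^esub> x"
  unfolding contract_right_def by (subst induced_pure[OF V W V bilinear_contract_right]) auto

lemma bilinear_tensor_functional:
  "f \<in> dual V \<Longrightarrow> g \<in> dual W \<Longrightarrow> bilinear_map V W scalars (\<lambda>(x, y). f x * g y)"
  by (auto intro!: bilinear_mapI linear_mapsI simp: dual_simps algebra_simps)

lemma tensor_functional_dual: "f \<in> dual V \<Longrightarrow> g \<in> dual W \<Longrightarrow> tensor_functional f g \<in> dual (tensor V W)"
  unfolding tensor_functional_def by (rule induced_linear[OF V W vspace_scalars bilinear_tensor_functional])

lemma tensor_functional_pure: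
  "f \<in> dual V \<Longrightarrow> g \<in> dual W \<Longrightarrow> x \<in> carrier V \<Longrightarrow> y \<in> carrier W \<Longrightarrow>
   tensor_functional f g (pure_tensor V W x y) = f x * g y"
  unfolding tensor_functional_def by (subst induced_pure[OF V W vspace_scalars bilinear_tensor_functional]) auto

lemma tensor_functional_contract:
  assumes "f \<in> dual V" "g \<in> dual W" "C \<in> carrier (tensor V W)"
  shows "tensor_functional f g C = f (contract_right V g C)"
  by (rule linear_maps_tensor_eq[OF V W vspace_scalars tensor_functional_dual
       linear_maps_comp[OF contract_right_linear] _ assms(3)])
    (use assms in \<open>auto simp: tensor_functional_pure contract_right_pure dual_simps\<close>)

lemma pure_zero_left: "y \<in> carrier W \<Longrightarrow> pure_tensor V W \<zero>\<^bsub>V\<^esub> y = \<zero>\<^bsub>tensor V W\<^esub>"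
  using linear_maps_zero[OF V vspace_tensor[OF V W] pure_linear_left[OF V W]] by simp

lemma pure_zero_right: "x \<in> carrier V \<Longrightarrow> pure_tensor V W x \<zero>\<^bsub>W\<^esub> = \<zero>\<^bsub>tensor V W\<^esub>"
  using linear_maps_zero[OF W vspace_tensor[OF V W] pure_linear_right[OF V W]] by simp

lemma pure_finsum_left:
  "\<phi> \<in> A \<rightarrow> carrier V \<Longrightarrow> y \<in> carrier W \<Longrightarrow>
   pure_tensor V W (\<Oplus>\<^bsub>V\<^esub>i\<in>A. \<phi> i) y = (\<Oplus>\<^bsub>tensor V W\<^esub>i\<in>A. pure_tensor V W (\<phi> i) y)"
  using linear_maps_finsum[OF V vspace_tensor[OF V W] pure_linear_left[OF V W]] by blast

lemma pure_finsum_right: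
  "\<phi> \<in> A \<rightarrow> carrier W \<Longrightarrow> x \<in> carrier V \<Longrightarrow>
   pure_tensor V W x (\<Oplus>\<^bsub>W\<^esub>i\<in>A. \<phi> i) = (\<Oplus>\<^bsub>tensor V W\<^esub>i\<in>A. pure_tensor V W x (\<phi> i))"
  using linear_maps_finsum[OF W vspace_tensor[OF V W] pure_linear_right[OF V W]] by blast

text \<open>The coefficients of a formal combination are absorbed into the left factors, and its
  support serves as index set.\<close>

lemma tensor_finsum_cases:
  assumes "C \<in> carrier (tensor V W)"
  obtains I :: "('a \<times> 'b) set" and x y where "finite I" "x \<in> I \<rightarrow> carrier V" "y \<in> I \<rightarrow> carrier W"
    "C = (\<Oplus>\<^bsub>tensor V W\<^esub>i\<in>I. pure_tensor V W (x i) (y i))"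
proof -
  from assms obtain t where t: "keys t \<subseteq> carrier V \<times> carrier W" "C = tensor_class V W t"
    by (rule tensor_cases[OF V W])
  have "C = (\<Oplus>\<^bsub>tensor V W\<^esub>p\<in>keys t. pure_tensor V W (lookup t p \<odot>\<^bsub>V\<^esub> fst p) (snd p))"
    unfolding t(2) tensor_class_lin_ext[OF V W t(1)] lin_ext_def
    by (rule T.finsum_cong') (use t(1) in \<open>auto simp: pure_scale_left[OF V W] pure_tensor_closed[OF V W]\<close>)
  then show thesis
    using t(1) by (intro that[of "keys t" "\<lambda>p. lookup t p \<odot>\<^bsub>V\<^esub> fst p" snd]) auto
qed

text \<open>Induction on the number of pure tensors: the last right factor either depends linearly on the
  others, and then can be eliminated, or is detected by a functional vanishing on them, and then its left
  factor lies in \<open>U\<close>.\<close>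

lemma tensor_contractions_in_subspace:
  assumes U: "submodule U ring_of_type_algebra V" and C: "C \<in> carrier (tensor V W)"
    and contr: "\<And>g. g \<in> dual W \<Longrightarrow> contract_right V g C \<in> U"
  shows "\<exists>t. keys t \<subseteq> U \<times> carrier W \<and> C = tensor_class V W t"
proof -
  note U' = V.subspaceD[OF U]
  have main: "\<exists>t. keys t \<subseteq> U \<times> carrier W \<and> C = tensor_class V W t"
    if "finite I" "x \<in> I \<rightarrow> carrier V" "y \<in> I \<rightarrow> carrier W"
      "C = (\<Oplus>\<^bsub>tensor V W\<^esub>i\<in>I. pure_tensor V W (x i) (y i))" "\<And>g. g \<in> dual W \<Longrightarrow> contract_right V g C \<in> U"
    for I :: "('a \<times> 'b) set" and x y C
    using that
  proof (induction I arbitrary: x C rule: finite_induct)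
    case empty
    then show ?case using linear_maps_zero[OF vspace_monoid_algebra vspace_tensor[OF V W] tensor_class_linear[OF V W]]
      by (intro exI[of _ 0]) simp
  next
    case (insert j I)
    note x = \<open>x \<in> insert j I \<rightarrow> carrier V\<close> and y = \<open>y \<in> insert j I \<rightarrow> carrier W\<close>
    have xj: "x j \<in> carrier V" "x \<in> I \<rightarrow> carrier V" "y j \<in> carrier W" "y \<in> I \<rightarrow> carrier W" using x y by auto
    define D where "D = (\<Oplus>\<^bsub>tensor V W\<^esub>i\<in>I. pure_tensor V W (x i) (y i))"
    have p: "(\<lambda>i. pure_tensor V W (z i) (y i)) \<in> I \<rightarrow> carrier (tensor V W)" if "z \<in> I \<rightarrow> carrier V" for z
      using that xj by (auto intro!: pure_tensor_closed[OF V W])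
    have D: "D \<in> carrier (tensor V W)" unfolding D_def using p[OF xj(2)] by (rule T.finsum_closed)
    have C: "C = pure_tensor V W (x j) (y j) \<oplus>\<^bsub>tensor V W\<^esub> D"
      unfolding D_def insert.prems(3) using p[OF xj(2)] insert.hyps xj pure_tensor_closed[OF V W]
      by (intro T.finsum_insert) auto
    let ?S = "{\<Oplus>\<^bsub>W\<^esub>i\<in>I. a i \<odot>\<^bsub>W\<^esub> y i | a. True}"
    have S: "submodule ?S ring_of_type_algebra W"
    proof (rule W.subspaceI)
      show "?S \<subseteq> carrier W" using xj(4) by (auto intro!: W.finsum_closed)
      show "\<zero>\<^bsub>W\<^esub> \<in> ?S"
        using xj(4) by (intro CollectI exI[of _ "\<lambda>_. 0"] conjI TrueI sym[OF W.add.finprod_one_eqI]) (auto dest: funcset_mem)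
    next
      fix u v assume "u \<in> ?S" "v \<in> ?S"
      then obtain a b where ab: "u = (\<Oplus>\<^bsub>W\<^esub>i\<in>I. a i \<odot>\<^bsub>W\<^esub> y i)" "v = (\<Oplus>\<^bsub>W\<^esub>i\<in>I. b i \<odot>\<^bsub>W\<^esub> y i)" by blast
      have "u \<oplus>\<^bsub>W\<^esub> v = (\<Oplus>\<^bsub>W\<^esub>i\<in>I. (a i + b i) \<odot>\<^bsub>W\<^esub> y i)"
        unfolding ab using xj(4) by (subst W.finsum_addf[symmetric])
          (auto intro!: W.finsum_cong' simp: W.scale_left_distrib dest: funcset_mem)
      then show "u \<oplus>\<^bsub>W\<^esub> v \<in> ?S" by (intro CollectI exI[of _ "\<lambda>i. a i + b i"] conjI TrueI)
    next
      fix c u assume "u \<in> ?S"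
      then obtain a where ab: "u = (\<Oplus>\<^bsub>W\<^esub>i\<in>I. a i \<odot>\<^bsub>W\<^esub> y i)" by blast
      have "c \<odot>\<^bsub>W\<^esub> u = (\<Oplus>\<^bsub>W\<^esub>i\<in>I. (c * a i) \<odot>\<^bsub>W\<^esub> y i)"
        unfolding ab using xj(4) insert.hyps(1) by (subst W.scale_finsum)
          (auto intro!: W.finsum_cong' simp: W.scale_assoc dest: funcset_mem)
      then show "c \<odot>\<^bsub>W\<^esub> u \<in> ?S" by (intro CollectI exI[of _ "\<lambda>i. c * a i"] conjI TrueI)
    qed
    have yS: "y i \<in> ?S" if "i \<in> I" for i
    proof -
      have "(\<Oplus>\<^bsub>W\<^esub>k\<in>I. (if k = i then 1 else 0) \<odot>\<^bsub>W\<^esub> y k) = (\<Oplus>\<^bsub>W\<^esub>k\<in>I. if k = i then y k else \<zero>\<^bsub>W\<^esub>)"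
        using xj(4) by (intro W.finsum_cong') (auto dest: funcset_mem)
      also have "\<dots> = y i" using W.finsum_delta[OF insert.hyps(1) that] xj(4) that by (auto dest: funcset_mem)
      finally show ?thesis by (intro CollectI exI[of _ "\<lambda>k. if k = i then 1 else 0"] conjI TrueI) (rule sym)
    qed
    show ?case
    proof (cases "y j \<in> ?S")
      case True
      then obtain a where a: "y j = (\<Oplus>\<^bsub>W\<^esub>i\<in>I. a i \<odot>\<^bsub>W\<^esub> y i)" by blast
      \<comment> \<open>Expanding \<open>y j\<close> in the other right factors and collecting terms
        removes the index j at the cost of changing the left factors, but leaves C unchanged; this
        is why the induction is arbitrary in x.\<close>
      let ?x = "\<lambda>i. a i \<odot>\<^bsub>V\<^esub> x j \<oplus>\<^bsub>V\<^esub> x i"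
      have x': "?x \<in> I \<rightarrow> carrier V" using xj by auto
      have "pure_tensor V W (x j) (y j) = (\<Oplus>\<^bsub>tensor V W\<^esub>i\<in>I. pure_tensor V W (a i \<odot>\<^bsub>V\<^esub> x j) (y i))"
        unfolding a using xj by (subst pure_finsum_right; (intro T.finsum_cong' refl)?)
          (auto simp: pure_scale_left[OF V W] pure_scale_right[OF V W] pure_tensor_closed[OF V W]
            dest: funcset_mem)
      then have "C = (\<Oplus>\<^bsub>tensor V W\<^esub>i\<in>I. pure_tensor V W (a i \<odot>\<^bsub>V\<^esub> x j) (y i)) \<oplus>\<^bsub>tensor V W\<^esub> D"
        using C by simp
      also have "\<dots> = (\<Oplus>\<^bsub>tensor V W\<^esub>i\<in>I. pure_tensor V W (?x i) (y i))"
      proof -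
        have "x i \<in> carrier V" "y i \<in> carrier W" if "i \<in> I" for i using xj that by auto
        then show ?thesis
          unfolding D_def using xj(1)
          by (subst T.finsum_addf[symmetric]; (intro T.finsum_cong' refl)?)
            (simp_all add: Pi_iff pure_add_left[OF V W] pure_tensor_closed[OF V W])
      qed
      finally show ?thesis by (rule insert.IH[OF x' xj(4) _ insert.prems(4)])
    next
      case False
      from exists_separating_dual[OF W S xj(3) False] obtain g where
        g: "g \<in> dual W" "g (y j) = 1" "\<And>u. u \<in> ?S \<Longrightarrow> g u = 0" by blast
      have gD: "contract_right V g D = \<zero>\<^bsub>V\<^esub>"
        unfolding D_def
        using linear_maps_finsum[OF vspace_tensor[OF V W] V contract_right_linear[OF g(1)] p[OF xj(2)]] xj g(3)[OF yS]
        by (simp add: Pi_iff, intro V.add.finprod_one_eqI) (simp add: contract_right_pure[OF g(1)])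
      have hC: "contract_right V h C = h (y j) \<odot>\<^bsub>V\<^esub> x j \<oplus>\<^bsub>V\<^esub> contract_right V h D" if "h \<in> dual W" for h
        unfolding C using linear_mapsD(2)[OF contract_right_linear[OF that] pure_tensor_closed[OF V W] D] xj
        by (simp add: contract_right_pure[OF that])
      \<comment> \<open>g annihilates the other right factors and takes the value 1 at
        \<open>y j\<close>, so contracting C with g leaves exactly \<open>x j\<close>.\<close>
      have xU: "x j \<in> U"
        using hC[OF g(1)] insert.prems(4)[OF g(1)] g(2) gD xj by simp
      have "contract_right V h D \<in> U" if h: "h \<in> dual W" for h
      proof -
        have cl: "contract_right V h D \<in> carrier V" by (rule linear_mapsD(1)[OF contract_right_linear[OF h] D])
        have "contract_right V h D = contract_right V h C \<ominus>\<^bsub>V\<^esub> h (y j) \<odot>\<^bsub>V\<^esub> x j"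
          unfolding hC[OF h] using cl xj V.a_comm[of "h (y j) \<odot>\<^bsub>V\<^esub> x j"] by (simp add: V.minus_eq V.a_assoc V.r_neg)
        then show ?thesis using insert.prems(4)[OF h] xU U' by simp
      qed
      from insert.IH[OF xj(2,4) D_def this] obtain t where
        t: "keys t \<subseteq> U \<times> carrier W" "D = tensor_class V W t" by blast
      have t': "keys t \<subseteq> carrier V \<times> carrier W" using t(1) U'(1) by blast
      have "C = tensor_class V W (single (x j, y j) 1 + t)"
        using linear_mapsD(2)[OF tensor_class_linear[OF V W], of "single (x j, y j) 1" t] t t' xj
        unfolding C by (simp add: pure_tensor_def)
      moreover have "keys (single (x j, y j) 1 + t) \<subseteq> U \<times> carrier W"
        using t xU xj by (intro keys_add_subset) auto
      ultimately show ?thesis by blast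
    qed
  qed
  from tensor_finsum_cases[OF C] obtain I :: "('a \<times> 'b) set" and x y where "finite I" "x \<in> I \<rightarrow> carrier V" "y \<in> I \<rightarrow> carrier W"
    "C = (\<Oplus>\<^bsub>tensor V W\<^esub>i\<in>I. pure_tensor V W (x i) (y i))" .
  from main[OF this contr] show ?thesis .
qed

text \<open>By \<open>dual_separates\<close> all contractions of C - D vanish. Hence C - D can be
  written with left factors in the zero subspace, and such a tensor is zero.\<close>

lemma tensor_functionals_separate:
  assumes C: "C \<in> carrier (tensor V W)" and D: "D \<in> carrier (tensor V W)"
    and eq: "\<And>f g. f \<in> dual V \<Longrightarrow> g \<in> dual W \<Longrightarrow> tensor_functional f g C = tensor_functional f g D"
  shows "C = D"
proof -
  let ?E = "C \<ominus>\<^bsub>tensor V W\<^esub> D"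
  have E: "?E \<in> carrier (tensor V W)" using C D by simp
  have "contract_right V g ?E \<in> {\<zero>\<^bsub>V\<^esub>}" if g: "g \<in> dual W" for g
  proof -
    have cl: "contract_right V g ?E \<in> carrier V" by (rule linear_mapsD(1)[OF contract_right_linear[OF g] E])
    have "f (contract_right V g ?E) = f \<zero>\<^bsub>V\<^esub>" if f: "f \<in> dual V" for f
      using linear_maps_diff[OF vspace_tensor[OF V W] vspace_scalars tensor_functional_dual[OF f g] C D] eq[OF f g]
      by (simp add: tensor_functional_contract[OF f g E, symmetric] dual_zero[OF V f])
    from dual_separates[OF V cl V.zero_closed this] show ?thesis by simp
  qed
  from tensor_contractions_in_subspace[OF singleton_zero_subspace[OF V] E this] obtain t where
    t: "keys t \<subseteq> {\<zero>\<^bsub>V\<^esub>} \<times> carrier W" "?E = tensor_class V W t" by blast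
  have keys: "keys t \<subseteq> carrier V \<times> carrier W" using t(1) V.zero_closed by blast
  have "?E = (\<Oplus>\<^bsub>tensor V W\<^esub>p\<in>keys t. \<zero>\<^bsub>tensor V W\<^esub>)"
    unfolding t(2) tensor_class_lin_ext[OF V W keys] lin_ext_def
    by (rule T.finsum_cong') (use t(1) in \<open>auto simp: pure_zero_left\<close>)
  also have "\<dots> = \<zero>\<^bsub>tensor V W\<^esub>" by (rule T.finsum_zero)
  finally show ?thesis using C D by (simp add: T.minus_eq T.add.inv_solve_right')
qed

end

lemma tensor_map_linear:
  assumes V: "vspace V" and W: "vspace W" and V': "vspace V'" and W': "vspace W'"
    and f: "f \<in> linear_maps V' V" and g: "g \<in> linear_maps W' W"
  shows "tensor_map V W f g \<in> linear_maps (tensor V' W') (tensor V W)"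
    "x \<in> carrier V' \<Longrightarrow> y \<in> carrier W' \<Longrightarrow> tensor_map V W f g (pure_tensor V' W' x y) = pure_tensor V W (f x) (g y)"
proof -
  have "bilinear_map V' W' (tensor V W) (\<lambda>(x, y). pure_tensor V W (f x) (g y))"
    using linear_mapsD(1)[OF f] linear_mapsD(1)[OF g]
      linear_maps_comp[OF f pure_linear_left[OF V W]] linear_maps_comp[OF g pure_linear_right[OF V W]]
    by (intro bilinear_mapI) auto
  from induced_linear[OF V' W' vspace_tensor[OF V W] this] induced_pure[OF V' W' vspace_tensor[OF V W] this]
  show "tensor_map V W f g \<in> linear_maps (tensor V' W') (tensor V W)"
    "x \<in> carrier V' \<Longrightarrow> y \<in> carrier W' \<Longrightarrow> tensor_map V W f g (pure_tensor V' W' x y) = pure_tensor V W (f x) (g y)"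
    by (simp_all add: tensor_map_def)
qed

lemma tensor_assoc_linear:
  assumes U: "vspace U" and V: "vspace V" and W: "vspace W"
  shows "tensor_assoc U V W \<in> linear_maps (tensor (tensor U V) W) (tensor U (tensor V W))" (is ?lin)
    "x \<in> carrier U \<Longrightarrow> y \<in> carrier V \<Longrightarrow> z \<in> carrier W \<Longrightarrow>
      tensor_assoc U V W (pure_tensor (tensor U V) W (pure_tensor U V x y) z) =
      pure_tensor U (tensor V W) x (pure_tensor V W y z)" (is "_ \<Longrightarrow> _ \<Longrightarrow> _ \<Longrightarrow> ?pure")
proof -
  interpret W: vec_space W using W by (simp add: vec_space_iff)
  let ?UV = "tensor U V" and ?VW = "tensor V W"
  let ?T = "tensor U ?VW"
  let ?f = "\<lambda>z (x, y). pure_tensor U ?VW x (pure_tensor V W y z)"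
  note UV = vspace_tensor[OF U V] and VW = vspace_tensor[OF V W]
  note T = vspace_tensor[OF U VW]
  have bil: "bilinear_map U V ?T (?f z)" if z: "z \<in> carrier W" for z
    using z pure_linear_left[OF U VW] linear_maps_comp[OF pure_linear_left[OF V W z] pure_linear_right[OF U VW]]
    by (intro bilinear_mapI) (auto simp: pure_tensor_closed[OF V W])
  note lin = induced_linear[OF U V T bil] and pure = induced_pure[OF U V T bil]
  \<comment> \<open>The outer \<open>induced\<close> requires linearity in z as well. For fixed C it
    follows by comparing two linear functions of C on pure tensors.\<close>
  have zlin: "(\<lambda>z. induced ?T (?f z) C) \<in> linear_maps W ?T" if C: "C \<in> carrier ?UV" for C
  proof (rule linear_mapsI)
    fix z assume z: "z \<in> carrier W"
    show "induced ?T (?f z) C \<in> carrier ?T" by (rule linear_mapsD(1)[OF lin[OF z] C])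
    fix c
    show "induced ?T (?f (c \<odot>\<^bsub>W\<^esub> z)) C = c \<odot>\<^bsub>?T\<^esub> induced ?T (?f z) C"
      by (rule linear_maps_tensor_eq[OF U V T lin linear_maps_scale[OF T lin[OF z]] _ C])
        (use z in \<open>auto simp: pure pure_scale_right[OF V W] pure_scale_right[OF U VW] pure_tensor_closed[OF V W]\<close>)
  next
    fix z z' assume z: "z \<in> carrier W" "z' \<in> carrier W"
    show "induced ?T (?f (z \<oplus>\<^bsub>W\<^esub> z')) C = induced ?T (?f z) C \<oplus>\<^bsub>?T\<^esub> induced ?T (?f z') C"
      by (rule linear_maps_tensor_eq[OF U V T lin linear_maps_add[OF T lin[OF z(1)] lin[OF z(2)]] _ C])
        (use z in \<open>auto simp: pure pure_add_right[OF V W] pure_add_right[OF U VW] pure_tensor_closed[OF V W]\<close>)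
  qed
  have bil': "bilinear_map ?UV W ?T (\<lambda>(C, z). induced ?T (?f z) C)"
    using lin zlin by (intro bilinear_mapI) auto
  from induced_linear[OF UV W T bil'] show ?lin by (simp add: tensor_assoc_def)
  assume x: "x \<in> carrier U" "y \<in> carrier V" "z \<in> carrier W"
  then show ?pure
    using induced_pure[OF UV W T bil' pure_tensor_closed[OF U V x(1,2)] x(3)]
    by (simp add: tensor_assoc_def pure)
qed

section \<open>Tensor products of algebras\<close>

lemma unital_algebra_simps:
  assumes "unital_algebra A"
  shows "ring A" "vspace A"
    "x \<in> carrier A \<Longrightarrow> y \<in> carrier A \<Longrightarrow> (c \<odot>\<^bsub>A\<^esub> x) \<otimes>\<^bsub>A\<^esub> y = c \<odot>\<^bsub>A\<^esub> (x \<otimes>\<^bsub>A\<^esub> y)"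
    "x \<in> carrier A \<Longrightarrow> y \<in> carrier A \<Longrightarrow> x \<otimes>\<^bsub>A\<^esub> (c \<odot>\<^bsub>A\<^esub> y) = c \<odot>\<^bsub>A\<^esub> (x \<otimes>\<^bsub>A\<^esub> y)"
  using assms by (auto simp: unital_algebra_def)

lemma mult_linear_left: "unital_algebra A \<Longrightarrow> a \<in> carrier A \<Longrightarrow> (\<lambda>x. a \<otimes>\<^bsub>A\<^esub> x) \<in> linear_maps A A"
  and mult_linear_right: "unital_algebra A \<Longrightarrow> a \<in> carrier A \<Longrightarrow> (\<lambda>x. x \<otimes>\<^bsub>A\<^esub> a) \<in> linear_maps A A"
  using unital_algebra_simps[of A]
  by (auto intro!: linear_mapsI simp: ring.ring_simprules monoid.m_closed ring.is_monoid)

context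
  fixes A :: "('k::field, 'a, 'm) module_scheme" and B :: "('k, 'b, 'n) module_scheme"
  assumes A: "unital_algebra A" and B: "unital_algebra B"
begin

interpretation A: ring A by (rule unital_algebra_simps[OF A])
interpretation B: ring B by (rule unital_algebra_simps[OF B])

lemma monoid_DirProd: "monoid (A \<times>\<times> B)"
  by (rule monoidI) (auto simp: A.m_assoc B.m_assoc DirProd_def)

interpretation M: ring "monoid_algebra (A \<times>\<times> B) :: ('k, _) module" by (rule ring_monoid_algebra[OF monoid_DirProd])

lemma vsp: "vspace A" "vspace B" using unital_algebra_simps A B by auto

text \<open>Multiplication by a basis element (a, b), followed by passage to classes, is the linear
  extension of the bilinear map sending (x, y) to ax \<otimes> by, and therefore kills the kernel;
  likewise on the right. General multipliers are sums of such elements with scalars.\<close>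

lemma tensor_kernel_ideal: "ideal (tensor_kernel A B) (monoid_algebra (A \<times>\<times> B))"
proof -
  let ?M = "monoid_algebra (A \<times>\<times> B) :: ('k, _) module" and ?T = "tensor A B"
  let ?K = "tensor_kernel A B"
  note T = vspace_tensor[OF vsp]
  note cl = tensor_class_linear[OF vsp]
  interpret T: vec_space ?T using T by (simp add: vec_space_iff)
  note K = tensor_kernel_submodule[OF vsp]
  note K' = monoid_algebra.subspaceD[OF K]
  have in_K: "t \<in> ?K \<longleftrightarrow> tensor_class A B t = \<zero>\<^bsub>?T\<^esub>" if "keys t \<subseteq> carrier A \<times> carrier B" for t
    using tensor_class_eq_iff[OF vsp that, of 0] linear_maps_zero[OF vspace_monoid_algebra T cl] by simp
  have single_mult: "single (a, b) c \<otimes>\<^bsub>?M\<^esub> k \<in> ?K \<and> k \<otimes>\<^bsub>?M\<^esub> single (a, b) c \<in> ?K"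
    if ab: "a \<in> carrier A" "b \<in> carrier B" and k: "k \<in> ?K" for a b c k
  proof -
    have s: "single (a, b) c \<in> carrier ?M" using ab by simp
    have kc: "k \<in> carrier ?M" using K'(1) k by auto
    have keys: "keys k \<subseteq> carrier (A \<times>\<times> B)" using kc by simp
    have "bilinear_map A B ?T (\<lambda>(x, y). c \<odot>\<^bsub>?T\<^esub> pure_tensor A B (a \<otimes>\<^bsub>A\<^esub> x) (b \<otimes>\<^bsub>B\<^esub> y))"
      using ab linear_maps_scale[OF T linear_maps_comp[OF mult_linear_left[OF A ab(1)] pure_linear_left[OF vsp]]]
        linear_maps_scale[OF T linear_maps_comp[OF mult_linear_left[OF B ab(2)] pure_linear_right[OF vsp]]]
      by (intro bilinear_mapI) auto
    note z1 = lin_ext_bilinear_kernel[OF vsp T this k]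
    have "bilinear_map A B ?T (\<lambda>(x, y). c \<odot>\<^bsub>?T\<^esub> pure_tensor A B (x \<otimes>\<^bsub>A\<^esub> a) (y \<otimes>\<^bsub>B\<^esub> b))"
      using ab linear_maps_scale[OF T linear_maps_comp[OF mult_linear_right[OF A ab(1)] pure_linear_left[OF vsp]]]
        linear_maps_scale[OF T linear_maps_comp[OF mult_linear_right[OF B ab(2)] pure_linear_right[OF vsp]]]
      by (intro bilinear_mapI) auto
    note z2 = lin_ext_bilinear_kernel[OF vsp T this k]
    note alg = unital_algebra_monoid_algebra[OF monoid_DirProd, where ?'k = 'k]
    have cs: "tensor_class A B (single (x, y) c) = c \<odot>\<^bsub>?T\<^esub> pure_tensor A B x y"
      if "x \<in> carrier A" "y \<in> carrier B" for x y
      using tensor_class_single_scale[OF vsp that] .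
    have "tensor_class A B (single (a, b) c \<otimes>\<^bsub>?M\<^esub> k) =
        lin_ext ?T (\<lambda>p. tensor_class A B (single (a, b) c \<otimes>\<^bsub>?M\<^esub> single p 1)) k"
      by (rule linear_maps_eq_lin_ext[OF T linear_maps_comp[OF mult_linear_left[OF alg s] cl] keys])
    also have "\<dots> = lin_ext ?T (\<lambda>(x, y). c \<odot>\<^bsub>?T\<^esub> pure_tensor A B (a \<otimes>\<^bsub>A\<^esub> x) (b \<otimes>\<^bsub>B\<^esub> y)) k"
      by (rule T.lin_ext_cong) (use keys ab cs in \<open>auto simp: pure_tensor_closed[OF vsp]\<close>)
    finally have e1: "tensor_class A B (single (a, b) c \<otimes>\<^bsub>?M\<^esub> k) = \<zero>\<^bsub>?T\<^esub>" using z1 by simp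
    have "tensor_class A B (k \<otimes>\<^bsub>?M\<^esub> single (a, b) c) =
        lin_ext ?T (\<lambda>p. tensor_class A B (single p 1 \<otimes>\<^bsub>?M\<^esub> single (a, b) c)) k"
      by (rule linear_maps_eq_lin_ext[OF T linear_maps_comp[OF mult_linear_right[OF alg s] cl] keys])
    also have "\<dots> = lin_ext ?T (\<lambda>(x, y). c \<odot>\<^bsub>?T\<^esub> pure_tensor A B (x \<otimes>\<^bsub>A\<^esub> a) (y \<otimes>\<^bsub>B\<^esub> b)) k"
      by (rule T.lin_ext_cong) (use keys ab cs in \<open>auto simp: pure_tensor_closed[OF vsp]\<close>)
    finally have e2: "tensor_class A B (k \<otimes>\<^bsub>?M\<^esub> single (a, b) c) = \<zero>\<^bsub>?T\<^esub>" using z2 by simp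
    show ?thesis
      using e1 e2 in_K M.m_closed[OF s kc] M.m_closed[OF kc s] by simp
  qed
  have gen: "s \<otimes>\<^bsub>?M\<^esub> k \<in> ?K \<and> k \<otimes>\<^bsub>?M\<^esub> s \<in> ?K" if k: "k \<in> ?K" and s: "keys s \<subseteq> carrier A \<times> carrier B" for s k
    using s
  proof (induction s rule: poly_mapping_induct)
    case (single p c) then show ?case using single_mult[of "fst p" "snd p" k c, OF _ _ k] by auto
  qed (use K'(2,3) in \<open>auto simp: monoid_algebra_l_distr monoid_algebra_r_distr\<close>)
  show ?thesis
    using K gen by (intro idealI M.ring_axioms) (auto simp: submodule_def)
qed

lemma unital_algebra_tensor: "unital_algebra (tensor A B)"
proof -
  interpret quotient_space "monoid_algebra (A \<times>\<times> B) :: ('k, _) module" "tensor_kernel A B"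
    using tensor_kernel_submodule[OF vsp] monoid_algebra.vec_space_axioms
    by (simp add: quotient_space_def quotient_space_axioms_def)
  show ?thesis unfolding tensor_def
    by (rule unital_algebra_quot[OF unital_algebra_monoid_algebra[OF monoid_DirProd] tensor_kernel_ideal])
qed

lemma pure_mult:
  assumes "a \<in> carrier A" "a' \<in> carrier A" "b \<in> carrier B" "b' \<in> carrier B"
  shows "pure_tensor A B a b \<otimes>\<^bsub>tensor A B\<^esub> pure_tensor A B a' b' = pure_tensor A B (a \<otimes>\<^bsub>A\<^esub> a') (b \<otimes>\<^bsub>B\<^esub> b')"
proof -
  interpret quotient_space "monoid_algebra (A \<times>\<times> B) :: ('k, _) module" "tensor_kernel A B"
    using tensor_kernel_submodule[OF vsp] monoid_algebra.vec_space_axioms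
    by (simp add: quotient_space_def quotient_space_axioms_def)
  show ?thesis
    using assms quot_mult_ideal[OF tensor_kernel_ideal, of "single (a, b) 1" "single (a', b') 1"]
    by (simp add: pure_tensor_def tensor_class_def tensor_def)
qed

lemma tensor_one: "\<one>\<^bsub>tensor A B\<^esub> = pure_tensor A B \<one>\<^bsub>A\<^esub> \<one>\<^bsub>B\<^esub>"
  by (simp add: tensor_def quot_alg_simps pure_tensor_def tensor_class_def DirProd_def)

end

section \<open>Irrelevance of the additional record fields\<close>

text \<open>\<open>cosemisimple\<close> quantifies over comodules of the plain type
  \<open>module\<close>, whereas H is a longer record. The regular comodule has to be entered as
  \<open>module.truncate H\<close>; this lemma and the following ones show that the constructions do
  not see the difference.\<close>

lemma tensor_truncate:
  "tensor (module.truncate V) W = tensor V W" "tensor V (module.truncate W) = tensor V W"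
  by (simp_all add: tensor_def quot_alg_def FactRing_def tensor_kernel_def bilinear_rels_def monoid_algebra_def DirProd_def module.defs)

lemma vspace_truncate: "vspace (module.truncate V) \<longleftrightarrow> vspace V"
  by (simp add: module_def abelian_group_def abelian_monoid_def abelian_group_axioms_def
      comm_group_def comm_monoid_def monoid_def comm_monoid_axioms_def group_def group_axioms_def Units_def
      module_axioms_def module.defs)

lemma linear_maps_truncate:
  "linear_maps (module.truncate V) W = linear_maps V W" "linear_maps V (module.truncate W) = linear_maps V W"
  by (simp_all add: linear_maps_def module.defs)

lemma submodule_truncate: "submodule U R (module.truncate V) \<longleftrightarrow> submodule U R V"
  by (simp add: submodule_def submodule_axioms_def subgroup_def m_inv_def module.defs)

lemma tensor_class_truncate:
  "tensor_class (module.truncate V) W = tensor_class V W" "tensor_class V (module.truncate W) = tensor_class V W"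
  by (simp_all add: fun_eq_iff tensor_class_def tensor_kernel_def bilinear_rels_def monoid_algebra_def DirProd_def module.defs)

lemma pure_tensor_truncate:
  "pure_tensor (module.truncate V) W = pure_tensor V W" "pure_tensor V (module.truncate W) = pure_tensor V W"
  by (simp_all add: fun_eq_iff pure_tensor_def tensor_class_truncate)

lemma finsum_truncate: "finsum (module.truncate V) = finsum V"
  by (simp add: fun_eq_iff finsum_def finprod_def comp_def module.defs)

lemma lin_ext_truncate: "lin_ext (module.truncate V) = lin_ext V"
  by (simp add: fun_eq_iff lin_ext_def finsum_truncate) (simp add: module.defs)

lemma induced_truncate: "induced (module.truncate V) = induced V"
  by (simp add: fun_eq_iff induced_def lin_ext_truncate)

lemma tensor_map_truncate:
  "tensor_map (module.truncate V) W = tensor_map V W" "tensor_map V (module.truncate W) = tensor_map V W"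
  by (simp_all add: fun_eq_iff tensor_map_def tensor_truncate pure_tensor_truncate)

lemma tensor_assoc_truncate: "tensor_assoc (module.truncate U) V W = tensor_assoc U V W"
  by (simp add: tensor_assoc_def tensor_truncate pure_tensor_truncate)

section \<open>Linear spans and dimension\<close>

text \<open>Defined through formal combinations rather than as an intersection of subspaces like
  \<open>gen_submodule\<close>, so that membership directly supplies coordinates.\<close>

definition lspan :: "('k::field, 'a, 'm) module_scheme \<Rightarrow> 'a set \<Rightarrow> 'a set" where
  "lspan V S = lin_ext V (\<lambda>x. x) ` {t. keys t \<subseteq> S}"

context vec_space begin

lemma lspan_subspace: assumes "S \<subseteq> carrier V" shows "submodule (lspan V S) ring_of_type_algebra V"
proof (rule subspaceI)
  have id: "(\<lambda>x. x) \<in> S \<rightarrow> carrier V" using assms by auto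
  show "lspan V S \<subseteq> carrier V" using lin_ext_closed[OF _ id] by (auto simp: lspan_def)
  show "\<zero> \<in> lspan V S" by (auto simp: lspan_def intro!: image_eqI[of _ _ 0])
  show "x \<oplus> y \<in> lspan V S" if xy: "x \<in> lspan V S" "y \<in> lspan V S" for x y
  proof -
    obtain s t where "keys s \<subseteq> S" "keys t \<subseteq> S" "x = lin_ext V (\<lambda>x. x) s" "y = lin_ext V (\<lambda>x. x) t"
      using xy by (auto simp: lspan_def)
    then show ?thesis unfolding lspan_def
      by (intro image_eqI[of _ _ "s + t"]) (simp_all add: lin_ext_add[OF _ _ id] keys_add_subset)
  qed
  show "c \<odot> x \<in> lspan V S" if x: "x \<in> lspan V S" for c x
  proof -
    obtain t where "keys t \<subseteq> S" "x = lin_ext V (\<lambda>x. x) t"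
      using x unfolding lspan_def by blast
    then show ?thesis unfolding lspan_def
      by (intro image_eqI[of _ _ "Poly_Mapping.map ((*) c) t"])
        (simp_all add: lin_ext_scale[OF _ id] order_trans[OF keys_map_times])
  qed
qed

lemma lspan_base: "S \<subseteq> carrier V \<Longrightarrow> x \<in> S \<Longrightarrow> x \<in> lspan V S"
  unfolding lspan_def by (intro image_eqI[of _ _ "single x 1"]) auto

lemma lin_ext_in_subspace:
  assumes "submodule U ring_of_type_algebra V" "\<phi> \<in> keys t \<rightarrow> U"
  shows "lin_ext V \<phi> t \<in> U"
  unfolding lin_ext_def using assms subspaceD(4)[OF assms(1)]
  by (intro subspace_finsum) auto

lemma lspan_least: "submodule U ring_of_type_algebra V \<Longrightarrow> S \<subseteq> U \<Longrightarrow> lspan V S \<subseteq> U"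
  unfolding lspan_def by (auto intro!: lin_ext_in_subspace)

lemma lin_ext_in_lspan: "\<phi> ` keys t \<subseteq> S \<Longrightarrow> S \<subseteq> carrier V \<Longrightarrow> lin_ext V \<phi> t \<in> lspan V S"
  using lspan_base by (intro lin_ext_in_subspace lspan_subspace) auto

end

context vector_space begin

text \<open>If the r + 1 vectors are distinct, they cannot be independent inside the span of at most
  r vectors; if two of them coincide, the coefficients 1 and -1 do.\<close>

lemma exists_linear_relation:
  assumes "finite E" "card E \<le> r" "\<And>k. k \<le> r \<Longrightarrow> v k \<in> span E"
  shows "\<exists>c. (\<exists>k\<le>r. c k \<noteq> 0) \<and> (\<Sum>k\<le>r. scale (c k) (v k)) = 0"
proof (cases "inj_on v {..r}")
  case True
  have "dependent (v ` {..r})"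
  proof (rule ccontr)
    assume "independent (v ` {..r})"
    then have "card (v ` {..r}) \<le> card E"
      using independent_span_bound[OF assms(1)] assms(3) by auto
    then show False using card_image[OF True] assms(2) by simp
  qed
  then obtain u where u: "\<exists>x\<in>v ` {..r}. u x \<noteq> 0" "(\<Sum>x\<in>v ` {..r}. scale (u x) x) = 0"
    using dependent_finite[of "v ` {..r}"] by auto
  then show ?thesis
    using sum.reindex[OF True, of "\<lambda>x. scale (u x) x"] by (intro exI[of _ "u \<circ> v"]) auto
next
  case False
  then obtain i j where ij: "i \<le> r" "j \<le> r" "i \<noteq> j" "v i = v j" by (auto simp: inj_on_def)
  let ?c = "\<lambda>k. if k = i then 1 else if k = j then -1 else 0"
  have "(\<Sum>k\<le>r. scale (?c k) (v k)) = (\<Sum>k\<in>{i,j}. scale (?c k) (v k))"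
    using ij by (intro sum.mono_neutral_right) auto
  also have "\<dots> = 0" using ij by simp
  finally show ?thesis using ij by (intro exI[of _ ?c]) auto
qed

lemma dim_strict_mono:
  assumes "finite E" "U \<subseteq> span E" "subspace U'" "U' \<subset> U"
  shows "dim U' < dim U"
proof -
  obtain B' where B': "B' \<subseteq> U'" "independent B'" "U' \<subseteq> span B'" "card B' = dim U'"
    using basis_exists[of U'] by blast
  obtain B where B: "B' \<subseteq> B" "B \<subseteq> U" "independent B" "U \<subseteq> span B"
    using maximal_independent_subset_extend[of B' U] B' assms(4) by blast
  have "finite B" using independent_span_bound[OF assms(1) B(3)] B(2) assms(2) by blast
  moreover have "B' \<noteq> B"
    using B(4) B'(1) assms(3,4) span_minimal[of B' U'] by blast
  ultimately have "card B' < card B" using B(1) by (intro psubset_card_mono) auto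
  then show ?thesis using B'(4) basis_card_eq_dim[OF B(2,4,3)] by simp
qed

end

section \<open>Eigenvectors of commuting operators\<close>

text \<open>The vector p(T) w, computed by Horner's scheme so that it obeys the recursion along
  \<open>pCons\<close>.\<close>

definition poly_op :: "('k::field, 'a, 'm) module_scheme \<Rightarrow> ('a \<Rightarrow> 'a) \<Rightarrow> 'k poly \<Rightarrow> 'a \<Rightarrow> 'a" where
  "poly_op V T p w = fold_coeffs (\<lambda>a x. (a \<odot>\<^bsub>V\<^esub> w) \<oplus>\<^bsub>V\<^esub> T x) p \<zero>\<^bsub>V\<^esub>"

context
  fixes V :: "('k::field, 'a, 'm) module_scheme" and T
  assumes V: "vspace V" and T: "T \<in> linear_maps V V"
begin

interpretation vec_space V using V by (simp add: vec_space_iff)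

lemma poly_op_0 [simp]: "poly_op V T 0 w = \<zero>\<^bsub>V\<^esub>"
  by (simp add: poly_op_def)

lemma poly_op_pCons:
  "w \<in> carrier V \<Longrightarrow> poly_op V T (pCons a p) w = a \<odot>\<^bsub>V\<^esub> w \<oplus>\<^bsub>V\<^esub> T (poly_op V T p w)"
  using linear_maps_zero[OF V V T] by (cases "p = 0 \<and> a = 0") (auto simp: poly_op_def)

lemma poly_op_closed: "w \<in> carrier V \<Longrightarrow> poly_op V T p w \<in> carrier V"
  using linear_mapsD(1)[OF T] by (induction p) (simp_all add: poly_op_pCons)

lemma poly_op_invariant:
  assumes "submodule W ring_of_type_algebra V" "\<And>x. x \<in> W \<Longrightarrow> T x \<in> W" "w \<in> W"
  shows "poly_op V T p w \<in> W"
  using subspaceD[OF assms(1)] assms(2,3) by (induction p) (auto simp: poly_op_pCons subset_iff)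

lemma poly_op_add: "w \<in> carrier V \<Longrightarrow> poly_op V T (p + q) w = poly_op V T p w \<oplus>\<^bsub>V\<^esub> poly_op V T q w"
  by (induction p q rule: poly_induct2)
    (simp_all add: poly_op_pCons poly_op_closed linear_mapsD[OF T] scale_left_distrib a_ac)

lemma poly_op_smult: "w \<in> carrier V \<Longrightarrow> poly_op V T (smult c p) w = c \<odot>\<^bsub>V\<^esub> poly_op V T p w"
  by (induction p)
    (simp_all add: poly_op_pCons poly_op_closed linear_mapsD[OF T] scale_right_distrib scale_assoc)

lemma poly_op_sum: "w \<in> carrier V \<Longrightarrow> poly_op V T (sum f A) w = (\<Oplus>\<^bsub>V\<^esub>i\<in>A. poly_op V T (f i) w)"
  by (induction A rule: infinite_finite_induct) (simp_all add: poly_op_add poly_op_closed)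

lemma poly_op_monom: "w \<in> carrier V \<Longrightarrow> poly_op V T (monom c k) w = c \<odot>\<^bsub>V\<^esub> (T ^^ k) w \<and> (T ^^ k) w \<in> carrier V"
proof (induction k)
  case 0 then show ?case using linear_maps_zero[OF V V T] by (simp add: monom_0 poly_op_pCons)
next
  case (Suc k) then show ?case
    using linear_mapsD[OF T] by (simp add: monom_Suc poly_op_pCons)
qed

text \<open>All iterates of w are values of formal combinations over the finite set E. Finitely many
  of these formal representatives already satisfy a linear relation, found in the type-based space
  of finitely supported functions; evaluating it in V shows that its coefficients define p.\<close>

lemma exists_annihilating_poly:
  assumes "w \<in> carrier V" "finite E" "E \<subseteq> carrier V" "\<And>k. (T ^^ k) w \<in> lspan V E"
  shows "\<exists>p. p \<noteq> 0 \<and> poly_op V T p w = \<zero>\<^bsub>V\<^esub>"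
proof -
  have "\<forall>k. \<exists>t. keys t \<subseteq> E \<and> (T ^^ k) w = lin_ext V (\<lambda>x. x) t"
    using assms(4) by (auto simp: lspan_def)
  then obtain t where t: "\<And>k. keys (t k) \<subseteq> E" "\<And>k. (T ^^ k) w = lin_ext V (\<lambda>x. x) (t k)" by metis
  let ?E = "(\<lambda>x. single x (1::'k)) ` E"
  have "t k \<in> poly_mapping.span ?E" for k
  proof -
    have "s \<in> poly_mapping.span ?E" if "keys s \<subseteq> E" for s
      using that
    proof (induction s rule: poly_mapping_induct)
      case (single x c)
      then show ?case using poly_mapping.span_scale[OF poly_mapping.span_base[of "single x 1" ?E], of c] by auto
    qed (auto intro: poly_mapping.span_zero poly_mapping.span_add)
    then show ?thesis using t(1) by blast
  qed
  then obtain c where c: "\<exists>k\<le>card ?E. c k \<noteq> 0" "(\<Sum>k\<le>card ?E. Poly_Mapping.map ((*) (c k)) (t k)) = 0"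
    using poly_mapping.exists_linear_relation[of ?E "card ?E" t] assms(2) by auto
  let ?p = "\<Sum>k\<le>card ?E. monom (c k) k"
  have id: "(\<lambda>x. x) \<in> E \<rightarrow> carrier V" using assms(3) by auto
  have sum: "lin_ext V (\<lambda>x. x) (\<Sum>k\<in>A. Poly_Mapping.map ((*) (c k)) (t k)) = (\<Oplus>\<^bsub>V\<^esub>k\<in>A. c k \<odot>\<^bsub>V\<^esub> (T ^^ k) w)"
    if "finite A" for A
    using that
  proof (induction A rule: finite_induct)
    case (insert a A)
    have "(T ^^ k) w \<in> carrier V" for k using poly_op_monom[OF assms(1)] by blast
    moreover have "keys (\<Sum>k\<in>A. Poly_Mapping.map ((*) (c k)) (t k)) \<subseteq> E"
      by (rule keys_sum_subset) (rule order_trans[OF keys_map_times t(1)])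
    ultimately show ?case
      using insert t by (simp add: lin_ext_add[OF _ _ id] lin_ext_scale[OF _ id] order_trans[OF keys_map_times])
  qed simp
  have "poly_op V T ?p w = (\<Oplus>\<^bsub>V\<^esub>k\<in>{..card ?E}. c k \<odot>\<^bsub>V\<^esub> (T ^^ k) w)"
    using poly_op_monom[OF assms(1)] by (simp add: poly_op_sum[OF assms(1)])
  also have "\<dots> = \<zero>\<^bsub>V\<^esub>" using sum[of "{..card ?E}"] c(2) by simp
  finally have "poly_op V T ?p w = \<zero>\<^bsub>V\<^esub>" .
  moreover have "coeff ?p k = c k" if "k \<le> card ?E" for k
    using that by (simp add: coeff_sum)
  then have "?p \<noteq> 0" using c(1) by (metis coeff_0)
  ultimately show ?thesis by blast
qed

end

text \<open>Split off a root: p = (X - c) q. The vector v = q(T) w satisfies T v = c v; if it is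
  nonzero it is an eigenvector, otherwise q annihilates w and has smaller degree. In degree 0 a
  nonzero constant would kill the nonzero vector w.\<close>

lemma exists_eigenvector:
  fixes V :: "('k::alg_closed_field, 'a, 'm) module_scheme"
  assumes V: "vspace V" and T: "T \<in> linear_maps V V"
    and W: "submodule W ring_of_type_algebra V" "\<And>x. x \<in> W \<Longrightarrow> T x \<in> W"
    and w: "w \<in> W" "w \<noteq> \<zero>\<^bsub>V\<^esub>" and p: "p \<noteq> 0" "poly_op V T p w = \<zero>\<^bsub>V\<^esub>"
  shows "\<exists>c. \<exists>v\<in>W. v \<noteq> \<zero>\<^bsub>V\<^esub> \<and> T v = c \<odot>\<^bsub>V\<^esub> v"
proof -
  interpret vec_space V using V by (simp add: vec_space_iff)
  have wV: "w \<in> carrier V" using w subspaceD(1)[OF W(1)] by auto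
  show ?thesis using p
  proof (induction "degree p" arbitrary: p)
    case 0
    then obtain a where a: "p = [:a:]" "a \<noteq> 0" by (metis degree_eq_zeroE pCons_0_0)
    have "a \<odot>\<^bsub>V\<^esub> w = \<zero>\<^bsub>V\<^esub>"
      using 0(3) wV linear_maps_zero[OF V V T] by (simp add: a poly_op_pCons[OF V T] poly_op_0[OF V T])
    then show ?case using scale_eq_zero_cancel[OF wV] a w by blast
  next
    case (Suc d)
    then obtain c where "poly p c = 0" using alg_closed_imp_poly_has_root[of p] by auto
    then obtain q where q: "p = [:-c, 1:] * q" by (metis dvdE poly_eq_0_iff_dvd)
    have q0: "q \<noteq> 0" using Suc.prems(1) q by auto
    have "degree p = degree [:-c, 1:] + degree q"
      unfolding q using q0 by (intro degree_mult_eq) auto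
    then have deg: "degree q = d" using Suc.hyps(2) by simp
    let ?v = "poly_op V T q w"
    have v: "?v \<in> W" by (rule poly_op_invariant[OF V T W w(1)])
    then have vV: "?v \<in> carrier V" using subspaceD(1)[OF W(1)] by auto
    have "p = smult (- c) q + pCons 0 q" by (simp add: q)
    then have "poly_op V T p w = (- c) \<odot>\<^bsub>V\<^esub> ?v \<oplus>\<^bsub>V\<^esub> (0 \<odot>\<^bsub>V\<^esub> w \<oplus>\<^bsub>V\<^esub> T ?v)"
      by (simp only: poly_op_add[OF V T wV] poly_op_smult[OF V T wV] poly_op_pCons[OF V T wV])
    then have "(- c) \<odot>\<^bsub>V\<^esub> ?v \<oplus>\<^bsub>V\<^esub> T ?v = \<zero>\<^bsub>V\<^esub>"
      using Suc.prems(2) wV vV linear_mapsD(1)[OF T] by simp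
    then have "c \<odot>\<^bsub>V\<^esub> ?v \<oplus>\<^bsub>V\<^esub> ((- c) \<odot>\<^bsub>V\<^esub> ?v \<oplus>\<^bsub>V\<^esub> T ?v) = c \<odot>\<^bsub>V\<^esub> ?v" using vV by simp
    then have "T ?v = c \<odot>\<^bsub>V\<^esub> ?v"
      using vV linear_mapsD(1)[OF T vV] by (simp flip: a_assoc scale_left_distrib)
    then show ?case using v Suc.hyps(1)[of q] deg q0 by blast
  qed
qed

text \<open>An eigenspace of one of the operators is invariant under the others.\<close>

lemma minimal_invariant_scalar:
  fixes V :: "('k::alg_closed_field, 'a, 'm) module_scheme"
  assumes V: "vspace V" and lin: "\<And>T. T \<in> \<T> \<Longrightarrow> T \<in> linear_maps V V"
    and comm: "\<And>S T x. S \<in> \<T> \<Longrightarrow> T \<in> \<T> \<Longrightarrow> x \<in> carrier V \<Longrightarrow> S (T x) = T (S x)"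
    and W: "submodule W ring_of_type_algebra V" "\<And>T x. T \<in> \<T> \<Longrightarrow> x \<in> W \<Longrightarrow> T x \<in> W"
    and minimal: "\<And>W'. submodule W' ring_of_type_algebra V \<Longrightarrow> W' \<subseteq> W \<Longrightarrow>
          (\<And>T x. T \<in> \<T> \<Longrightarrow> x \<in> W' \<Longrightarrow> T x \<in> W') \<Longrightarrow> W' = {\<zero>\<^bsub>V\<^esub>} \<or> W' = W"
    and w: "w \<in> W" "w \<noteq> \<zero>\<^bsub>V\<^esub>" and T: "T \<in> \<T>" and p: "p \<noteq> 0" "poly_op V T p w = \<zero>\<^bsub>V\<^esub>"
  shows "\<exists>c. \<forall>x\<in>W. T x = c \<odot>\<^bsub>V\<^esub> x"
proof -
  interpret vec_space V using V by (simp add: vec_space_iff)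
  note W' = subspaceD[OF W(1)]
  from exists_eigenvector[OF V lin[OF T] W(1) W(2)[OF T] w p]
  obtain c v where v: "v \<in> W" "v \<noteq> \<zero>\<^bsub>V\<^esub>" "T v = c \<odot>\<^bsub>V\<^esub> v" by blast
  let ?U = "{x \<in> W. T x = c \<odot>\<^bsub>V\<^esub> x}"
  have "submodule ?U ring_of_type_algebra V"
    using W' linear_mapsD(2,3)[OF lin[OF T]] linear_maps_zero[OF V V lin[OF T]]
    by (intro subspaceI) (auto simp: subset_iff scale_right_distrib scale_assoc mult.commute)
  moreover have "S x \<in> ?U" if "S \<in> \<T>" "x \<in> ?U" for S x
    using that W(2) comm[OF T that(1), of x] linear_mapsD(3)[OF lin[OF that(1)], of x c] W'(1) by auto
  ultimately have "?U = {\<zero>\<^bsub>V\<^esub>} \<or> ?U = W" by (intro minimal) auto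
  then have "?U = W" using v by blast
  then show ?thesis by blast
qed

section \<open>Hopf algebras\<close>

locale hopf_alg =
  fixes H :: "('k::field, 'a, 'm) hopf_scheme" (structure)
  assumes hopf: "hopf_algebra H"
begin

lemma unital: "unital_algebra H" using hopf by (simp add: hopf_algebra_def)

lemma vsp: "vspace H" using unital by (rule unital_algebra_simps)

sublocale ring H using unital by (rule unital_algebra_simps)
sublocale V: vec_space H using vsp by (simp add: vec_space_iff)

section \<open>The convolution algebra of functionals and its action on the Hopf algebra\<close>

abbreviation T where "T \<equiv> tensor H H"
abbreviation \<Delta> where "\<Delta> \<equiv> comult H"
abbreviation \<epsilon> where "\<epsilon> \<equiv> counit H"

lemma vsp_T: "vspace T" by (rule vspace_tensor[OF vsp vsp])

sublocale T: vec_space T using vsp_T by (simp add: vec_space_iff)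

lemma comult_linear: "\<Delta> \<in> linear_maps H T" and comult_ring_hom: "\<Delta> \<in> ring_hom H T"
  using hopf by (auto simp: hopf_algebra_def algebra_homs_def)

lemma counit_dual: "\<epsilon> \<in> dual H" and counit_ring_hom: "\<epsilon> \<in> ring_hom H scalars"
  using hopf by (auto simp: hopf_algebra_def algebra_homs_def)

lemma comult_closed [simp]: "x \<in> carrier H \<Longrightarrow> \<Delta> x \<in> carrier T"
  using linear_mapsD(1)[OF comult_linear] .

text \<open>In Sweedler notation x is sent to x_1 f(x_2). This is a left action of the dual with the
  product \<open>conv\<close>.\<close>

definition act :: "('a \<Rightarrow> 'k) \<Rightarrow> 'a \<Rightarrow> 'a" where
  "act f x = contract_right H f (\<Delta> x)"

definition conv :: "('a \<Rightarrow> 'k) \<Rightarrow> ('a \<Rightarrow> 'k) \<Rightarrow> 'a \<Rightarrow> 'k" where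
  "conv f g x = tensor_functional f g (\<Delta> x)"

lemma act_linear: "f \<in> dual H \<Longrightarrow> act f \<in> linear_maps H H"
  unfolding act_def[abs_def]
  by (rule linear_maps_comp[OF comult_linear contract_right_linear[OF vsp vsp]])

lemma act_closed [simp]: "f \<in> dual H \<Longrightarrow> x \<in> carrier H \<Longrightarrow> act f x \<in> carrier H"
  using linear_mapsD(1)[OF act_linear] .

lemma conv_dual: "f \<in> dual H \<Longrightarrow> g \<in> dual H \<Longrightarrow> conv f g \<in> dual H"
  unfolding conv_def[abs_def]
  by (rule linear_maps_comp[OF comult_linear tensor_functional_dual[OF vsp vsp]])

text \<open>Expresses values of convolution products by the action, so that identities for
  \<open>act\<close> follow from identities for \<open>conv\<close> by
  \<open>dual_separates\<close>.\<close>

lemma conv_act: "f \<in> dual H \<Longrightarrow> g \<in> dual H \<Longrightarrow> x \<in> carrier H \<Longrightarrow> conv f g x = f (act g x)"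
  unfolding conv_def act_def by (rule tensor_functional_contract[OF vsp vsp]) simp_all

lemma act_counit: "x \<in> carrier H \<Longrightarrow> act \<epsilon> x = x"
  using hopf by (simp add: hopf_algebra_def act_def contract_right_def)

text \<open>This is f applied to the left counit axiom; the right counit axiom is
  \<open>act_counit\<close>.\<close>

lemma conv_counit_left:
  assumes f: "f \<in> dual H" and x: "x \<in> carrier H" shows "conv \<epsilon> f x = f x"
proof -
  have bil: "bilinear_map H H H (\<lambda>(y, z). \<epsilon> y \<odot> z)"
    using dual_scale_vector[OF vsp counit_dual] linear_maps_scale[OF vsp linear_maps_id(2)]
    by (intro bilinear_mapI) auto
  have "f (induced H (\<lambda>(y, z). \<epsilon> y \<odot> z) C) = tensor_functional \<epsilon> f C" if "C \<in> carrier T" for C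
    by (rule linear_maps_tensor_eq[OF vsp vsp vspace_scalars linear_maps_comp[OF induced_linear[OF vsp vsp vsp bil] f]
       tensor_functional_dual[OF vsp vsp counit_dual f] _ that])
     (simp add: induced_pure[OF vsp vsp vsp bil] tensor_functional_pure[OF vsp vsp counit_dual f] dual_simps(2)[OF f])
  from this[of "\<Delta> x"] show ?thesis
    using hopf x by (simp add: hopf_algebra_def conv_def)
qed

text \<open>The functional f \<otimes> g \<otimes> h is applied to the coassociativity axiom. The
  three claims rewrite it on either side and across \<open>tensor_assoc\<close>, each by comparison
  on pure tensors.\<close>

lemma conv_assoc:
  assumes f: "f \<in> dual H" and g: "g \<in> dual H" and h: "h \<in> dual H" and x: "x \<in> carrier H"
  shows "conv (conv f g) h x = conv f (conv g h) x"
proof -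
  note fg = tensor_functional_dual[OF vsp vsp f g] and gh = tensor_functional_dual[OF vsp vsp g h]
  note m1 = tensor_map_linear[OF vsp_T vsp vsp vsp comult_linear linear_maps_id(1)]
  note m2 = tensor_map_linear[OF vsp vsp_T vsp vsp linear_maps_id(1) comult_linear]
  note a = tensor_assoc_linear[OF vsp vsp vsp]
  have 1: "tensor_functional (tensor_functional f g) h (tensor_map T H \<Delta> id C) = tensor_functional (conv f g) h C"
    if C: "C \<in> carrier T" for C
    by (rule linear_maps_tensor_eq[OF vsp vsp vspace_scalars
         linear_maps_comp[OF m1(1) tensor_functional_dual[OF vsp_T vsp fg h]]
         tensor_functional_dual[OF vsp vsp conv_dual[OF f g] h] _ C])
       (simp add: m1(2) tensor_functional_pure[OF vsp_T vsp fg h] tensor_functional_pure[OF vsp vsp conv_dual[OF f g] h] conv_def)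
  have 2: "tensor_functional f (tensor_functional g h) (tensor_map H T id \<Delta> C) = tensor_functional f (conv g h) C"
    if C: "C \<in> carrier T" for C
    by (rule linear_maps_tensor_eq[OF vsp vsp vspace_scalars
         linear_maps_comp[OF m2(1) tensor_functional_dual[OF vsp vsp_T f gh]]
         tensor_functional_dual[OF vsp vsp f conv_dual[OF g h]] _ C])
       (simp add: m2(2) tensor_functional_pure[OF vsp vsp_T f gh] tensor_functional_pure[OF vsp vsp f conv_dual[OF g h]] conv_def)
  have 3: "tensor_functional f (tensor_functional g h) (tensor_assoc H H H C) = tensor_functional (tensor_functional f g) h C"
    if C: "C \<in> carrier (tensor T H)" for C
  proof (rule linear_maps_tensor_eq[OF vsp_T vsp vspace_scalars
         linear_maps_comp[OF a(1) tensor_functional_dual[OF vsp vsp_T f gh]]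
         tensor_functional_dual[OF vsp_T vsp fg h] _ C])
    fix D z assume D: "D \<in> carrier T" and z: "z \<in> carrier H"
    show "tensor_functional f (tensor_functional g h) (tensor_assoc H H H (pure_tensor T H D z)) =
        tensor_functional (tensor_functional f g) h (pure_tensor T H D z)"
      by (rule linear_maps_tensor_eq[OF vsp vsp vspace_scalars
        linear_maps_comp[OF linear_maps_comp[OF pure_linear_left[OF vsp_T vsp z] a(1)] tensor_functional_dual[OF vsp vsp_T f gh]]
        linear_maps_comp[OF pure_linear_left[OF vsp_T vsp z] tensor_functional_dual[OF vsp_T vsp fg h]] _ D])
       (use z in \<open>simp add: a(2) pure_tensor_closed[OF vsp vsp] tensor_functional_pure[OF vsp vsp_T f gh] tensor_functional_pure[OF vsp_T vsp fg h]
         tensor_functional_pure[OF vsp vsp f g] tensor_functional_pure[OF vsp vsp g h]\<close>)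
  qed
  have "tensor_functional (conv f g) h (\<Delta> x) =
      tensor_functional f (tensor_functional g h) (tensor_assoc H H H (tensor_map T H \<Delta> id (\<Delta> x)))"
    using x by (simp add: 1[symmetric] 3 linear_mapsD(1)[OF m1(1)])
  also have "\<dots> = tensor_functional f (tensor_functional g h) (tensor_map H T id \<Delta> (\<Delta> x))"
    using hopf x by (simp add: hopf_algebra_def)
  also have "\<dots> = tensor_functional f (conv g h) (\<Delta> x)" using x by (simp add: 2)
  finally show ?thesis by (simp add: conv_def)
qed

text \<open>Against a functional h the two sides are the two bracketings of the convolution of h, f
  and g at x.\<close>

lemma act_act:
  assumes f: "f \<in> dual H" and g: "g \<in> dual H" and x: "x \<in> carrier H"
  shows "act f (act g x) = act (conv f g) x"
proof (rule dual_separates[OF vsp])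
  fix h assume h: "h \<in> dual H"
  show "h (act f (act g x)) = h (act (conv f g) x)"
    using conv_assoc[OF h f g x] f g h x
    by (simp add: conv_act[symmetric] conv_dual)
qed (use f g x in \<open>simp_all add: conv_dual\<close>)

text \<open>All iterates of x under \<open>act f\<close> are of the form \<open>act h x\<close> and
  so remain in the finite-dimensional space of \<open>act_locally_finite\<close>; this provides
  annihilating polynomials.\<close>

lemma act_power:
  assumes f: "f \<in> dual H" and x: "x \<in> carrier H"
  shows "\<exists>h\<in>dual H. (act f ^^ k) x = act h x"
proof (induction k)
  case 0 then show ?case using act_counit[OF x] counit_dual by (intro bexI[of _ \<epsilon>]) simp_all
next
  case (Suc k)
  then obtain h where "h \<in> dual H" "(act f ^^ k) x = act h x" by blast
  then show ?case using act_act[OF f _ x] conv_dual[OF f] by (intro bexI[of _ "conv f h"]) simp_all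
qed

text \<open>\<Delta>(x) is a finite combination of pure tensors, and contracting it leaves a
  combination of their left factors, whatever the functional.\<close>

lemma act_locally_finite:
  assumes x: "x \<in> carrier H"
  shows "\<exists>E. finite E \<and> E \<subseteq> carrier H \<and> (\<forall>f\<in>dual H. act f x \<in> lspan H E)"
proof -
  from comult_closed[OF x] obtain t where t: "keys t \<subseteq> carrier H \<times> carrier H" "\<Delta> x = tensor_class H H t"
    by (rule tensor_cases[OF vsp vsp])
  let ?E = "fst ` keys t"
  have E: "?E \<subseteq> carrier H" using t(1) by auto
  note S = V.lspan_subspace[OF E]
  have "act f x \<in> lspan H ?E" if f: "f \<in> dual H" for f
  proof -
    have "act f x = lin_ext H (\<lambda>(x, y). f y \<odot> x) t"
      unfolding act_def contract_right_def t(2)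
      by (rule induced_class[OF vsp vsp vsp bilinear_contract_right[OF vsp vsp f] t(1)])
    also have "\<dots> \<in> lspan H ?E"
    proof (intro V.lin_ext_in_subspace[OF S] Pi_I)
      fix p assume "p \<in> keys t"
      then have "fst p \<in> ?E" by simp
      then show "(case p of (x, y) \<Rightarrow> f y \<odot> x) \<in> lspan H ?E"
        using V.subspaceD(4)[OF S] V.lspan_base[OF E] by (simp add: case_prod_unfold)
    qed
    finally show ?thesis .
  qed
  with E show ?thesis by (intro exI[of _ ?E]) auto
qed

subsection \<open>Group-like elements\<close>

definition grouplike :: "'a set" where
  "grouplike = {g \<in> carrier H. g \<noteq> \<zero> \<and> \<Delta> g = pure_tensor H H g g}"

lemma grouplike_carrier: "g \<in> grouplike \<Longrightarrow> g \<in> carrier H"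
  by (simp add: grouplike_def)

lemma act_grouplike: "f \<in> dual H \<Longrightarrow> g \<in> grouplike \<Longrightarrow> act f g = f g \<odot> g"
  by (simp add: grouplike_def act_def contract_right_pure[OF vsp vsp])

lemma counit_grouplike: assumes "g \<in> grouplike" shows "\<epsilon> g = 1"
proof -
  have g: "g \<in> carrier H" "g \<noteq> \<zero>" using assms by (auto simp: grouplike_def)
  have e: "\<epsilon> g \<odot> g = g" using act_grouplike[OF counit_dual assms] act_counit[OF g(1)] by simp
  then have "\<epsilon> g * \<epsilon> g = \<epsilon> g" using dual_simps(2)[OF counit_dual g(1), of "\<epsilon> g"] by simp
  moreover have "\<epsilon> g \<noteq> 0" using e g by auto
  ultimately show ?thesis by simp
qed

text \<open>Every functional f \<otimes> h takes the value f(g) h(g) both on \<Delta>(g) and on g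
  \<otimes> g, and these functionals separate tensors.\<close>

lemma grouplikeI:
  assumes g: "g \<in> carrier H" "g \<noteq> \<zero>" and act: "\<And>f. f \<in> dual H \<Longrightarrow> act f g = f g \<odot> g"
  shows "g \<in> grouplike"
proof -
  have "\<Delta> g = pure_tensor H H g g"
    using g act
    by (intro tensor_functionals_separate[OF vsp vsp])
      (simp_all add: pure_tensor_closed[OF vsp vsp] tensor_functional_pure[OF vsp vsp] dual_simps(2)
         conv_act[unfolded conv_def])
  then show ?thesis using g by (simp add: grouplike_def)
qed

text \<open>The counit axioms give \<open>\<epsilon>(w) act f w = f(w) w\<close>, so the eigenvalues
  are the values of \<open>f\<close> at \<open>w / \<epsilon>(w)\<close>.\<close>

lemma eigenvector_grouplike:
  assumes w: "w \<in> carrier H" "w \<noteq> \<zero>" and eig: "\<And>f. f \<in> dual H \<Longrightarrow> \<exists>c. act f w = c \<odot> w"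
  shows "\<exists>c. \<exists>g\<in>grouplike. w = c \<odot> g"
proof -
  have f: "\<epsilon> w \<odot> act f w = f w \<odot> w" if f: "f \<in> dual H" for f
  proof -
    from eig[OF f] obtain c where c: "act f w = c \<odot> w" by blast
    have "f w = \<epsilon> (act f w)"
      using conv_counit_left[OF f w(1)] conv_act[OF counit_dual f w(1)] by simp
    also have "\<dots> = c * \<epsilon> w" unfolding c using dual_simps(2)[OF counit_dual w(1)] .
    finally show ?thesis using w by (simp add: c V.scale_assoc mult.commute)
  qed
  have e: "\<epsilon> w \<noteq> 0"
  proof
    assume "\<epsilon> w = 0"
    then have "f w = f \<zero>" if "f \<in> dual H" for f
      using f[OF that] w that V.scale_eq_zero_cancel[OF w(1)] dual_zero[OF vsp that] by (metis V.scale_zero_left act_closed)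
    then show False using dual_separates[OF vsp w(1) zero_closed] w(2) by blast
  qed
  let ?g = "inverse (\<epsilon> w) \<odot> w"
  have "?g \<in> grouplike"
  proof (rule grouplikeI)
    show "?g \<in> carrier H" using w by simp
    show "?g \<noteq> \<zero>" using V.scale_eq_zero_cancel[OF w(1), of "inverse (\<epsilon> w)"] e w by auto
    fix k assume k: "k \<in> dual H"
    have "act k ?g = inverse (\<epsilon> w) \<odot> act k w" by (rule linear_mapsD(3)[OF act_linear[OF k] w(1)])
    also have "\<dots> = inverse (\<epsilon> w) \<odot> (inverse (\<epsilon> w) \<odot> (\<epsilon> w \<odot> act k w))"
      using e k w by (simp add: V.scale_assoc)
    also have "\<dots> = k ?g \<odot> ?g"
      unfolding f[OF k] using w by (simp add: dual_simps(2)[OF k] V.scale_assoc mult_ac)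
    finally show "act k ?g = k ?g \<odot> ?g" .
  qed
  moreover have "w = \<epsilon> w \<odot> ?g" using w e by (simp add: V.scale_assoc)
  ultimately show ?thesis by blast
qed

lemma one_grouplike: "\<one> \<in> grouplike"
proof -
  have "\<epsilon> \<one> = 1" using ring_hom_one[OF counit_ring_hom] by simp
  then have "\<one> \<noteq> \<zero>" using dual_zero[OF vsp counit_dual] by auto
  moreover have "\<Delta> \<one> = pure_tensor H H \<one> \<one>"
    using ring_hom_one[OF comult_ring_hom] tensor_one[OF unital unital] by simp
  ultimately show ?thesis by (simp add: grouplike_def)
qed

lemma mult_grouplike: assumes "g \<in> grouplike" "h \<in> grouplike" shows "g \<otimes> h \<in> grouplike"
proof -
  have gh: "g \<in> carrier H" "h \<in> carrier H" using assms by (auto simp: grouplike_def)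
  have "\<epsilon> (g \<otimes> h) = 1"
    using ring_hom_mult[OF counit_ring_hom gh] counit_grouplike assms by simp
  then have "g \<otimes> h \<noteq> \<zero>" using dual_zero[OF vsp counit_dual] by auto
  moreover have "\<Delta> (g \<otimes> h) = pure_tensor H H (g \<otimes> h) (g \<otimes> h)"
    using ring_hom_mult[OF comult_ring_hom gh] assms gh
    by (simp add: grouplike_def pure_mult[OF unital unital])
  ultimately show ?thesis using gh by (simp add: grouplike_def)
qed

text \<open>Group-like elements are common eigenvectors with eigenvalues f(g). Applying
  \<open>act f\<close> minus f(h) to a relation removes the term of h, so the shorter relation is
  trivial by induction, that is, f(g) = f(h) for all f and all g in the support. The support is then
  {h}, which is impossible because h is nonzero.\<close>

lemma grouplike_independent:
  assumes "keys t \<subseteq> grouplike" "lin_ext H (\<lambda>x. x) t = \<zero>"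
  shows "t = 0"
  using assms
proof (induction "card (keys t)" arbitrary: t rule: less_induct)
  case less
  have kc: "keys t \<subseteq> carrier H" using less.prems(1) grouplike_carrier by blast
  show ?case
  proof (rule ccontr)
    assume "t \<noteq> 0"
    then obtain h where h: "h \<in> keys t" by (metis keys_eq_empty ex_in_conv)
    have "g = h" if g: "g \<in> keys t" for g
    proof (rule dual_separates[OF vsp])
      fix f assume f: "f \<in> dual H"
      \<comment> \<open>The coefficients of the relation after applying \<open>act f\<close> minus
        \<open>f h\<close> times the identity; the one at h is zero.\<close>
      let ?t = "Poly_Mapping.mapp (\<lambda>x c. (f x - f h) * c) t"
      have keys: "keys ?t \<subseteq> keys t - {h}"
        by (auto simp: in_keys_iff lookup_mapp when_def)
      have "lin_ext H (\<lambda>x. x) ?t = (\<Oplus>x\<in>keys t. lookup ?t x \<odot> x)"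
        using keys kc by (intro V.lin_ext_superset) auto
      also have "\<dots> = (\<Oplus>x\<in>keys t. lookup t x \<odot> act f x \<oplus> (- f h) \<odot> (lookup t x \<odot> x))"
        using kc less.prems(1) f
        by (intro finsum_cong')
          (auto simp: lookup_mapp when_def act_grouplike subset_iff V.scale_assoc algebra_simps simp flip: V.scale_left_distrib)
      also have "\<dots> = lin_ext H (act f) t \<oplus> (- f h) \<odot> lin_ext H (\<lambda>x. x) t"
        unfolding lin_ext_def using kc f
        by (subst V.scale_finsum) (auto intro!: finsum_addf)
      also have "lin_ext H (act f) t = act f (lin_ext H (\<lambda>x. x) t)"
        using kc by (subst linear_maps_lin_ext[OF vsp vsp act_linear[OF f]]) auto
      also have "\<dots> = \<zero>" using less.prems(2) linear_maps_zero[OF vsp vsp act_linear[OF f]] by simp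
      finally have "lin_ext H (\<lambda>x. x) ?t = \<zero>" using less.prems(2) by simp
      moreover have "card (keys ?t) < card (keys t)"
        using keys h by (intro psubset_card_mono) auto
      ultimately have "?t = 0" using less.hyps[of ?t] keys less.prems(1) by blast
      then have "lookup ?t g = 0" by simp
      then show "f g = f h" using g by (simp add: lookup_mapp in_keys_iff)
    qed (use g h kc in auto)
    then have "keys t = {h}" using h by blast
    then have "lin_ext H (\<lambda>x. x) t = lookup t h \<odot> h" using kc by (simp add: lin_ext_def)
    then have "h = \<zero>" using less.prems(2) V.scale_eq_zero_cancel[of h "lookup t h"] h kc by (auto simp: in_keys_iff)
    then show False using h less.prems(1) by (auto simp: grouplike_def)
  qed
qed

lemma grouplike_lin_ext_inj:
  assumes "keys s \<subseteq> grouplike" "keys t \<subseteq> grouplike" "lin_ext H (\<lambda>x. x) s = lin_ext H (\<lambda>x. x) t"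
  shows "s = t"
proof -
  have id: "(\<lambda>x. x) \<in> grouplike \<rightarrow> carrier H" using grouplike_carrier by auto
  have "lin_ext H (\<lambda>x. x) (s - t) = \<zero>"
    using assms V.lin_ext_closed[OF assms(2) id] by (simp add: V.lin_ext_diff[OF _ _ id] minus_eq r_neg)
  then have "s - t = 0" using grouplike_independent[of "s - t"] keys_diff_subset[OF assms(1,2)] by simp
  then show ?thesis by simp
qed

lemma grouplike_coordinate:
  assumes "F \<subseteq> grouplike" "g \<in> grouplike" "g \<notin> F"
  shows "\<exists>f\<in>dual H. f g = 1 \<and> (\<forall>h\<in>F. f h = 0)"
proof -
  have F: "F \<subseteq> carrier H" using assms(1) grouplike_carrier by auto
  have "g \<notin> lspan H F"
  proof
    assume "g \<in> lspan H F"
    then obtain t where t: "keys t \<subseteq> F" "g = lin_ext H (\<lambda>x. x) t" by (auto simp: lspan_def)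
    have "lin_ext H (\<lambda>x. x) (single g 1) = g" using grouplike_carrier[OF assms(2)] by simp
    then have "t = single g 1"
      using t assms by (intro grouplike_lin_ext_inj) auto
    then show False using t(1) assms(3) by simp
  qed
  from exists_separating_dual[OF vsp V.lspan_subspace[OF F] grouplike_carrier[OF assms(2)] this]
  show ?thesis using V.lspan_base[OF F] by blast
qed

text \<open>For x in U and g in its support, a functional which is 1 at g and 0 at the rest of the
  support acts on x by cutting out the multiple of g. So U contains every group-like element
  occurring in one of its members.\<close>

lemma invariant_subspace_grouplike:
  assumes U: "submodule U ring_of_type_algebra H" "\<And>f x. f \<in> dual H \<Longrightarrow> x \<in> U \<Longrightarrow> act f x \<in> U"
    and "U \<subseteq> lspan H grouplike"
  shows "U = lspan H (grouplike \<inter> U)"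
proof
  show "lspan H (grouplike \<inter> U) \<subseteq> U" by (rule V.lspan_least[OF U(1)]) simp
  show "U \<subseteq> lspan H (grouplike \<inter> U)"
  proof
    fix x assume x: "x \<in> U"
    with assms(3) obtain t where t: "keys t \<subseteq> grouplike" "x = lin_ext H (\<lambda>x. x) t"
      by (auto simp: lspan_def)
    have kc: "keys t \<subseteq> carrier H" using t(1) grouplike_carrier by auto
    have "g \<in> U" if g: "g \<in> keys t" for g
    proof -
      obtain f where f: "f \<in> dual H" "f g = 1" "\<And>h. h \<in> keys t - {g} \<Longrightarrow> f h = 0"
      proof -
        have "keys t - {g} \<subseteq> grouplike" "g \<in> grouplike" "g \<notin> keys t - {g}"
          using t(1) g by auto
        from grouplike_coordinate[OF this] show thesis using that by blast
      qed
      have "act f x = lin_ext H (act f) t"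
        unfolding t(2) using kc by (subst linear_maps_lin_ext[OF vsp vsp act_linear[OF f(1)]]) auto
      also have "\<dots> = (\<Oplus>h\<in>keys t. if h = g then lookup t h \<odot> h else \<zero>)"
        unfolding lin_ext_def using f t(1) kc
        by (intro finsum_cong') (auto simp: act_grouplike subset_iff)
      also have "\<dots> = lookup t g \<odot> g"
        using g kc by (subst V.finsum_delta) auto
      finally have "lookup t g \<odot> g \<in> U" using U(2)[OF f(1) x] by simp
      then have "inverse (lookup t g) \<odot> (lookup t g \<odot> g) \<in> U"
        using V.subspaceD(4)[OF U(1)] by blast
      then show ?thesis using g kc by (simp add: V.scale_assoc in_keys_iff subset_iff)
    qed
    then show "x \<in> lspan H (grouplike \<inter> U)" using t by (auto simp: lspan_def)
  qed
qed

end

locale cocommutative_hopf = hopf_alg +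
  assumes cocomm: "cocommutative H"
begin

lemma conv_commute:
  assumes f: "f \<in> dual H" and g: "g \<in> dual H" and x: "x \<in> carrier H"
  shows "conv f g x = conv g f x"
proof -
  have bil: "bilinear_map H H T (\<lambda>(y, z). pure_tensor H H z y)"
    using pure_linear_left[OF vsp vsp] pure_linear_right[OF vsp vsp] by (intro bilinear_mapI) auto
  have "tensor_functional f g (induced T (\<lambda>(y, z). pure_tensor H H z y) C) = tensor_functional g f C"
    if "C \<in> carrier T" for C
    by (rule linear_maps_tensor_eq[OF vsp vsp vspace_scalars
        linear_maps_comp[OF induced_linear[OF vsp vsp vsp_T bil] tensor_functional_dual[OF vsp vsp f g]]
        tensor_functional_dual[OF vsp vsp g f] _ that])
      (simp add: induced_pure[OF vsp vsp vsp_T bil] tensor_functional_pure[OF vsp vsp f g] tensor_functional_pure[OF vsp vsp g f])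
  from this[of "\<Delta> x"] show ?thesis
    using cocomm x by (simp add: cocommutative_def conv_def)
qed

lemma act_commute:
  "f \<in> dual H \<Longrightarrow> g \<in> dual H \<Longrightarrow> x \<in> carrier H \<Longrightarrow> act f (act g x) = act g (act f x)"
proof (rule dual_separates[OF vsp])
  fix h assume fgx: "f \<in> dual H" "g \<in> dual H" "x \<in> carrier H" and h: "h \<in> dual H"
  have "act f (act g x) = act (conv f g) x" "act g (act f x) = act (conv g f) x"
    using fgx by (simp_all add: act_act)
  moreover have "h (act (conv f g) x) = conv h (conv f g) x" "h (act (conv g f) x) = conv h (conv g f) x"
    using fgx h by (simp_all add: conv_act conv_dual)
  \<comment> \<open>Commutativity moves h to the right, where it is absorbed into the point
    \<open>act h x\<close>; there f and g can be exchanged.\<close>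
  moreover have "conv h (conv f g) x = conv (conv f g) h x" "conv h (conv g f) x = conv (conv g f) h x"
    using fgx h by (auto intro!: conv_commute conv_dual)
  moreover have "conv (conv f g) h x = conv (conv g f) h x"
  proof -
    have "conv (conv f g) h x = conv f g (act h x)" "conv (conv g f) h x = conv g f (act h x)"
      using fgx h by (simp_all add: conv_act conv_dual)
    then show ?thesis using fgx h conv_commute[of f g "act h x"] by simp
  qed
  ultimately show "h (act f (act g x)) = h (act g (act f x))" by simp
qed simp_all

end

lemma cosemisimple_spanned_by_grouplike:
  fixes H :: "('k::alg_closed_field, 'a, 'm) hopf_scheme"
  assumes "hopf_algebra H" "cocommutative H" "cosemisimple H"
  shows "carrier H = lspan H (hopf_alg.grouplike H)"
proof -
  interpret cocommutative_hopf H
    using assms by (simp add: cocommutative_hopf_def hopf_alg_def cocommutative_hopf_axioms_def)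
  let ?V = "module.truncate H :: ('k, 'a) module"
  have G: "grouplike \<subseteq> carrier H" using grouplike_carrier by auto
  have "comodule H ?V \<Delta>"
    using hopf vsp comult_linear
    unfolding comodule_def vspace_truncate linear_maps_truncate tensor_truncate tensor_assoc_truncate
      tensor_map_truncate induced_truncate
    by (simp add: hopf_algebra_def module.defs)
  then have ss: "semisimple_comodule H ?V \<Delta>" using assms(3) by (simp add: cosemisimple_def)
  \<comment> \<open>Subcomodules are the subspaces invariant under the dual: in one direction the
    contraction of \<Delta>(x) is evaluated, in the other
    \<open>tensor_contractions_in_subspace\<close> applies.\<close>
  have sub: "subcomodule H ?V \<Delta> W \<longleftrightarrow> submodule W ring_of_type_algebra H \<and> (\<forall>f\<in>dual H. \<forall>x\<in>W. act f x \<in> W)" for W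
  proof -
    have "(\<forall>w\<in>W. \<exists>t. keys t \<subseteq> W \<times> carrier H \<and> \<Delta> w = tensor_class H H t) \<longleftrightarrow>
        (\<forall>f\<in>dual H. \<forall>x\<in>W. act f x \<in> W)" if W: "submodule W ring_of_type_algebra H"
    proof (intro iffI ballI)
      fix f x assume *: "\<forall>w\<in>W. \<exists>t. keys t \<subseteq> W \<times> carrier H \<and> \<Delta> w = tensor_class H H t"
        and f: "f \<in> dual H" and x: "x \<in> W"
      then obtain t where t: "keys t \<subseteq> W \<times> carrier H" "\<Delta> x = tensor_class H H t" by blast
      then have t': "keys t \<subseteq> carrier H \<times> carrier H" using V.subspaceD(1)[OF W] by blast
      have "act f x = lin_ext H (\<lambda>(x, y). f y \<odot>\<^bsub>H\<^esub> x) t"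
        unfolding act_def contract_right_def t(2)
        by (rule induced_class[OF vsp vsp vsp bilinear_contract_right[OF vsp vsp f] t'])
      also have "\<dots> \<in> W"
        using V.subspaceD(4)[OF W] t(1) by (intro V.lin_ext_in_subspace[OF W]) auto
      finally show "act f x \<in> W" .
    next
      fix w assume "\<forall>f\<in>dual H. \<forall>x\<in>W. act f x \<in> W" "w \<in> W"
      then show "\<exists>t. keys t \<subseteq> W \<times> carrier H \<and> \<Delta> w = tensor_class H H t"
        using V.subspaceD(1)[OF W]
        by (intro tensor_contractions_in_subspace[OF vsp vsp W]) (auto simp: act_def)
    qed
    then show ?thesis by (auto simp: subcomodule_def submodule_truncate tensor_class_truncate)
  qed
  have simple: "W \<subseteq> lspan H grouplike" if W: "simple_subcomodule H ?V \<Delta> W" for W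
  proof -
    have z: "\<zero>\<^bsub>?V\<^esub> = \<zero>\<^bsub>H\<^esub>" by (simp add: module.defs)
    from W have Wsub: "submodule W ring_of_type_algebra H" and inv: "\<And>f x. f \<in> dual H \<Longrightarrow> x \<in> W \<Longrightarrow> act f x \<in> W"
      and min: "\<And>W'. submodule W' ring_of_type_algebra H \<Longrightarrow> (\<And>f x. f \<in> dual H \<Longrightarrow> x \<in> W' \<Longrightarrow> act f x \<in> W') \<Longrightarrow>
        W' \<subseteq> W \<Longrightarrow> W' = {\<zero>\<^bsub>H\<^esub>} \<or> W' = W"
      unfolding simple_subcomodule_def sub z by blast+
    have "w \<in> lspan H grouplike" if w: "w \<in> W" "w \<noteq> \<zero>\<^bsub>H\<^esub>" for w
    proof -
      have wH: "w \<in> carrier H" using V.subspaceD(1)[OF Wsub] w by auto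
      \<comment> \<open>The orbit of w is finite-dimensional, so some nonzero polynomial in
        \<open>act f\<close> kills w; simplicity of W then makes \<open>act f\<close> a scalar on
        W.\<close>
      have "\<exists>c. act f w = c \<odot>\<^bsub>H\<^esub> w" if f: "f \<in> dual H" for f
      proof -
        from act_locally_finite[OF wH] obtain E where E: "finite E" "E \<subseteq> carrier H" "\<And>f. f \<in> dual H \<Longrightarrow> act f w \<in> lspan H E"
          by blast
        have "(act f ^^ k) w \<in> lspan H E" for k using act_power[OF f wH, of k] E(3) by auto
        from exists_annihilating_poly[OF vsp act_linear[OF f] wH E(1,2) this]
        obtain p where p: "p \<noteq> 0" "poly_op H (act f) p w = \<zero>\<^bsub>H\<^esub>" by blast
        have "\<exists>c. \<forall>x\<in>W. act f x = c \<odot>\<^bsub>H\<^esub> x"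
          by (rule minimal_invariant_scalar[OF vsp, of "act ` dual H", OF _ _ Wsub _ _ w _ p])
            (use act_linear act_commute inv min f in \<open>auto 0 3\<close>)
        then show ?thesis using w by blast
      qed
      from eigenvector_grouplike[OF wH w(2) this] obtain c g where "g \<in> grouplike" "w = c \<odot>\<^bsub>H\<^esub> g" by blast
      then show ?thesis
        using V.lspan_base[OF G] V.subspaceD(4)[OF V.lspan_subspace[OF G]] by simp
    qed
    then show ?thesis using V.subspaceD(2)[OF V.lspan_subspace[OF G]] by blast
  qed
  have "v \<in> lspan H grouplike" if "v \<in> carrier H" for v
  proof -
    from ss obtain \<S> where \<S>: "\<forall>W\<in>\<S>. simple_subcomodule H ?V \<Delta> W"
      "\<forall>v\<in>carrier ?V. \<exists>F s. finite F \<and> F \<subseteq> \<S> \<and> (\<forall>W\<in>F. s W \<in> W) \<and> v = (\<Oplus>\<^bsub>?V\<^esub>W\<in>F. s W)"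
      unfolding semisimple_comodule_def by (elim exE conjE)
    have "v \<in> carrier ?V" using that by (simp add: module.defs)
    with \<S>(2) obtain F s where "F \<subseteq> \<S>" and F: "\<forall>W\<in>F. s W \<in> W" "v = (\<Oplus>\<^bsub>?V\<^esub>W\<in>F. s W)" by metis
    with \<S>(1) have simple_F: "\<forall>W\<in>F. simple_subcomodule H ?V \<Delta> W" by auto
    have "v = (\<Oplus>\<^bsub>H\<^esub>W\<in>F. s W)" using F(2) by (simp add: finsum_truncate)
    also have "\<dots> \<in> lspan H grouplike"
      using F(1) simple_F simple by (intro V.subspace_finsum[OF V.lspan_subspace[OF G]]) auto
    finally show ?thesis .
  qed
  then show ?thesis using V.subspaceD(1)[OF V.lspan_subspace[OF G]] by blast
qed

section \<open>The algebra of the quantum permutation group\<close>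

lemma ideal_subspace:
  assumes "unital_algebra A" "ideal I A"
  shows "submodule I ring_of_type_algebra A"
proof -
  interpret vec_space A using unital_algebra_simps[OF assms(1)] by (simp add: vec_space_iff)
  interpret ideal I A by fact
  show ?thesis
  proof (rule subspaceI)
    fix c x assume x: "x \<in> I"
    \<comment> \<open>Ideals absorb ring elements, and scaling by c is multiplication by the ring
      element c 1.\<close>
    have "c \<odot>\<^bsub>A\<^esub> x = (c \<odot>\<^bsub>A\<^esub> \<one>\<^bsub>A\<^esub>) \<otimes>\<^bsub>A\<^esub> x"
      using x a_subset unital_algebra_simps(3)[OF assms(1), of "\<one>\<^bsub>A\<^esub>" x c] by auto
    then show "c \<odot>\<^bsub>A\<^esub> x \<in> I" using I_l_closed[OF x, of "c \<odot>\<^bsub>A\<^esub> \<one>\<^bsub>A\<^esub>"] by simp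
  qed (use a_subset in auto)
qed

lemma free_monoid_simps [simp]:
  "carrier (free_monoid L) = lists L" "v \<otimes>\<^bsub>free_monoid L\<^esub> w = v @ w" "\<one>\<^bsub>free_monoid L\<^esub> = []"
  by (simp_all add: free_monoid_def)

lemma monoid_free_monoid: "monoid (free_monoid L)"
  by (rule monoidI) auto

lemma unital_algebra_free_algebra: "unital_algebra (free_algebra L :: ('k::field, _) module)"
  unfolding free_algebra_def by (rule unital_algebra_monoid_algebra[OF monoid_free_monoid])

interpretation free: ring "free_algebra L :: ('k::field, _) module" for L
  by (rule unital_algebra_simps[OF unital_algebra_free_algebra])

lemma As_rels_subset: "As_rels n \<subseteq> carrier (free_algebra (As_letters n) :: ('k::field, _) module)"
proof -
  have s: "keys (\<Sum>l\<in>{1..n}. single (f l) (1::'k)) \<subseteq> lists (As_letters n)"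
    if "\<And>l. l \<in> {1..n} \<Longrightarrow> f l \<in> lists (As_letters n)" for f
    by (rule keys_sum_subset) (use that in simp)
  show ?thesis
    unfolding As_rels_def Let_def free_algebra_def
    by (rule subsetI, elim UnE CollectE exE conjE; simp add: keys_diff_subset del: One_nat_def)
      (intro keys_diff_subset s; simp del: One_nat_def)+
qed

section \<open>Magic matrices and the universal property of the algebra of the quantum permutation
  group\<close>

definition word_eval :: "('k::field, 'a, 'm) module_scheme \<Rightarrow> (nat \<Rightarrow> nat \<Rightarrow> 'a) \<Rightarrow> (nat \<times> nat) list \<Rightarrow> 'a" where
  "word_eval B d w = foldr (\<lambda>(i, j) C. d i j \<otimes>\<^bsub>B\<^esub> C) w \<one>\<^bsub>B\<^esub>"

lemma word_eval_simps [simp]: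
  "word_eval B d [] = \<one>\<^bsub>B\<^esub>" "word_eval B d ((i, j) # w) = d i j \<otimes>\<^bsub>B\<^esub> word_eval B d w"
  by (simp_all add: word_eval_def)

text \<open>A magic matrix in B amounts to an algebra homomorphism from \<open>As_algebra n\<close>
  to B. The locale is instantiated with the generators themselves, with their comultiplication
  matrix in the tensor square, with their images in H, and with the generators in the conjugate
  opposite algebra.\<close>

locale magic_matrix =
  fixes B :: "('k::field, 'a, 'm) module_scheme" (structure) and n :: nat and u :: "nat \<Rightarrow> nat \<Rightarrow> 'a"
  assumes alg: "unital_algebra B"
    and u_closed: "\<And>i j. i \<in> {1..n} \<Longrightarrow> j \<in> {1..n} \<Longrightarrow> u i j \<in> carrier B"
    and row_mult: "\<And>i j k. i \<in> {1..n} \<Longrightarrow> j \<in> {1..n} \<Longrightarrow> k \<in> {1..n} \<Longrightarrow>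
        u k i \<otimes> u k j = (if i = j then u k i else \<zero>)"
    and row_sum: "\<And>i. i \<in> {1..n} \<Longrightarrow> (\<Oplus>l\<in>{1..n}. u i l) = \<one>"
    and col_mult: "\<And>i j k. i \<in> {1..n} \<Longrightarrow> j \<in> {1..n} \<Longrightarrow> k \<in> {1..n} \<Longrightarrow>
        u i k \<otimes> u j k = (if i = j then u i k else \<zero>)"
    and col_sum: "\<And>i. i \<in> {1..n} \<Longrightarrow> (\<Oplus>l\<in>{1..n}. u l i) = \<one>"
begin

lemma vspace_B: "vspace B" using unital_algebra_simps[OF alg] by simp

sublocale ring B using alg by (rule unital_algebra_simps)
sublocale V: vec_space B using vspace_B by (simp add: vec_space_iff)

lemma word_eval_closed [simp]: "w \<in> lists (As_letters n) \<Longrightarrow> word_eval B u w \<in> carrier B"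
  by (induction w) (auto simp: u_closed)

lemma word_eval_append:
  "v \<in> lists (As_letters n) \<Longrightarrow> w \<in> lists (As_letters n) \<Longrightarrow>
   word_eval B u (v @ w) = word_eval B u v \<otimes> word_eval B u w"
proof (induction v)
  case (Cons a v)
  obtain i j where a: "a = (i, j)" by (cases a)
  have "u i j \<in> carrier B" "word_eval B u v \<in> carrier B" "word_eval B u w \<in> carrier B"
    using Cons.prems a by (auto intro!: u_closed word_eval_closed)
  then show ?case using Cons a by (simp add: m_assoc)
qed simp

lemma word_eval_funcset: "word_eval B u \<in> carrier (free_monoid (As_letters n)) \<rightarrow> carrier B"
  by auto

abbreviation "eval_free \<equiv> lin_ext B (word_eval B u)"

lemma eval_free_linear: "eval_free \<in> linear_maps (free_algebra (As_letters n)) B"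
  unfolding free_algebra_def by (rule lin_ext_linear[OF vspace_B word_eval_funcset])

lemma eval_free_mult:
  assumes "keys s \<subseteq> lists (As_letters n)" "keys t \<subseteq> lists (As_letters n)"
  shows "eval_free (s \<otimes>\<^bsub>free_algebra (As_letters n)\<^esub> t) = eval_free s \<otimes> eval_free t"
proof -
  let ?F = "free_algebra (As_letters n) :: ('k, _) module"
  note F = unital_algebra_free_algebra[of "As_letters n"]
  note F' = linear_maps_eq_on_singles[OF vspace_B, where G = "free_monoid (As_letters n)", folded free_algebra_def]
  have cl: "x \<in> carrier ?F" if "keys x \<subseteq> lists (As_letters n)" for x
    using that by (simp add: free_algebra_def)
  have single: "eval_free (single v 1 \<otimes>\<^bsub>?F\<^esub> t) = eval_free (single v 1) \<otimes> eval_free t"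
    if v: "v \<in> lists (As_letters n)" and t: "keys t \<subseteq> lists (As_letters n)" for v t
    by (rule F'[OF linear_maps_comp[OF mult_linear_left[OF F cl] eval_free_linear]
          linear_maps_comp[OF eval_free_linear mult_linear_left[OF alg]]])
      (use v t linear_mapsD(1)[OF eval_free_linear cl] in
        \<open>simp_all add: free_algebra_def word_eval_append\<close>)
  show ?thesis
    by (rule F'[OF linear_maps_comp[OF mult_linear_right[OF F cl] eval_free_linear]
          linear_maps_comp[OF eval_free_linear mult_linear_right[OF alg]]])
      (use assms linear_mapsD(1)[OF eval_free_linear cl] single in simp_all)
qed

lemma eval_free_rels: assumes "r \<in> As_rels n" shows "eval_free r = \<zero>"
proof -
  note diff = V.lin_ext_diff[OF _ _ word_eval_funcset, simplified]
  have sum: "eval_free (\<Sum>l\<in>A. single [(f l, g l)] 1) = (\<Oplus>l\<in>A. u (f l) (g l))"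
    if "finite A" "\<And>l. l \<in> A \<Longrightarrow> f l \<in> {1..n}" "\<And>l. l \<in> A \<Longrightarrow> g l \<in> {1..n}" for f g and A :: "nat set"
    using that
  proof (induction A rule: finite_induct)
    case (insert a A)
    have "keys (\<Sum>l\<in>A. single [(f l, g l)] (1::'k)) \<subseteq> lists (As_letters n)"
      using insert.prems by (intro keys_sum_subset) auto
    moreover have "u (f l) (g l) \<in> carrier B" if "l \<in> insert a A" for l
      using insert.prems that by (intro u_closed) auto
    ultimately show ?case
      using insert by (simp add: V.lin_ext_add[OF _ _ word_eval_funcset] Pi_iff)
  qed simp
  from assms show ?thesis
    unfolding As_rels_def Let_def
  proof (elim UnE CollectE exE conjE)
    fix i j k assume r: "r = single [(k, i), (k, j)] 1 - (if i = j then single [(k, i)] 1 else 0)"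
      and i: "i \<in> {1..n}" "j \<in> {1..n}" "k \<in> {1..n}"
    then show ?thesis
      using u_closed[OF i(3,1)] u_closed[OF i(3,2)] row_mult[OF i]
      by (cases "i = j") (simp_all add: diff minus_eq r_neg)
  next
    fix i j k assume r: "r = single [(i, k), (j, k)] 1 - (if i = j then single [(i, k)] 1 else 0)"
      and i: "i \<in> {1..n}" "j \<in> {1..n}" "k \<in> {1..n}"
    then show ?thesis
      using u_closed[OF i(1,3)] u_closed[OF i(2,3)] col_mult[OF i]
      by (cases "i = j") (simp_all add: diff minus_eq r_neg)
  next
    fix i assume r: "r = (\<Sum>l\<in>{1..n}. single [(i, l)] 1) - single [] 1" and i: "i \<in> {1..n}"
    have k: "keys (\<Sum>l\<in>{1..n}. single [(i, l)] (1::'k)) \<subseteq> lists (As_letters n)"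
      using i by (intro keys_sum_subset) auto
    show ?thesis
      using k i sum[of "{1..n}" "\<lambda>_. i" "\<lambda>l. l"] row_sum[OF i] unfolding r
      by (subst diff) (simp_all add: minus_eq r_neg)
  next
    fix i assume r: "r = (\<Sum>l\<in>{1..n}. single [(l, i)] 1) - single [] 1" and i: "i \<in> {1..n}"
    have k: "keys (\<Sum>l\<in>{1..n}. single [(l, i)] (1::'k)) \<subseteq> lists (As_letters n)"
      using i by (intro keys_sum_subset) auto
    show ?thesis
      using k i sum[of "{1..n}" "\<lambda>l. l" "\<lambda>_. i"] col_sum[OF i] unfolding r
      by (subst diff) (simp_all add: minus_eq r_neg)
  qed
qed

text \<open>By multiplicativity the kernel of the evaluation is a two-sided ideal. It contains the
  relations, hence the ideal generated by them.\<close>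

lemma eval_free_ideal: assumes "t \<in> As_ideal n" shows "eval_free t = \<zero>"
proof -
  let ?F = "free_algebra (As_letters n) :: ('k, _) module"
  let ?I = "{t \<in> carrier ?F. eval_free t = \<zero>}"
  note lin = linear_mapsD[OF eval_free_linear]
  have carrier: "carrier ?F = {t. keys t \<subseteq> lists (As_letters n)}" by (simp add: free_algebra_def)
  have sub: "submodule ?I ring_of_type_algebra ?F"
    using kernel_subspace[OF unital_algebra_simps(2)[OF unital_algebra_free_algebra] vspace_B eval_free_linear
      singleton_zero_subspace[OF vspace_B]] by simp
  have "ideal ?I ?F"
  proof (rule idealI[OF free.ring_axioms])
    show "subgroup ?I (add_monoid ?F)" using sub by (simp add: submodule_def)
    show "x \<otimes>\<^bsub>?F\<^esub> a \<in> ?I" "a \<otimes>\<^bsub>?F\<^esub> x \<in> ?I" if "a \<in> ?I" "x \<in> carrier ?F" for a x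
    proof -
      have ax: "a \<in> carrier ?F" "eval_free a = \<zero>" using that(1) by auto
      then show "x \<otimes>\<^bsub>?F\<^esub> a \<in> ?I" "a \<otimes>\<^bsub>?F\<^esub> x \<in> ?I"
        using eval_free_mult[of a x] eval_free_mult[of x a] that(2) lin(1)[OF that(2)] carrier
          free.m_closed[OF that(2) ax(1)] free.m_closed[OF ax(1) that(2)]
        by (simp_all only: mem_Collect_eq l_null r_null simp_thms)
    qed
  qed
  then have "As_ideal n \<subseteq> ?I"
    unfolding As_ideal_def using As_rels_subset eval_free_rels by (intro free.genideal_minimal) auto
  then show ?thesis using assms by auto
qed

lemma induced_As_word:
  assumes "w \<in> lists (As_letters n)" and "ideal (As_ideal n) (free_algebra (As_letters n) :: ('k, _) module)"
  shows "induced B (word_eval B u) (As_word n w) = word_eval B u w"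
proof -
  have "induced B (word_eval B u) (As_word n w) = eval_free (single w 1)"
    unfolding As_word_def free_algebra_def
    by (rule induced_coset[OF vspace_B word_eval_funcset
         ideal_subspace[OF unital_algebra_free_algebra assms(2), unfolded free_algebra_def]])
      (use assms eval_free_ideal in auto)
  then show ?thesis using assms by simp
qed

end

lemma As_relsI:
  assumes "i \<in> {1..n}"
  shows "j \<in> {1..n} \<Longrightarrow> k \<in> {1..n} \<Longrightarrow>
      single [(k, i), (k, j)] 1 - (if i = j then single [(k, i)] 1 else 0) \<in> As_rels n"
    "j \<in> {1..n} \<Longrightarrow> k \<in> {1..n} \<Longrightarrow>
      single [(i, k), (j, k)] 1 - (if i = j then single [(i, k)] 1 else 0) \<in> As_rels n"
    "(\<Sum>l\<in>{1..n}. single [(i, l)] 1) - single [] 1 \<in> As_rels n"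
    "(\<Sum>l\<in>{1..n}. single [(l, i)] 1) - single [] 1 \<in> As_rels n"
  unfolding As_rels_def Let_def using assms by blast+

lemma As_ideal_ideal: "ideal (As_ideal n) (free_algebra (As_letters n) :: ('k::field, _) module)"
  unfolding As_ideal_def by (rule free.genideal_ideal[OF As_rels_subset])

interpretation As_quot: quotient_space "free_algebra (As_letters n) :: ('k::field, _) module" "As_ideal n" for n
  using ideal_subspace[OF unital_algebra_free_algebra As_ideal_ideal, of n]
    unital_algebra_simps(2)[OF unital_algebra_free_algebra[of "As_letters n"]]
  by (simp add: quotient_space_def quotient_space_axioms_def vec_space_iff)

lemma unital_algebra_As: "unital_algebra (As_algebra n :: ('k::field, _) module)"
  unfolding As_algebra_def by (rule As_quot.unital_algebra_quot[OF unital_algebra_free_algebra As_ideal_ideal])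

interpretation As: ring "As_algebra n :: ('k::field, _) module" for n
  by (rule unital_algebra_simps[OF unital_algebra_As])

lemma As_word_closed: "w \<in> lists (As_letters n) \<Longrightarrow> As_word n w \<in> carrier (As_algebra n :: ('k::field, _) module)"
  unfolding As_word_def As_algebra_def by (rule As_quot.quot_closed) (simp add: free_algebra_def)

lemma As_word_Nil: "\<one>\<^bsub>As_algebra n :: ('k::field, _) module\<^esub> = As_word n []"
  by (simp add: As_word_def As_algebra_def quot_alg_simps) (simp add: free_algebra_def)

lemma As_word_append:
  "v \<in> lists (As_letters n) \<Longrightarrow> w \<in> lists (As_letters n) \<Longrightarrow>
   As_word n (v @ w) = As_word n v \<otimes>\<^bsub>As_algebra n :: ('k::field, _) module\<^esub> As_word n w"
  unfolding As_word_def As_algebra_def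
  by (subst As_quot.quot_mult_ideal[OF As_ideal_ideal]) (simp_all add: free_algebra_def)

lemma magic_As: "magic_matrix (As_algebra n :: ('k::field, _) module) n (As_gen n)"
proof -
  let ?F = "free_algebra (As_letters n) :: ('k::field, _) module" and ?A = "As_algebra n :: ('k::field, _) module"
  let ?c = "\<lambda>t. As_ideal n +>\<^bsub>?F\<^esub> t"
  note lin = As_quot.coset_linear[of n, folded As_algebra_def, where ?'k = 'k]
  note vF = unital_algebra_simps(2)[OF unital_algebra_free_algebra] and vA = unital_algebra_simps(2)[OF unital_algebra_As]
  have rel: "?c s = ?c t" if "s - t \<in> As_rels n" "keys s \<subseteq> lists (As_letters n)" "keys t \<subseteq> lists (As_letters n)" for s t
  proof -
    have "s - t \<in> As_ideal n" unfolding As_ideal_def using free.genideal_self[OF As_rels_subset] that(1) by auto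
    then show ?thesis using that(2,3) by (subst As_quot.coset_eq_iff) (simp_all add: free_algebra_def)
  qed
  have sum: "?c (\<Sum>l\<in>A. single (w l) 1) = (\<Oplus>\<^bsub>?A\<^esub>l\<in>A. As_word n (w l))"
    if "w ` A \<subseteq> lists (As_letters n)" for w and A :: "nat set"
  proof -
    have "(\<Oplus>\<^bsub>?F\<^esub>l\<in>A. single (w l) (1::'k)) = (\<Sum>l\<in>A. single (w l) 1)"
      unfolding free_algebra_def using that by (intro finsum_monoid_algebra) (simp add: image_subset_iff)
    moreover have "(\<lambda>l. single (w l) (1::'k)) \<in> A \<rightarrow> carrier ?F"
      using that by (simp add: free_algebra_def image_subset_iff)
    ultimately show ?thesis
      using linear_maps_finsum[OF vF vA lin, of "\<lambda>l. single (w l) 1" A] by (simp only: As_word_def)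
  qed
  have zero: "?c 0 = \<zero>\<^bsub>?A\<^esub>" using linear_maps_zero[OF vF vA lin] by (simp add: free_algebra_def)
  show ?thesis
  proof (unfold_locales)
    show "unital_algebra ?A" by (rule unital_algebra_As)
    fix i assume i: "i \<in> {1..n}"
    show "As_gen n i j \<in> carrier ?A" if "j \<in> {1..n}" for j
      using i that by (simp add: As_gen_def As_word_closed)
    have k: "keys (\<Sum>l\<in>{1..n}. single [(i, l)] (1::'k)) \<subseteq> lists (As_letters n)"
       "keys (\<Sum>l\<in>{1..n}. single [(l, i)] (1::'k)) \<subseteq> lists (As_letters n)"
      by (rule keys_sum_subset; use i in simp)+
    have "?c (\<Sum>l\<in>{1..n}. single [(i, l)] 1) = ?c (single [] 1)"
      by (rule rel[OF As_relsI(3)]) (use i k in simp_all)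
    moreover have "?c (\<Sum>l\<in>{1..n}. single [(i, l)] 1) = (\<Oplus>\<^bsub>?A\<^esub>l\<in>{1..n}. As_word n [(i, l)])"
      by (rule sum) (use i in auto)
    ultimately show "(\<Oplus>\<^bsub>?A\<^esub>l\<in>{1..n}. As_gen n i l) = \<one>\<^bsub>?A\<^esub>"
      unfolding As_gen_def As_word_Nil by (simp only: As_word_def)
    have "?c (\<Sum>l\<in>{1..n}. single [(l, i)] 1) = ?c (single [] 1)"
      by (rule rel[OF As_relsI(4)]) (use i k in simp_all)
    moreover have "?c (\<Sum>l\<in>{1..n}. single [(l, i)] 1) = (\<Oplus>\<^bsub>?A\<^esub>l\<in>{1..n}. As_word n [(l, i)])"
      by (rule sum) (use i in auto)
    ultimately show "(\<Oplus>\<^bsub>?A\<^esub>l\<in>{1..n}. As_gen n l i) = \<one>\<^bsub>?A\<^esub>"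
      unfolding As_gen_def As_word_Nil by (simp only: As_word_def)
    fix j k assume jk: "j \<in> {1..n}" "k \<in> {1..n}"
    have "?c (single [(k, i), (k, j)] 1) = ?c (if i = j then single [(k, i)] 1 else 0)"
      by (rule rel[OF As_relsI(1)]) (use i jk in simp_all)
    then show "As_gen n k i \<otimes>\<^bsub>?A\<^esub> As_gen n k j = (if i = j then As_gen n k i else \<zero>\<^bsub>?A\<^esub>)"
      using i jk As_word_append[of "[(k, i)]" n "[(k, j)]"] zero by (auto simp: As_gen_def As_word_def)
    have "?c (single [(i, k), (j, k)] 1) = ?c (if i = j then single [(i, k)] 1 else 0)"
      by (rule rel[OF As_relsI(2)]) (use i jk in simp_all)
    then show "As_gen n i k \<otimes>\<^bsub>?A\<^esub> As_gen n j k = (if i = j then As_gen n i k else \<zero>\<^bsub>?A\<^esub>)"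
      using i jk As_word_append[of "[(i, k)]" n "[(j, k)]"] zero by (auto simp: As_gen_def As_word_def)
  qed
qed

text \<open>A product of two entries is a double sum over a and b. For entries in one row the left
  tensor factors force a = b by \<open>row_mult\<close>, after which the right factors lie in one
  row and force i = j. For entries in one column the right factors force a = b and the left ones i =
  j. The row and column sums collapse in the same two stages.\<close>

lemma (in magic_matrix) magic_comult:
  "magic_matrix (tensor B B) n (\<lambda>i j. \<Oplus>\<^bsub>tensor B B\<^esub>k\<in>{1..n}. pure_tensor B B (u i k) (u k j))"
proof -
  let ?T = "tensor B B"
  let ?p = "pure_tensor B B"
  let ?d = "\<lambda>i j. \<Oplus>\<^bsub>?T\<^esub>k\<in>{1..n}. ?p (u i k) (u k j)"
  note v = vspace_B
  note T = unital_algebra_tensor[OF alg alg]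
  interpret T: ring ?T by (rule unital_algebra_simps[OF T])
  interpret TV: vec_space ?T using unital_algebra_simps[OF T] by (simp add: vec_space_iff)
  note pc = pure_tensor_closed[OF v v]
  have mult: "?d a b \<otimes>\<^bsub>?T\<^esub> ?d c d = (\<Oplus>\<^bsub>?T\<^esub>k\<in>{1..n}. \<Oplus>\<^bsub>?T\<^esub>l\<in>{1..n}. ?p (u a k \<otimes> u c l) (u k b \<otimes> u l d))"
    if "a \<in> {1..n}" "b \<in> {1..n}" "c \<in> {1..n}" "d \<in> {1..n}" for a b c d
  proof -
    have "?d a b \<otimes>\<^bsub>?T\<^esub> ?d c d = (\<Oplus>\<^bsub>?T\<^esub>k\<in>{1..n}. ?p (u a k) (u k b) \<otimes>\<^bsub>?T\<^esub> ?d c d)"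
      using that u_closed pc by (intro T.finsum_ldistr) (auto intro!: T.finsum_closed)
    also have "\<dots> = (\<Oplus>\<^bsub>?T\<^esub>k\<in>{1..n}. \<Oplus>\<^bsub>?T\<^esub>l\<in>{1..n}. ?p (u a k) (u k b) \<otimes>\<^bsub>?T\<^esub> ?p (u c l) (u l d))"
    proof (rule T.finsum_cong'[OF refl])
      fix k assume k: "k \<in> {1..n}"
      show "?p (u a k) (u k b) \<otimes>\<^bsub>?T\<^esub> ?d c d = (\<Oplus>\<^bsub>?T\<^esub>l\<in>{1..n}. ?p (u a k) (u k b) \<otimes>\<^bsub>?T\<^esub> ?p (u c l) (u l d))"
        using that u_closed pc k by (intro T.finsum_rdistr) auto
    qed (use that u_closed pc in \<open>auto intro!: T.finsum_closed\<close>)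
    also have "\<dots> = (\<Oplus>\<^bsub>?T\<^esub>k\<in>{1..n}. \<Oplus>\<^bsub>?T\<^esub>l\<in>{1..n}. ?p (u a k \<otimes> u c l) (u k b \<otimes> u l d))"
    proof (rule T.finsum_cong'[OF refl])
      fix k assume k: "k \<in> {1..n}"
      show "(\<Oplus>\<^bsub>?T\<^esub>l\<in>{1..n}. ?p (u a k) (u k b) \<otimes>\<^bsub>?T\<^esub> ?p (u c l) (u l d)) =
          (\<Oplus>\<^bsub>?T\<^esub>l\<in>{1..n}. ?p (u a k \<otimes> u c l) (u k b \<otimes> u l d))"
        using that u_closed pc k pure_mult[OF alg alg] by (intro T.finsum_cong' refl) auto
    qed (use that u_closed pc in \<open>auto intro!: T.finsum_closed\<close>)
    finally show ?thesis .
  qed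
  have delta: "(\<Oplus>\<^bsub>?T\<^esub>k\<in>{1..n}. \<Oplus>\<^bsub>?T\<^esub>l\<in>{1..n}. if k = l then f k else \<zero>\<^bsub>?T\<^esub>) = (\<Oplus>\<^bsub>?T\<^esub>k\<in>{1..n}. f k)"
    if f: "f \<in> {1..n} \<rightarrow> carrier ?T" for f
  proof (rule T.finsum_cong'[OF refl f])
    fix k assume k: "k \<in> {1..n}"
    have "(\<Oplus>\<^bsub>?T\<^esub>l\<in>{1..n}. if k = l then f k else \<zero>\<^bsub>?T\<^esub>) = (\<Oplus>\<^bsub>?T\<^esub>l\<in>{1..n}. if l = k then f l else \<zero>\<^bsub>?T\<^esub>)"
      using f k by (intro T.finsum_cong' refl) auto
    also have "\<dots> = f k" using f k by (intro TV.finsum_delta) auto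
    finally show "(\<Oplus>\<^bsub>?T\<^esub>l\<in>{1..n}. if k = l then f k else \<zero>\<^bsub>?T\<^esub>) = f k" .
  qed
  have zero: "(\<Oplus>\<^bsub>?T\<^esub>k\<in>{1..n}. \<zero>\<^bsub>?T\<^esub>) = \<zero>\<^bsub>?T\<^esub>" by (rule T.finsum_zero)
  show ?thesis
  proof (unfold_locales)
    show "unital_algebra ?T" by (rule T)
    fix i assume i: "i \<in> {1..n}"
    show "?d i j \<in> carrier ?T" if "j \<in> {1..n}" for j
      using i that u_closed pc by (intro T.finsum_closed) auto
    have "(\<Oplus>\<^bsub>?T\<^esub>l\<in>{1..n}. ?d i l) = (\<Oplus>\<^bsub>?T\<^esub>k\<in>{1..n}. \<Oplus>\<^bsub>?T\<^esub>l\<in>{1..n}. ?p (u i k) (u k l))"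
      using i u_closed pc by (intro TV.finsum_swap) auto
    also have "\<dots> = (\<Oplus>\<^bsub>?T\<^esub>k\<in>{1..n}. ?p (u i k) \<one>)"
    proof (rule T.finsum_cong'[OF refl])
      fix k assume k: "k \<in> {1..n}"
      show "(\<Oplus>\<^bsub>?T\<^esub>l\<in>{1..n}. ?p (u i k) (u k l)) = ?p (u i k) \<one>"
        using i k u_closed by (subst row_sum[OF k, symmetric], subst pure_finsum_right[OF v v]) auto
    qed (use i u_closed pc in auto)
    also have "\<dots> = ?p \<one> \<one>"
      using i u_closed by (subst row_sum[OF i, symmetric], subst pure_finsum_left[OF v v]) auto
    finally show "(\<Oplus>\<^bsub>?T\<^esub>l\<in>{1..n}. ?d i l) = \<one>\<^bsub>?T\<^esub>" by (simp add: tensor_one[OF alg alg])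
    have "(\<Oplus>\<^bsub>?T\<^esub>l\<in>{1..n}. ?d l i) = (\<Oplus>\<^bsub>?T\<^esub>k\<in>{1..n}. \<Oplus>\<^bsub>?T\<^esub>l\<in>{1..n}. ?p (u l k) (u k i))"
      using i u_closed pc by (intro TV.finsum_swap) auto
    also have "\<dots> = (\<Oplus>\<^bsub>?T\<^esub>k\<in>{1..n}. ?p \<one> (u k i))"
    proof (rule T.finsum_cong'[OF refl])
      fix k assume k: "k \<in> {1..n}"
      show "(\<Oplus>\<^bsub>?T\<^esub>l\<in>{1..n}. ?p (u l k) (u k i)) = ?p \<one> (u k i)"
        using i k u_closed by (subst col_sum[OF k, symmetric], subst pure_finsum_left[OF v v]) auto
    qed (use i u_closed pc in auto)
    also have "\<dots> = ?p \<one> \<one>"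
      using i u_closed by (subst (2) col_sum[OF i, symmetric], subst pure_finsum_right[OF v v]) auto
    finally show "(\<Oplus>\<^bsub>?T\<^esub>l\<in>{1..n}. ?d l i) = \<one>\<^bsub>?T\<^esub>" by (simp add: tensor_one[OF alg alg])
    fix j k assume jk: "j \<in> {1..n}" "k \<in> {1..n}"
    have "?d k i \<otimes>\<^bsub>?T\<^esub> ?d k j = (\<Oplus>\<^bsub>?T\<^esub>a\<in>{1..n}. \<Oplus>\<^bsub>?T\<^esub>b\<in>{1..n}. if a = b then (if i = j then ?p (u k a) (u a i) else \<zero>\<^bsub>?T\<^esub>) else \<zero>\<^bsub>?T\<^esub>)"
      unfolding mult[OF jk(2) i jk(2) jk(1)]
    proof (intro T.finsum_cong' refl)
      fix a b assume ab: "a \<in> {1..n}" "b \<in> {1..n}"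
      then show "?p (u k a \<otimes> u k b) (u a i \<otimes> u b j) = (if a = b then (if i = j then ?p (u k a) (u a i) else \<zero>\<^bsub>?T\<^esub>) else \<zero>\<^bsub>?T\<^esub>)"
        using i jk row_mult u_closed by (auto simp: row_mult pure_zero_left[OF v v] pure_zero_right[OF v v])
    qed (use i jk u_closed pc in \<open>auto intro!: T.finsum_closed\<close>)
    also have "\<dots> = (\<Oplus>\<^bsub>?T\<^esub>a\<in>{1..n}. if i = j then ?p (u k a) (u a i) else \<zero>\<^bsub>?T\<^esub>)"
      by (rule delta) (use i jk u_closed pc in auto)
    finally show "?d k i \<otimes>\<^bsub>?T\<^esub> ?d k j = (if i = j then ?d k i else \<zero>\<^bsub>?T\<^esub>)" using zero by (simp split: if_splits)
    have "?d i k \<otimes>\<^bsub>?T\<^esub> ?d j k = (\<Oplus>\<^bsub>?T\<^esub>a\<in>{1..n}. \<Oplus>\<^bsub>?T\<^esub>b\<in>{1..n}. if a = b then (if i = j then ?p (u i a) (u a k) else \<zero>\<^bsub>?T\<^esub>) else \<zero>\<^bsub>?T\<^esub>)"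
      unfolding mult[OF i jk(2) jk(1) jk(2)]
    proof (intro T.finsum_cong' refl)
      fix a b assume ab: "a \<in> {1..n}" "b \<in> {1..n}"
      then show "?p (u i a \<otimes> u j b) (u a k \<otimes> u b k) = (if a = b then (if i = j then ?p (u i a) (u a k) else \<zero>\<^bsub>?T\<^esub>) else \<zero>\<^bsub>?T\<^esub>)"
        using i jk u_closed by (auto simp: col_mult pure_zero_left[OF v v] pure_zero_right[OF v v])
    qed (use i jk u_closed pc in \<open>auto intro!: T.finsum_closed\<close>)
    also have "\<dots> = (\<Oplus>\<^bsub>?T\<^esub>a\<in>{1..n}. if i = j then ?p (u i a) (u a k) else \<zero>\<^bsub>?T\<^esub>)"
      by (rule delta) (use i jk u_closed pc in auto)
    finally show "?d i k \<otimes>\<^bsub>?T\<^esub> ?d j k = (if i = j then ?d i k else \<zero>\<^bsub>?T\<^esub>)" using zero by (simp split: if_splits)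
  qed
qed

lemma As_fields:
  "module.truncate (As n) = As_algebra n"
  "carrier (As n) = carrier (As_algebra n)" "monoid.mult (As n) = monoid.mult (As_algebra n)"
  "one (As n) = one (As_algebra n)" "zero (As n) = zero (As_algebra n)"
  "add (As n) = add (As_algebra n)" "module.smult (As n) = module.smult (As_algebra n)"
  by (simp_all add: As_def Let_def module.defs)

lemma comult_As_gen:
  assumes "i \<in> {1..n}" "j \<in> {1..n}"
  shows "comult (As n :: ('k::field, _) hopf) (As_gen n i j) =
    (\<Oplus>\<^bsub>tensor (As_algebra n) (As_algebra n)\<^esub>k\<in>{1..n}. pure_tensor (As_algebra n) (As_algebra n) (As_gen n i k) (As_gen n k j))"
    (is "_ = ?d i j")
proof -
  interpret magic_matrix "As_algebra n :: ('k, _) module" n "As_gen n" by (rule magic_As)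
  interpret T: magic_matrix "tensor (As_algebra n) (As_algebra n) :: ('k, _) module" n ?d by (rule magic_comult)
  \<comment> \<open>The comultiplication of \<open>As\<close> is by definition the evaluation of
    words at this matrix, which is the reason for the shape of \<open>word_eval\<close>.\<close>
  have "comult (As n) (As_gen n i j) =
    induced (tensor (As_algebra n) (As_algebra n)) (word_eval (tensor (As_algebra n) (As_algebra n)) ?d) (As_gen n i j)"
    by (simp add: As_def Let_def module.defs hopf.defs word_eval_def[abs_def])
  also have "\<dots> = word_eval (tensor (As_algebra n) (As_algebra n)) ?d [(i, j)]"
    unfolding As_gen_def[of n i j] by (rule T.induced_As_word[OF _ As_ideal_ideal]) (use assms in simp)
  finally show ?thesis using assms T.u_closed[of i j] by simp
qed

text \<open>What is retained of the quotient map in (a) and (b) alike: a magic matrix with matrix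
  comultiplication whose words span H. Counit and antipode of its entries are recovered in
  \<open>counit_u\<close> and \<open>antipode_u\<close>.\<close>

locale magic_hopf = hopf_alg H + magic_matrix H n u
  for H :: "('k::field, 'a, 'm) hopf_scheme" (structure) and n u +
  assumes comult_u: "\<And>i j. i \<in> {1..n} \<Longrightarrow> j \<in> {1..n} \<Longrightarrow>
        \<Delta> (u i j) = (\<Oplus>\<^bsub>T\<^esub>k\<in>{1..n}. pure_tensor H H (u i k) (u k j))"
    and generated: "carrier H \<subseteq> lspan H (word_eval H u ` lists (As_letters n))"

lemma magic_hopf_quotient:
  fixes H :: "('k::field, 'a, 'm) hopf_scheme"
  assumes "hopf_algebra H" and \<pi>: "\<pi> \<in> hopf_homs (As n) H" "\<pi> ` carrier (As n) = carrier H"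
  shows "magic_hopf H n (\<lambda>i j. \<pi> (As_gen n i j))"
proof -
  let ?A = "As_algebra n :: ('k, _) module"
  interpret H: hopf_alg H by unfold_locales fact
  interpret A: magic_matrix ?A n "As_gen n" by (rule magic_As)
  have lin: "\<pi> \<in> linear_maps ?A H" using \<pi>(1)
    by (auto simp: hopf_homs_def algebra_homs_def linear_maps_def As_fields)
  have rh: "\<pi> \<in> ring_hom ?A H" using \<pi>(1)
    by (auto simp: hopf_homs_def algebra_homs_def ring_hom_def As_fields)
  note vA = unital_algebra_simps(2)[OF unital_algebra_As]
  have sum: "\<pi> (\<Oplus>\<^bsub>?A\<^esub>k\<in>{1..n}. f k) = (\<Oplus>\<^bsub>H\<^esub>k\<in>{1..n}. \<pi> (f k))" if "f \<in> {1..n} \<rightarrow> carrier ?A" for f :: "nat \<Rightarrow> _"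
    by (rule linear_maps_finsum[OF vA H.vsp lin that])
  have magic: "magic_matrix H n (\<lambda>i j. \<pi> (As_gen n i j))"
  proof (unfold_locales)
    show "unital_algebra H" by (rule H.unital)
    fix i assume i: "i \<in> {1..n}"
    show "\<pi> (As_gen n i j) \<in> carrier H" if "j \<in> {1..n}" for j
      using linear_mapsD(1)[OF lin A.u_closed[OF i that]] .
    show "(\<Oplus>\<^bsub>H\<^esub>l\<in>{1..n}. \<pi> (As_gen n i l)) = \<one>\<^bsub>H\<^esub>" "(\<Oplus>\<^bsub>H\<^esub>l\<in>{1..n}. \<pi> (As_gen n l i)) = \<one>\<^bsub>H\<^esub>"
      using i ring_hom_one[OF rh] sum[of "\<lambda>l. As_gen n i l"] sum[of "\<lambda>l. As_gen n l i"] A.u_closed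
      by (simp_all add: A.row_sum A.col_sum Pi_iff del: One_nat_def)
    fix j k assume jk: "j \<in> {1..n}" "k \<in> {1..n}"
    show "\<pi> (As_gen n k i) \<otimes>\<^bsub>H\<^esub> \<pi> (As_gen n k j) = (if i = j then \<pi> (As_gen n k i) else \<zero>\<^bsub>H\<^esub>)"
      using A.row_mult[OF i jk] ring_hom_mult[OF rh A.u_closed[OF jk(2) i] A.u_closed[OF jk(2,1)]] linear_maps_zero[OF vA H.vsp lin]
      by auto
    show "\<pi> (As_gen n i k) \<otimes>\<^bsub>H\<^esub> \<pi> (As_gen n j k) = (if i = j then \<pi> (As_gen n i k) else \<zero>\<^bsub>H\<^esub>)"
      using A.col_mult[OF i jk] ring_hom_mult[OF rh A.u_closed[OF i jk(2)] A.u_closed[OF jk]] linear_maps_zero[OF vA H.vsp lin]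
      by auto
  qed
  interpret M: magic_matrix H n "\<lambda>i j. \<pi> (As_gen n i j)" by (rule magic)
  show ?thesis
  proof (unfold_locales)
    fix i j assume ij: "i \<in> {1..n}" "j \<in> {1..n}"
    note tm = tensor_map_linear[OF H.vsp H.vsp vA vA lin lin]
    have "comult H (\<pi> (As_gen n i j)) = tensor_map H H \<pi> \<pi> (comult (As n) (As_gen n i j))"
      using \<pi>(1) A.u_closed[OF ij] by (auto simp: hopf_homs_def As_fields)
    also have "\<dots> = (\<Oplus>\<^bsub>tensor H H\<^esub>k\<in>{1..n}. tensor_map H H \<pi> \<pi> (pure_tensor ?A ?A (As_gen n i k) (As_gen n k j)))"
      unfolding comult_As_gen[OF ij]
      by (rule linear_maps_finsum[OF vspace_tensor[OF vA vA] H.vsp_T tm(1)])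
        (use ij in \<open>intro Pi_I pure_tensor_closed[OF vA vA] A.u_closed\<close>)
    also have "\<dots> = (\<Oplus>\<^bsub>tensor H H\<^esub>k\<in>{1..n}. pure_tensor H H (\<pi> (As_gen n i k)) (\<pi> (As_gen n k j)))"
      using ij A.u_closed M.u_closed pure_tensor_closed[OF H.vsp H.vsp] by (intro H.T.finsum_cong' refl) (auto simp: tm(2))
    finally show "comult H (\<pi> (As_gen n i j)) = (\<Oplus>\<^bsub>tensor H H\<^esub>k\<in>{1..n}. pure_tensor H H (\<pi> (As_gen n i k)) (\<pi> (As_gen n k j)))" .
  next
    let ?S = "word_eval H (\<lambda>i j. \<pi> (As_gen n i j)) ` lists (As_letters n)"
    \<comment> \<open>The quotient map sends words to words in the images. As words span the free
      algebra, its surjectivity yields the spanning condition.\<close>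
    have word: "\<pi> (As_word n w) = word_eval H (\<lambda>i j. \<pi> (As_gen n i j)) w" if "w \<in> lists (As_letters n)" for w
      using that
    proof (induction w)
      case Nil then show ?case using ring_hom_one[OF rh] by (simp add: As_word_Nil)
    next
      case (Cons a w)
      obtain i j where a: "a = (i, j)" by (cases a)
      have mem: "i \<in> {1..n}" "j \<in> {1..n}" "w \<in> lists (As_letters n)" using Cons.hyps a by auto
      then have "[(i, j)] \<in> lists (As_letters n)" by simp
      from As_word_append[OF this mem(3)]
      have "As_word n (a # w) = As_gen n i j \<otimes>\<^bsub>?A\<^esub> As_word n w" by (simp add: As_gen_def a)
      then show ?case
        using Cons.IH a ring_hom_mult[OF rh A.u_closed[OF mem(1,2)] As_word_closed[OF mem(3)]] by simp
    qed
    have S: "?S \<subseteq> carrier H" by (auto intro!: M.word_eval_closed simp del: in_lists_conv_set)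
    show "carrier H \<subseteq> lspan H ?S"
    proof
      fix x assume "x \<in> carrier H"
      then obtain y where y: "y \<in> carrier ?A" "x = \<pi> y" using \<pi>(2) by (auto simp: As_fields)
      then obtain t where t: "keys t \<subseteq> lists (As_letters n)" "y = As_ideal n +>\<^bsub>free_algebra (As_letters n)\<^esub> t"
        unfolding As_algebra_def by (elim As_quot.quot_cases) (auto simp: free_algebra_def)
      note comp = linear_maps_comp[OF As_quot.coset_linear[of n, folded As_algebra_def] lin]
      have "x = lin_ext H (\<lambda>w. \<pi> (As_word n w)) t"
        unfolding y t(2) As_word_def
        using linear_maps_eq_lin_ext[OF H.vsp comp[unfolded free_algebra_def], folded free_algebra_def, of t] t(1) by simp
      also have "\<dots> \<in> lspan H ?S"
      proof (intro H.V.lin_ext_in_lspan[OF _ S] image_subsetI)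
        fix w assume "w \<in> keys t"
        then have w: "w \<in> lists (As_letters n)" using t(1) by blast
        show "\<pi> (As_word n w) \<in> ?S" unfolding word[OF w] using w by (rule imageI)
      qed
      finally show "x \<in> lspan H ?S" .
    qed
  qed
qed

section \<open>Group-like elements in the rows of a magic matrix\<close>

context magic_hopf begin

lemma act_u:
  assumes "i \<in> {1..n}" "j \<in> {1..n}" "f \<in> dual H"
  shows "act f (u i j) = (\<Oplus>k\<in>{1..n}. f (u k j) \<odot> u i k)"
proof -
  have "act f (u i j) = (\<Oplus>k\<in>{1..n}. contract_right H f (pure_tensor H H (u i k) (u k j)))"
    unfolding act_def comult_u[OF assms(1,2)]
    by (rule linear_maps_finsum[OF vsp_T vsp contract_right_linear[OF vsp vsp assms(3)]])
      (use assms u_closed pure_tensor_closed[OF vsp vsp] in auto)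
  also have "\<dots> = (\<Oplus>k\<in>{1..n}. f (u k j) \<odot> u i k)"
    using assms u_closed by (intro finsum_cong' refl) (auto simp: contract_right_pure[OF vsp vsp assms(3)])
  finally show ?thesis .
qed

lemma conv_u:
  assumes "i \<in> {1..n}" "j \<in> {1..n}" "f \<in> dual H" "g \<in> dual H"
  shows "conv f g (u i j) = (\<Sum>k\<in>{1..n}. f (u i k) * g (u k j))"
  using assms u_closed
  by (simp add: conv_act act_u dual_finsum[OF vsp assms(3)] Pi_iff dual_simps(2)[OF assms(3)] mult.commute)

text \<open>The algebra homomorphism from K^n, with pointwise product, onto the span of the i-th
  row. The coefficients c need not be unique, since some u_ij may vanish.\<close>

definition row :: "nat \<Rightarrow> (nat \<Rightarrow> 'k) \<Rightarrow> 'a" where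
  "row i c = (\<Oplus>j\<in>{1..n}. c j \<odot> u i j)"

lemma row_closed [simp]: "i \<in> {1..n} \<Longrightarrow> row i c \<in> carrier H"
  unfolding row_def by (rule finsum_closed) (auto simp: u_closed)

lemma row_add: "i \<in> {1..n} \<Longrightarrow> row i c \<oplus> row i d = row i (\<lambda>j. c j + d j)"
  unfolding row_def by (subst finsum_addf[symmetric]; (intro finsum_cong' refl)?)
    (auto simp: u_closed V.scale_left_distrib)

lemma row_scale: "i \<in> {1..n} \<Longrightarrow> a \<odot> row i c = row i (\<lambda>j. a * c j)"
  unfolding row_def by (subst V.scale_finsum; (intro finsum_cong' refl)?)
    (auto simp: u_closed V.scale_assoc)

lemma row_one: "i \<in> {1..n} \<Longrightarrow> row i (\<lambda>_. 1) = \<one>"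
  unfolding row_def by (subst row_sum[symmetric]; (intro finsum_cong' refl)?) (auto simp: u_closed)

lemma row_zero: "i \<in> {1..n} \<Longrightarrow> row i (\<lambda>_. 0) = \<zero>"
  unfolding row_def by (rule add.finprod_one_eqI) (auto simp: u_closed)

lemma row_single: assumes "i \<in> {1..n}" "k \<in> {1..n}" shows "row i (\<lambda>j. if j = k then 1 else 0) = u i k"
proof -
  have "row i (\<lambda>j. if j = k then 1 else 0) = (\<Oplus>j\<in>{1..n}. if j = k then u i j else \<zero>)"
    unfolding row_def using assms by (intro finsum_cong' refl) (auto simp: u_closed)
  also have "\<dots> = u i k" using assms by (intro V.finsum_delta) (auto simp: u_closed)
  finally show ?thesis .
qed

lemma row_mult_u: assumes i: "i \<in> {1..n}" "k \<in> {1..n}" shows "row i c \<otimes> u i k = c k \<odot> u i k"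
proof -
  have "row i c \<otimes> u i k = (\<Oplus>j\<in>{1..n}. (c j \<odot> u i j) \<otimes> u i k)"
    unfolding row_def using assms u_closed by (intro finsum_ldistr) auto
  also have "\<dots> = (\<Oplus>j\<in>{1..n}. if j = k then c j \<odot> u i j else \<zero>)"
    using assms u_closed by (intro finsum_cong' refl) (auto simp: unital_algebra_simps(3)[OF alg] row_mult)
  also have "\<dots> = c k \<odot> u i k" using assms by (intro V.finsum_delta) (auto simp: u_closed)
  finally show ?thesis .
qed

lemma row_times: assumes i: "i \<in> {1..n}" shows "row i c \<otimes> row i d = row i (\<lambda>j. c j * d j)"
proof -
  have "row i c \<otimes> row i d = (\<Oplus>k\<in>{1..n}. row i c \<otimes> (d k \<odot> u i k))"
    unfolding row_def[of i d] using i u_closed by (intro finsum_rdistr) auto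
  also have "\<dots> = row i (\<lambda>j. c j * d j)"
    unfolding row_def[of i "\<lambda>j. c j * d j"] using i u_closed
    by (intro finsum_cong' refl)
      (auto simp: unital_algebra_simps(4)[OF alg] row_mult_u V.scale_assoc mult.commute)
  finally show ?thesis .
qed

lemma row_finsum:
  "finite A \<Longrightarrow> i \<in> {1..n} \<Longrightarrow> (\<Oplus>k\<in>A. row i (c k)) = row i (\<lambda>j. \<Sum>k\<in>A. c k j)"
proof (induction A rule: finite_induct)
  case (insert a A)
  then show ?case by (simp add: row_add del: atLeastAtMost_iff)
qed (simp add: row_zero)

text \<open>The functional f acts on the coefficients by the matrix (f(u_kj)), the same for every
  row i. So each row is invariant, and in the *-case it is these matrices that are
  diagonalised.\<close>

lemma act_row:
  assumes i: "i \<in> {1..n}" and f: "f \<in> dual H"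
  shows "act f (row i c) = row i (\<lambda>k. \<Sum>j\<in>{1..n}. f (u k j) * c j)"
proof -
  have "act f (row i c) = (\<Oplus>j\<in>{1..n}. act f (c j \<odot> u i j))"
    unfolding row_def using i u_closed by (intro linear_maps_finsum[OF vsp vsp act_linear[OF f]]) auto
  also have "\<dots> = (\<Oplus>j\<in>{1..n}. row i (\<lambda>k. f (u k j) * c j))"
  proof (intro finsum_cong' refl)
    fix j assume j: "j \<in> {1..n}"
    have "act f (c j \<odot> u i j) = c j \<odot> row i (\<lambda>k. f (u k j))"
      using linear_mapsD(3)[OF act_linear[OF f] u_closed[OF i j]] act_u[OF i j f] by (simp add: row_def)
    then show "act f (c j \<odot> u i j) = row i (\<lambda>k. f (u k j) * c j)"
      using i by (simp add: row_scale mult.commute del: atLeastAtMost_iff)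
  qed (use i in auto)
  finally show ?thesis using i by (simp add: row_finsum del: atLeastAtMost_iff)
qed

lemma rows_subspace: assumes "i \<in> {1..n}" shows "submodule (range (row i)) ring_of_type_algebra H"
proof (rule V.subspaceI)
  show "range (row i) \<subseteq> carrier H" using assms by auto
  show "\<zero> \<in> range (row i)" using row_zero[OF assms] by (metis rangeI)
qed (use assms in \<open>auto simp: row_add row_scale\<close>)

definition row_grouplike :: "nat \<Rightarrow> 'a set" where
  "row_grouplike i = grouplike \<inter> range (row i)"

lemma one_row_grouplike: "i \<in> {1..n} \<Longrightarrow> \<one> \<in> row_grouplike i"
  using one_grouplike row_one[of i] unfolding row_grouplike_def by (metis IntI rangeI)

lemma mult_row_grouplike:
  "i \<in> {1..n} \<Longrightarrow> g \<in> row_grouplike i \<Longrightarrow> h \<in> row_grouplike i \<Longrightarrow> g \<otimes> h \<in> row_grouplike i"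
  unfolding row_grouplike_def by (auto simp: mult_grouplike row_times)

lemma row_grouplike_commute:
  "i \<in> {1..n} \<Longrightarrow> g \<in> row_grouplike i \<Longrightarrow> h \<in> row_grouplike i \<Longrightarrow> g \<otimes> h = h \<otimes> g"
  unfolding row_grouplike_def by (auto simp: row_times mult.commute)

text \<open>The row is an image of K^n, so n + 1 of its members satisfy a linear relation, whereas
  group-like elements are independent.\<close>

lemma card_row_grouplike_le:
  assumes i: "i \<in> {1..n}" and F: "F \<subseteq> row_grouplike i" "finite F"
  shows "card F \<le> n"
proof (rule ccontr)
  assume "\<not> card F \<le> n"
  then obtain F' where F': "F' \<subseteq> F" "card F' = Suc n"
    by (metis not_less_eq_eq obtain_subset_with_card_n)
  then have "finite F'" using F finite_subset by blast
  then obtain h where h: "bij_betw h {0..<Suc n} F'" using ex_bij_betw_nat_finite F'(2) by metis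
  have h': "h k \<in> row_grouplike i" if "k \<le> n" for k
  proof -
    have "h k \<in> F'" using bij_betwE[OF h] that by simp
    then show ?thesis using F' F by blast
  qed
  then have "\<forall>k. \<exists>c. k \<le> n \<longrightarrow> h k = row i c" by (auto simp: row_grouplike_def)
  then obtain c where c: "\<And>k. k \<le> n \<Longrightarrow> h k = row i (c k)" by metis
  \<comment> \<open>The u_ij of one row need not be independent, so the relation is found among
    coefficient vectors in the free space on {1..n} and only then mapped to the row.\<close>
  let ?E = "(\<lambda>j. single j (1::'k)) ` {1..n}"
  let ?v = "\<lambda>k. \<Sum>j\<in>{1..n}. Poly_Mapping.map ((*) (c k j)) (single j 1)"
  have "?v k \<in> poly_mapping.span ?E" for k
    by (intro poly_mapping.span_sum poly_mapping.span_scale poly_mapping.span_base) auto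
  moreover have "card ?E \<le> n" using card_image_le[of "{1..n}" "\<lambda>j. single j (1::'k)"] by simp
  ultimately obtain a where a: "\<exists>k\<le>n. a k \<noteq> 0" "(\<Sum>k\<le>n. Poly_Mapping.map ((*) (a k)) (?v k)) = 0"
    using poly_mapping.exists_linear_relation[of ?E n ?v] by auto
  have a0: "(\<Sum>k\<le>n. a k * c k j) = 0" if j: "j \<in> {1..n}" for j
  proof -
    have lv: "lookup (?v k) j = c k j" for k
    proof -
      have "lookup (?v k) j = (\<Sum>l\<in>{1..n}. if l = j then c k l else 0)"
        unfolding lookup_sum by (intro sum.cong) (auto simp: lookup_single when_def)
      then show ?thesis using j by simp
    qed
    have "lookup (\<Sum>k\<le>n. Poly_Mapping.map ((*) (a k)) (?v k)) j = (\<Sum>k\<le>n. a k * c k j)"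
      unfolding lookup_sum[of _ "{..n}"] lookup_map_times lv ..
    then show ?thesis unfolding a(2) by simp
  qed
  let ?s = "\<Sum>k\<le>n. single (h k) (a k)"
  have id: "(\<lambda>x. x) \<in> grouplike \<rightarrow> carrier H" using grouplike_carrier by auto
  have hg: "h k \<in> grouplike" if "k \<le> n" for k using h'[OF that] by (simp add: row_grouplike_def)
  have sumA: "keys (\<Sum>k\<in>A. single (h k) (a k)) \<subseteq> grouplike \<and>
     lin_ext H (\<lambda>x. x) (\<Sum>k\<in>A. single (h k) (a k)) = (\<Oplus>k\<in>A. a k \<odot> h k)"
    if "finite A" "A \<subseteq> {..n}" for A
    using that
  proof (induction A rule: finite_induct)
    case (insert b A)
    have "h k \<in> carrier H" if "k \<in> insert b A" for k using insert.prems that grouplike_carrier[OF hg] by auto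
    moreover have "h b \<in> grouplike" using hg insert.prems by auto
    ultimately show ?case
      using insert by (simp add: V.lin_ext_add[OF _ _ id] keys_add_subset Pi_iff)
  qed simp
  have "(\<Oplus>k\<in>{..n}. a k \<odot> h k) = (\<Oplus>k\<in>{..n}. row i (\<lambda>j. a k * c k j))"
    using i c by (intro finsum_cong' refl) (auto simp: row_scale)
  also have "\<dots> = row i (\<lambda>j. \<Sum>k\<le>n. a k * c k j)" using i by (simp add: row_finsum del: atLeastAtMost_iff)
  also have "\<dots> = row i (\<lambda>_. 0)"
    unfolding row_def using i u_closed by (intro finsum_cong' refl) (auto simp: a0)
  finally have "(\<Oplus>k\<in>{..n}. a k \<odot> h k) = \<zero>" using row_zero[OF i] by simp
  then have s0: "?s = 0" using sumA[of "{..n}"] by (intro grouplike_independent) auto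
  have "lookup ?s (h k) = a k" if k: "k \<le> n" for k
  proof -
    have "lookup ?s (h k) = (\<Sum>l\<le>n. if l = k then a l else 0)"
      unfolding lookup_sum
      by (intro sum.cong) (use h k in \<open>auto simp: lookup_single when_def bij_betw_def inj_on_def\<close>)
    then show ?thesis using k by simp
  qed
  then have "a k = 0" if "k \<le> n" for k using that s0 by simp
  then show False using a(1) by blast
qed

lemma finite_row_grouplike: "i \<in> {1..n} \<Longrightarrow> finite (row_grouplike i)"
  using finite_if_finite_subsets_card_bdd[of "row_grouplike i" n] card_row_grouplike_le[of i] by blast

lemma antipode_grouplike:
  assumes "g \<in> grouplike"
  shows "antipode H g \<in> carrier H" "antipode H g \<otimes> g = \<one>" "g \<otimes> antipode H g = \<one>"
proof -
  have S: "antipode H \<in> linear_maps H H" using hopf by (simp add: hopf_algebra_def)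
  note g = grouplike_carrier[OF assms]
  show Sg: "antipode H g \<in> carrier H" by (rule linear_mapsD(1)[OF S g])
  have 1: "bilinear_map H H H (\<lambda>(y, z). antipode H y \<otimes> z)"
    using linear_maps_comp[OF S mult_linear_right[OF unital]] mult_linear_left[OF unital] linear_mapsD(1)[OF S]
    by (intro bilinear_mapI) auto
  have 2: "bilinear_map H H H (\<lambda>(y, z). y \<otimes> antipode H z)"
    using linear_maps_comp[OF S mult_linear_left[OF unital]] mult_linear_right[OF unital] linear_mapsD(1)[OF S]
    by (intro bilinear_mapI) auto
  have e: "induced H (\<lambda>(y, z). antipode H y \<otimes> z) (\<Delta> g) = \<epsilon> g \<odot> \<one>"
    "induced H (\<lambda>(y, z). y \<otimes> antipode H z) (\<Delta> g) = \<epsilon> g \<odot> \<one>"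
    using hopf g unfolding hopf_algebra_def by auto
  have d: "\<Delta> g = pure_tensor H H g g" using assms by (simp add: grouplike_def)
  show "antipode H g \<otimes> g = \<one>" "g \<otimes> antipode H g = \<one>"
    using e unfolding d induced_pure[OF vsp vsp vsp 1 g g] induced_pure[OF vsp vsp vsp 2 g g] counit_grouplike[OF assms]
    by simp_all
qed

text \<open>Left multiplication by g is injective, the antipode supplying a left inverse, and maps
  the finite set \<open>row_grouplike i\<close> to itself; hence it is onto and reaches 1. In this
  way the inverse is found inside the row without computing the antipode there.\<close>

lemma row_grouplike_inverse:
  assumes i: "i \<in> {1..n}" and g: "g \<in> row_grouplike i"
  shows "\<exists>h\<in>row_grouplike i. g \<otimes> h = \<one> \<and> h \<otimes> g = \<one>"
proof -
  have gg: "g \<in> grouplike" using g by (simp add: row_grouplike_def)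
  have "inj_on (\<lambda>x. g \<otimes> x) (row_grouplike i)"
  proof (rule inj_onI)
    fix x y assume xy: "x \<in> row_grouplike i" "y \<in> row_grouplike i" "g \<otimes> x = g \<otimes> y"
    then have c: "x \<in> carrier H" "y \<in> carrier H" using grouplike_carrier by (auto simp: row_grouplike_def)
    have "antipode H g \<otimes> (g \<otimes> x) = antipode H g \<otimes> (g \<otimes> y)" using xy(3) by simp
    then show "x = y"
      using antipode_grouplike[OF gg] c grouplike_carrier[OF gg] by (simp flip: m_assoc)
  qed
  moreover have "(\<lambda>x. g \<otimes> x) ` row_grouplike i \<subseteq> row_grouplike i"
    using mult_row_grouplike[OF i g] by auto
  ultimately have "(\<lambda>x. g \<otimes> x) ` row_grouplike i = row_grouplike i"
    using endo_inj_surj[OF finite_row_grouplike[OF i]] by blast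
  then obtain h where "h \<in> row_grouplike i" "g \<otimes> h = \<one>" using one_row_grouplike[OF i] by (metis imageE)
  then show ?thesis using row_grouplike_commute[OF i g] by metis
qed

end

text \<open>The meeting point of (a) and (b): the spanning condition comes from cosemisimplicity in
  the former and from the simultaneous diagonalisation in the latter.\<close>

locale magic_grouplike = magic_hopf H n u for H :: "('k::field, 'a, 'm) hopf_scheme" (structure) and n u +
  assumes u_spanned: "\<And>i j. i \<in> {1..n} \<Longrightarrow> j \<in> {1..n} \<Longrightarrow> u i j \<in> lspan H grouplike"
begin

lemma grouplike_subset: "grouplike \<subseteq> carrier H"
  using grouplike_carrier by auto

lemma rows_eq_lspan: assumes i: "i \<in> {1..n}" shows "range (row i) = lspan H (row_grouplike i)"
  unfolding row_grouplike_def
proof (rule invariant_subspace_grouplike[OF rows_subspace[OF i]])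
  show "act f x \<in> range (row i)" if "f \<in> dual H" "x \<in> range (row i)" for f x
    using that i by (auto simp: act_row)
  note L = V.lspan_subspace[OF grouplike_subset]
  show "range (row i) \<subseteq> lspan H grouplike"
    using i u_spanned V.subspaceD(4)[OF L] unfolding row_def by (auto intro!: V.subspace_finsum[OF L])
qed

text \<open>The submonoid generated by the groups of all rows. That it contains inverses and
  exhausts the group-like elements is shown below.\<close>

definition grouplike_words :: "'a set" where
  "grouplike_words = {foldr (\<otimes>) ws \<one> | ws. set ws \<subseteq> (\<Union>i\<in>{1..n}. row_grouplike i)}"

lemma foldr_grouplike: "set ws \<subseteq> grouplike \<Longrightarrow> foldr (\<otimes>) ws \<one> \<in> grouplike"
  by (induction ws) (auto simp: one_grouplike mult_grouplike)

lemma grouplike_words_subset: "grouplike_words \<subseteq> grouplike"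
proof
  fix g assume "g \<in> grouplike_words"
  then obtain ws where "set ws \<subseteq> (\<Union>i\<in>{1..n}. row_grouplike i)" "g = foldr (\<otimes>) ws \<one>" by (auto simp: grouplike_words_def)
  then show "g \<in> grouplike" using foldr_grouplike[of ws] by (auto simp: row_grouplike_def)
qed

lemma foldr_mult_append:
  "set vs \<subseteq> carrier H \<Longrightarrow> set ws \<subseteq> carrier H \<Longrightarrow>
    foldr (\<otimes>) (vs @ ws) \<one> = foldr (\<otimes>) vs \<one> \<otimes> foldr (\<otimes>) ws \<one> \<and> foldr (\<otimes>) vs \<one> \<in> carrier H \<and> foldr (\<otimes>) ws \<one> \<in> carrier H"
proof (induction vs)
  case Nil
  have "foldr (\<otimes>) ws \<one> \<in> carrier H" using Nil(2) by (induction ws) auto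
  then show ?case by simp
qed (auto simp: m_assoc)

lemma grouplike_words_mult: assumes "g \<in> grouplike_words" "h \<in> grouplike_words" shows "g \<otimes> h \<in> grouplike_words"
proof -
  obtain vs ws where w: "set vs \<subseteq> (\<Union>i\<in>{1..n}. row_grouplike i)" "g = foldr (\<otimes>) vs \<one>"
    "set ws \<subseteq> (\<Union>i\<in>{1..n}. row_grouplike i)" "h = foldr (\<otimes>) ws \<one>"
    using assms unfolding grouplike_words_def by blast
  have "(\<Union>i\<in>{1..n}. row_grouplike i) \<subseteq> carrier H" using grouplike_carrier by (auto simp: row_grouplike_def)
  then have "g \<otimes> h = foldr (\<otimes>) (vs @ ws) \<one>"
    using w foldr_mult_append[of vs ws] by (metis order_trans)
  moreover have "set (vs @ ws) \<subseteq> (\<Union>i\<in>{1..n}. row_grouplike i)" using w by auto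
  ultimately show ?thesis unfolding grouplike_words_def by blast
qed

text \<open>The span of these words is closed under multiplication and contains every u_ij by
  \<open>rows_eq_lspan\<close>, so it contains all words in the u_ij.\<close>

lemma carrier_eq_lspan_words: "carrier H = lspan H grouplike_words"
proof
  have sub: "grouplike_words \<subseteq> carrier H" using grouplike_words_subset grouplike_subset by blast
  note L = V.lspan_subspace[OF sub]
  note L' = V.subspaceD[OF L]
  show "lspan H grouplike_words \<subseteq> carrier H" by (rule L')
  have mult1: "g \<otimes> y \<in> lspan H grouplike_words" if g: "g \<in> grouplike_words" and y: "y \<in> lspan H grouplike_words" for g y
  proof -
    obtain t where t: "keys t \<subseteq> grouplike_words" "y = lin_ext H (\<lambda>x. x) t" using y by (auto simp: lspan_def)
    have gc: "g \<in> carrier H" using g sub by auto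
    have "g \<otimes> y = lin_ext H (\<lambda>x. g \<otimes> x) t"
      unfolding t(2) by (rule linear_maps_lin_ext[OF vsp vsp mult_linear_left[OF unital gc]]) (use t(1) sub in auto)
    also have "\<dots> \<in> lspan H grouplike_words"
      by (rule V.lin_ext_in_lspan[OF _ sub]) (use t(1) grouplike_words_mult[OF g] in auto)
    finally show ?thesis .
  qed
  have mult: "x \<otimes> y \<in> lspan H grouplike_words" if x: "x \<in> lspan H grouplike_words" and y: "y \<in> lspan H grouplike_words" for x y
  proof -
    obtain t where t: "keys t \<subseteq> grouplike_words" "x = lin_ext H (\<lambda>x. x) t" using x by (auto simp: lspan_def)
    have yc: "y \<in> carrier H" using y L'(1) by auto
    have "x \<otimes> y = lin_ext H (\<lambda>x. x \<otimes> y) t"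
      unfolding t(2) by (rule linear_maps_lin_ext[OF vsp vsp mult_linear_right[OF unital yc]]) (use t(1) sub in auto)
    also have "\<dots> \<in> lspan H grouplike_words"
      by (rule V.lin_ext_in_subspace[OF L]) (use t(1) mult1[OF _ y] in auto)
    finally show ?thesis .
  qed
  have rg: "row_grouplike i \<subseteq> grouplike_words" if "i \<in> {1..n}" for i
  proof
    fix g assume "g \<in> row_grouplike i"
    then have "set [g] \<subseteq> (\<Union>i\<in>{1..n}. row_grouplike i)" "g = foldr (\<otimes>) [g] \<one>"
      using that grouplike_carrier by (auto simp: row_grouplike_def)
    then show "g \<in> grouplike_words" unfolding grouplike_words_def by blast
  qed
  have ul: "u i j \<in> lspan H grouplike_words" if "i \<in> {1..n}" "j \<in> {1..n}" for i j
  proof -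
    have "u i j \<in> range (row i)" using row_single[OF that] by (metis rangeI)
    also have "\<dots> = lspan H (row_grouplike i)" by (rule rows_eq_lspan[OF that(1)])
    also have "\<dots> \<subseteq> lspan H grouplike_words" using rg[OF that(1)] by (auto simp: lspan_def)
    finally show ?thesis .
  qed
  have one: "\<one> \<in> lspan H grouplike_words"
  proof (rule V.lspan_base[OF sub])
    have "set [] \<subseteq> (\<Union>i\<in>{1..n}. row_grouplike i)" "\<one> = foldr (\<otimes>) [] \<one>" by auto
    then show "\<one> \<in> grouplike_words" unfolding grouplike_words_def by blast
  qed
  have "word_eval H u w \<in> lspan H grouplike_words" if "\<forall>x\<in>set w. x \<in> As_letters n" for w
    using that by (induction w) (auto simp: one mult ul)
  then have "word_eval H u ` lists (As_letters n) \<subseteq> lspan H grouplike_words" by auto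
  from V.lspan_least[OF L this] show "carrier H \<subseteq> lspan H grouplike_words" using generated by blast
qed

text \<open>A group-like element is a combination of words, which are group-like themselves; by
  independence the combination consists of that element alone. So the row groups generate all of G
  and do not merely span H.\<close>

lemma grouplike_eq_words: "grouplike = grouplike_words"
proof
  show "grouplike \<subseteq> grouplike_words"
  proof
    fix g assume g: "g \<in> grouplike"
    then have "g \<in> lspan H grouplike_words" using carrier_eq_lspan_words grouplike_carrier by auto
    then obtain t where t: "keys t \<subseteq> grouplike_words" "g = lin_ext H (\<lambda>x. x) t" by (auto simp: lspan_def)
    have "lin_ext H (\<lambda>x. x) (single g 1) = g" using grouplike_carrier[OF g] by simp
    then have "t = single g 1"
      using t g grouplike_words_subset by (intro grouplike_lin_ext_inj) auto
    then show "g \<in> grouplike_words" using t(1) by simp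
  qed
qed (rule grouplike_words_subset)

lemma carrier_eq_lspan: "carrier H = lspan H grouplike"
  using carrier_eq_lspan_words grouplike_eq_words by simp

section \<open>The group of group-like elements and the isomorphism with its group algebra\<close>

definition group_of :: "'a monoid" where
  "group_of = \<lparr>carrier = grouplike, monoid.mult = monoid.mult H, one = one H\<rparr>"

lemma group_of_simps [simp]:
  "carrier group_of = grouplike" "x \<otimes>\<^bsub>group_of\<^esub> y = x \<otimes> y" "\<one>\<^bsub>group_of\<^esub> = \<one>"
  by (simp_all add: group_of_def)

text \<open>Inverses are assembled letter by letter from those in the row groups, which keeps them
  group-like; \<open>group_of_inv\<close> then identifies them with the antipode.\<close>

lemma group_group_of: "group group_of"
proof (rule groupI)
  fix x assume "x \<in> carrier group_of"
  then have "x \<in> grouplike_words" using grouplike_eq_words by simp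
  then obtain ws where ws: "set ws \<subseteq> (\<Union>i\<in>{1..n}. row_grouplike i)" "x = foldr (\<otimes>) ws \<one>" by (auto simp: grouplike_words_def)
  have "\<exists>y\<in>grouplike. y \<otimes> foldr (\<otimes>) ws \<one> = \<one>" using ws(1)
  proof (induction ws)
    case Nil then show ?case using one_grouplike by (intro bexI[of _ \<one>]) auto
  next
    case (Cons a ws)
    then obtain y where y: "y \<in> grouplike" "y \<otimes> foldr (\<otimes>) ws \<one> = \<one>" by auto
    from Cons.prems obtain i where i: "i \<in> {1..n}" "a \<in> row_grouplike i" by auto
    from row_grouplike_inverse[OF this] obtain h where h: "h \<in> row_grouplike i" "h \<otimes> a = \<one>" by blast
    have "set ws \<subseteq> grouplike" using Cons.prems by (auto simp: row_grouplike_def)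
    then have c: "foldr (\<otimes>) ws \<one> \<in> carrier H" using foldr_grouplike grouplike_carrier by blast
    have c': "a \<in> carrier H" "h \<in> carrier H" "y \<in> carrier H" "h \<in> grouplike"
      using i h y grouplike_carrier by (auto simp: row_grouplike_def)
    have "(y \<otimes> h) \<otimes> (a \<otimes> foldr (\<otimes>) ws \<one>) = y \<otimes> ((h \<otimes> a) \<otimes> foldr (\<otimes>) ws \<one>)"
      using c c' by (simp add: m_assoc)
    also have "\<dots> = \<one>" using c y h by simp
    finally show ?case using y c' by (intro bexI[of _ "y \<otimes> h"]) (auto simp: mult_grouplike)
  qed
  then show "\<exists>y\<in>carrier group_of. y \<otimes>\<^bsub>group_of\<^esub> x = \<one>\<^bsub>group_of\<^esub>" using ws by simp
qed (auto simp: one_grouplike mult_grouplike m_assoc grouplike_carrier)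

lemma group_of_inv: "g \<in> grouplike \<Longrightarrow> inv\<^bsub>group_of\<^esub> g = antipode H g"
proof -
  assume g: "g \<in> grouplike"
  interpret G: group group_of by (rule group_group_of)
  have "inv\<^bsub>group_of\<^esub> g \<in> grouplike" "inv\<^bsub>group_of\<^esub> g \<otimes> g = \<one>" using G.l_inv[of g] G.inv_closed[of g] g by auto
  then show ?thesis
    using antipode_grouplike[OF g] grouplike_carrier g
    by (metis l_one m_assoc r_one)
qed

text \<open>The inverse of evaluating formal combinations of group-like elements. Existence is the
  spanning property \<open>carrier_eq_lspan\<close>, uniqueness is linear independence.\<close>

definition coordinates :: "'a \<Rightarrow> 'a \<Rightarrow>\<^sub>0 'k" where
  "coordinates x = (THE t. keys t \<subseteq> grouplike \<and> lin_ext H (\<lambda>x. x) t = x)"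

lemma coordinates_lin_ext:
  assumes "keys t \<subseteq> grouplike" shows "coordinates (lin_ext H (\<lambda>x. x) t) = t"
  unfolding coordinates_def using assms grouplike_lin_ext_inj by (intro the_equality) auto

lemma coordinates:
  assumes "x \<in> carrier H"
  shows "keys (coordinates x) \<subseteq> grouplike" "lin_ext H (\<lambda>x. x) (coordinates x) = x"
  using assms coordinates_lin_ext unfolding carrier_eq_lspan lspan_def by auto

lemma coordinates_grouplike: "g \<in> grouplike \<Longrightarrow> coordinates g = single g 1"
  using coordinates_lin_ext[of "single g 1"] grouplike_carrier by simp

abbreviation "KG \<equiv> monoid_algebra group_of :: ('k, 'a \<Rightarrow>\<^sub>0 'k) module"

lemma monoid_group_of: "monoid group_of" using group_group_of by (simp add: group_def)

lemma coordinates_linear: "coordinates \<in> linear_maps H KG"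
proof (rule linear_mapsI)
  have id: "(\<lambda>x. x) \<in> grouplike \<rightarrow> carrier H" using grouplike_carrier by auto
  fix x assume x: "x \<in> carrier H"
  show "coordinates x \<in> carrier KG" using coordinates[OF x] by simp
  show "coordinates (c \<odot> x) = c \<odot>\<^bsub>KG\<^esub> coordinates x" for c
    using coordinates_lin_ext[OF order_trans[OF keys_map_times coordinates(1)[OF x]], of c] coordinates[OF x]
    by (simp add: V.lin_ext_scale[OF _ id])
  show "coordinates (x \<oplus> y) = coordinates x \<oplus>\<^bsub>KG\<^esub> coordinates y" if y: "y \<in> carrier H" for y
    using coordinates_lin_ext[of "coordinates x + coordinates y"] coordinates[OF x] coordinates[OF y]
    by (simp add: V.lin_ext_add[OF _ _ id] keys_add_subset)
qed

text \<open>Every x is recovered from coordinates supported on the group-like elements, so structure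
  maps need only be compared there.\<close>

lemma linear_maps_eq_on_grouplike:
  assumes M: "vspace M" and f: "f \<in> linear_maps H M" and g: "g \<in> linear_maps H M"
    and eq: "\<And>x. x \<in> grouplike \<Longrightarrow> f x = g x" and x: "x \<in> carrier H"
  shows "f x = g x"
proof -
  interpret M: vec_space M using M by (simp add: vec_space_iff)
  have c: "(\<lambda>x. x) \<in> keys (coordinates x) \<rightarrow> carrier H"
    using coordinates(1)[OF x] grouplike_carrier by auto
  have "lin_ext M f (coordinates x) = lin_ext M g (coordinates x)"
    using coordinates(1)[OF x] eq grouplike_carrier linear_mapsD(1)[OF g] by (intro M.lin_ext_cong) auto
  then show ?thesis
    using linear_maps_lin_ext[OF vsp M f c] linear_maps_lin_ext[OF vsp M g c] coordinates(2)[OF x] by simp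
qed

lemma coordinates_mult:
  assumes x: "x \<in> carrier H" and y: "y \<in> carrier H"
  shows "coordinates (x \<otimes> y) = coordinates x \<otimes>\<^bsub>KG\<^esub> coordinates y"
proof -
  note A = unital_algebra_monoid_algebra[OF monoid_group_of, where ?'k = 'k]
  note lin = linear_mapsD(1)[OF coordinates_linear]
  have 1: "coordinates (g \<otimes> y) = coordinates g \<otimes>\<^bsub>KG\<^esub> coordinates y" if g: "g \<in> grouplike" and y: "y \<in> carrier H" for g y
    by (rule linear_maps_eq_on_grouplike[OF vspace_monoid_algebra
         linear_maps_comp[OF mult_linear_left[OF unital grouplike_carrier[OF g]] coordinates_linear]
         linear_maps_comp[OF coordinates_linear mult_linear_left[OF A lin[OF grouplike_carrier[OF g]]]] _ y])
      (use g in \<open>simp add: coordinates_grouplike mult_grouplike\<close>)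
  show ?thesis
    by (rule linear_maps_eq_on_grouplike[OF vspace_monoid_algebra
         linear_maps_comp[OF mult_linear_right[OF unital y] coordinates_linear]
         linear_maps_comp[OF coordinates_linear mult_linear_right[OF A lin[OF y]]] _ x])
      (use 1 y in simp)
qed

lemma bij_coordinates: "bij_betw coordinates (carrier H) (carrier KG)"
proof (rule bij_betwI')
  show "coordinates x = coordinates y \<longleftrightarrow> x = y" if "x \<in> carrier H" "y \<in> carrier H" for x y
    using coordinates(2) that by metis
  show "coordinates x \<in> carrier KG" if "x \<in> carrier H" for x using coordinates(1)[OF that] by simp
  show "\<exists>x\<in>carrier H. t = coordinates x" if "t \<in> carrier KG" for t
  proof -
    have "lin_ext H (\<lambda>x. x) t \<in> carrier H"
      using that grouplike_carrier by (intro V.lin_ext_closed[of t grouplike]) auto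
    then show ?thesis using coordinates_lin_ext[of t] that by (intro bexI[of _ "lin_ext H (\<lambda>x. x) t"]) auto
  qed
qed

text \<open>Formulated for any record L with the structure maps of the group algebra, so that it
  serves both \<open>group_hopf\<close> and its extension by a star. Comultiplication, counit and
  antipode are compared as linear maps on group-like elements.\<close>

lemma coordinates_hopf_hom:
  fixes L :: "('k, 'a \<Rightarrow>\<^sub>0 'k, 'l) hopf_scheme"
  assumes L: "module.truncate L = KG"
    and comult_L: "comult L = lin_ext (tensor KG KG) (\<lambda>g. pure_tensor KG KG (single g 1) (single g 1))"
    and counit_L: "counit L = lin_ext scalars (\<lambda>g. 1)"
    and antipode_L: "antipode L = lin_ext KG (\<lambda>g. single (inv\<^bsub>group_of\<^esub> g) 1)"
  shows "coordinates \<in> hopf_homs H L" "bij_betw coordinates (carrier H) (carrier L)"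
proof -
  have fields: "carrier L = carrier KG" "monoid.mult L = monoid.mult KG" "one L = one KG" "zero L = zero KG"
    "add L = add KG" "module.smult L = module.smult KG"
    unfolding L[symmetric] by (simp_all add: module.defs)
  show "bij_betw coordinates (carrier H) (carrier L)" using bij_coordinates by (simp add: fields)
  note vA = vspace_monoid_algebra[of group_of, where ?'k = 'k]
  note T = vspace_tensor[OF vA vA]
  interpret TT: vec_space "tensor KG KG" using T by (simp add: vec_space_iff)
  have S: "antipode H \<in> linear_maps H H" using hopf by (simp add: hopf_algebra_def)
  have tm: "tensor_map L L = tensor_map KG KG"
    unfolding L[symmetric] by (simp add: tensor_map_truncate)
  note tml = tensor_map_linear[OF vA vA vsp vsp coordinates_linear coordinates_linear]
  have single: "single g 1 \<in> carrier KG" if "g \<in> grouplike" for g using that by simp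
  have "comult L (coordinates x) = tensor_map L L coordinates coordinates (\<Delta> x)" if x: "x \<in> carrier H" for x
    unfolding comult_L tm
  proof (rule linear_maps_eq_on_grouplike[OF T linear_maps_comp[OF coordinates_linear lin_ext_linear[OF T]]
        linear_maps_comp[OF comult_linear tml(1)] _ x])
    show "(\<lambda>g. pure_tensor KG KG (single g 1) (single g 1)) \<in> carrier group_of \<rightarrow> carrier (tensor KG KG)"
      using single by (auto intro!: pure_tensor_closed[OF vA vA])
    fix g assume g: "g \<in> grouplike"
    then have "\<Delta> g = pure_tensor H H g g" by (simp add: grouplike_def)
    then show "lin_ext (tensor KG KG) (\<lambda>g. pure_tensor KG KG (single g 1) (single g 1)) (coordinates g) =
        tensor_map KG KG coordinates coordinates (\<Delta> g)"
      using g tml(2)[OF grouplike_carrier[OF g] grouplike_carrier[OF g]] pure_tensor_closed[OF vA vA single[OF g] single[OF g]]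
      by (simp add: coordinates_grouplike)
  qed
  moreover have "counit L (coordinates x) = \<epsilon> x" if x: "x \<in> carrier H" for x
    unfolding counit_L
    by (rule linear_maps_eq_on_grouplike[OF vspace_scalars linear_maps_comp[OF coordinates_linear lin_ext_linear[OF vspace_scalars]]
        counit_dual _ x])
      (simp_all add: coordinates_grouplike counit_grouplike lin_ext_def finsum_scalars)
  moreover have "coordinates (antipode H x) = antipode L (coordinates x)" if x: "x \<in> carrier H" for x
    unfolding antipode_L
  proof (rule linear_maps_eq_on_grouplike[OF vA linear_maps_comp[OF S coordinates_linear]
        linear_maps_comp[OF coordinates_linear lin_ext_linear[OF vA]] _ x])
    interpret G: group group_of by (rule group_group_of)
    have inv: "inv\<^bsub>group_of\<^esub> g \<in> grouplike" if "g \<in> grouplike" for g using G.inv_closed[of g] that by simp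
    then show "(\<lambda>g. single (inv\<^bsub>group_of\<^esub> g) 1) \<in> carrier group_of \<rightarrow> carrier KG" by auto
    fix g assume g: "g \<in> grouplike"
    then show "coordinates (antipode H g) = lin_ext KG (\<lambda>g. single (inv\<^bsub>group_of\<^esub> g) 1) (coordinates g)"
      using inv[OF g] by (simp add: coordinates_grouplike flip: group_of_inv)
  qed
  moreover have "coordinates \<in> ring_hom H L"
    using coordinates_mult coordinates_grouplike[OF one_grouplike] linear_mapsD[OF coordinates_linear]
    by (intro ring_hom_memI) (simp_all add: fields)
  moreover have "coordinates \<in> linear_maps H L"
    using coordinates_linear by (simp add: linear_maps_def fields)
  ultimately show "coordinates \<in> hopf_homs H L"
    by (simp add: hopf_homs_def algebra_homs_def)
qed

lemma hopf_iso_group_hopf: "hopf_iso H (group_hopf group_of)"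
proof -
  let ?L = "group_hopf group_of :: ('k, 'a \<Rightarrow>\<^sub>0 'k) hopf"
  have "module.truncate ?L = KG" "comult ?L = lin_ext (tensor KG KG) (\<lambda>g. pure_tensor KG KG (single g 1) (single g 1))"
    "counit ?L = lin_ext scalars (\<lambda>g. 1)" "antipode ?L = lin_ext KG (\<lambda>g. single (inv\<^bsub>group_of\<^esub> g) 1)"
    by (simp_all add: group_hopf_def Let_def module.defs hopf.defs)
  from coordinates_hopf_hom[OF this] show ?thesis unfolding hopf_iso_def by blast
qed

end

section \<open>Hopf *-algebras\<close>

text \<open>The antihomomorphism underlying the *-structure of \<open>A\<^sub>s(n)\<close> is a homomorphism into the
  opposite algebra with conjugate scalars.\<close>

definition conj_opposite :: "(complex, 'a, 'm) module_scheme \<Rightarrow> (complex, 'a) module" where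
  "conj_opposite A = \<lparr>carrier = carrier A, monoid.mult = (\<lambda>x y. y \<otimes>\<^bsub>A\<^esub> x), one = \<one>\<^bsub>A\<^esub>, zero = \<zero>\<^bsub>A\<^esub>,
     add = add A, module.smult = (\<lambda>c x. cnj c \<odot>\<^bsub>A\<^esub> x)\<rparr>"

lemma conj_opposite_simps [simp]:
  "carrier (conj_opposite A) = carrier A" "x \<otimes>\<^bsub>conj_opposite A\<^esub> y = y \<otimes>\<^bsub>A\<^esub> x"
  "\<one>\<^bsub>conj_opposite A\<^esub> = \<one>\<^bsub>A\<^esub>" "\<zero>\<^bsub>conj_opposite A\<^esub> = \<zero>\<^bsub>A\<^esub>" "x \<oplus>\<^bsub>conj_opposite A\<^esub> y = x \<oplus>\<^bsub>A\<^esub> y"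
  "c \<odot>\<^bsub>conj_opposite A\<^esub> x = cnj c \<odot>\<^bsub>A\<^esub> x" "add (conj_opposite A) = add A"
  by (simp_all add: conj_opposite_def)

lemma finsum_conj_opposite: "finsum (conj_opposite A) = finsum A"
  by (simp add: fun_eq_iff finsum_def finprod_def comp_def)

lemma keys_map_cnj [simp]: "keys (Poly_Mapping.map cnj t) = keys t"
  by (auto simp: in_keys_iff Poly_Mapping.map.rep_eq when_def)

lemma lookup_map_cnj [simp]: "lookup (Poly_Mapping.map cnj t) x = cnj (lookup t x)"
  by (simp add: Poly_Mapping.map.rep_eq when_def)

lemma lin_ext_conj_opposite: "lin_ext (conj_opposite A) \<phi> t = lin_ext A \<phi> (Poly_Mapping.map cnj t)"
  by (simp add: lin_ext_def finsum_conj_opposite)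

lemma unital_algebra_conj_opposite:
  assumes "unital_algebra A" shows "unital_algebra (conj_opposite A)"
proof -
  interpret ring A using assms by (rule unital_algebra_simps)
  interpret vec_space A using unital_algebra_simps[OF assms] by (simp add: vec_space_iff)
  have ag: "abelian_group (conj_opposite A)"
    by (rule abelian_groupI) (auto simp: a_ac intro: bexI[of _ "\<ominus>\<^bsub>A\<^esub> _"] l_neg)
  have "monoid (conj_opposite A)"
    by (rule monoidI) (auto simp: m_assoc)
  with ag have "ring (conj_opposite A)"
    by (intro ringI) (auto simp: l_distr r_distr)
  moreover have "vspace (conj_opposite A)"
    using ag by (intro vspaceI) (auto simp: scale_left_distrib scale_right_distrib scale_assoc)
  ultimately show ?thesis
    using unital_algebra_simps(3,4)[OF assms] by (simp add: unital_algebra_def)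
qed

text \<open>The relations are symmetric under reversal of products and have real coefficients, so
  the generators also form a magic matrix in the conjugate opposite algebra. Evaluating a word there
  gives the reversed word, and since this evaluation vanishes on \<open>As_ideal n\<close>, the star
  takes a single value on the coset of a generator.\<close>

lemma star_As_gen:
  assumes ij: "i \<in> {1..n}" "j \<in> {1..n}"
  shows "star (As_star n) (As_gen n i j) = As_gen n i j"
proof -
  let ?A = "As_algebra n :: (complex, _) module"
  let ?B = "conj_opposite ?A"
  interpret A: magic_matrix ?A n "As_gen n" by (rule magic_As)
  have "magic_matrix ?B n (As_gen n)"
    unfolding magic_matrix_def
    using unital_algebra_conj_opposite[OF unital_algebra_As] A.u_closed A.row_mult A.col_mult A.row_sum A.col_sum
    by (auto simp: finsum_conj_opposite simp del: atLeastAtMost_iff One_nat_def)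
  then interpret B: magic_matrix ?B n "As_gen n" .
  have eval: "word_eval ?B (As_gen n) w = As_word n (rev w)" if "w \<in> lists (As_letters n)" for w
  proof -
    have "set w \<subseteq> As_letters n" using that by (simp add: in_lists_conv_set subset_iff)
    then show ?thesis
    proof (induction w)
      case (Cons a w)
      obtain i j where a: "a = (i, j)" by (cases a)
      have "rev w \<in> lists (As_letters n)" "[a] \<in> lists (As_letters n)"
        using Cons.prems by (auto simp: in_lists_conv_set)
      from As_word_append[OF this, where ?'k = complex] show ?case using Cons a by (simp add: As_gen_def)
    qed (simp add: As_word_Nil)
  qed
  let ?\<phi> = "\<lambda>t. lin_ext ?A (\<lambda>w. As_word n (rev w)) (Poly_Mapping.map cnj t)"
  have eq: "?\<phi> t = B.eval_free t" if "keys t \<subseteq> lists (As_letters n)" for t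
    unfolding lin_ext_conj_opposite
  proof (intro A.V.lin_ext_cong Pi_I)
    fix w assume "w \<in> keys (Poly_Mapping.map cnj t)"
    then have w: "w \<in> lists (As_letters n)" using that by auto
    show "As_word n (rev w) = word_eval ?B (As_gen n) w" using eval[OF w] by simp
    show "word_eval ?B (As_gen n) w \<in> carrier ?A" using B.word_eval_closed[OF w] by simp
  qed
  have carr: "carrier (free_algebra (As_letters n) :: (complex, _) module) = {t. keys t \<subseteq> lists (As_letters n)}"
    by (simp add: free_algebra_def)
  have sub: "As_ideal n \<subseteq> {t :: _ \<Rightarrow>\<^sub>0 complex. keys t \<subseteq> lists (As_letters n)}"
    using As_quot.subspace_props(1)[of n, where ?'k = complex] carr by simp
  let ?s = "single [(i, j)] (1::complex)"
  have s: "keys ?s \<subseteq> lists (As_letters n)" using ij by simp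
  have "star (As_star n) (As_gen n i j) = the_elem (?\<phi> ` As_gen n i j)"
    by (simp add: As_star_def hopf.defs hopf_star.defs induced_cnj_def)
  also have "\<dots> = ?\<phi> ?s"
  proof (rule the_elem_image_constant)
    show "?s \<in> As_gen n i j"
      unfolding As_gen_def As_word_def by (rule As_quot.a_rcos_self) (use s carr in simp)
    fix t :: "(nat \<times> nat) list \<Rightarrow>\<^sub>0 complex" assume "t \<in> As_gen n i j"
    then obtain k where k: "k \<in> As_ideal n" "t = k + ?s"
      unfolding As_gen_def As_word_def by (auto simp: a_r_coset_def' free_algebra_def)
    then have kk: "keys k \<subseteq> lists (As_letters n)" using sub by auto
    have "B.eval_free t = B.eval_free k \<oplus>\<^bsub>?A\<^esub> B.eval_free ?s"
      unfolding k(2) using B.V.lin_ext_add[OF _ _ B.word_eval_funcset, of k ?s] kk s by simp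
    also have "\<dots> = B.eval_free ?s"
      using B.eval_free_ideal[OF k(1)] B.V.lin_ext_closed[of ?s "lists (As_letters n)" "word_eval ?B (As_gen n)"] s B.word_eval_funcset
      by simp
    finally show "?\<phi> t = ?\<phi> ?s" using eq[OF s] eq[OF keys_add_subset[OF kk s]] k(2) by simp
  qed
  also have "\<dots> = As_gen n i j"
    unfolding eq[OF s] using ij B.u_closed[OF ij] A.u_closed[OF ij] by simp
  finally show ?thesis .
qed

section \<open>Cocommutative *-quotients: counit, antipode and adjoints\<close>

locale magic_star = magic_hopf H n u + cocommutative_hopf H
  for H :: "('a, 'm) hopf_star_scheme" (structure) and n u +
  assumes star_algebra: "hopf_star_algebra H"
    and star_u: "\<And>i j. i \<in> {1..n} \<Longrightarrow> j \<in> {1..n} \<Longrightarrow> star H (u i j) = u i j"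
begin

lemma star_closed [simp]: "x \<in> carrier H \<Longrightarrow> star H x \<in> carrier H"
  using star_algebra by (auto simp: hopf_star_algebra_def)

lemma star_simps:
  "x \<in> carrier H \<Longrightarrow> y \<in> carrier H \<Longrightarrow> star H (x \<oplus> y) = star H x \<oplus> star H y"
  "x \<in> carrier H \<Longrightarrow> y \<in> carrier H \<Longrightarrow> star H (x \<otimes> y) = star H y \<otimes> star H x"
  "x \<in> carrier H \<Longrightarrow> star H (c \<odot> x) = cnj c \<odot> star H x"
  "x \<in> carrier H \<Longrightarrow> star H (star H x) = x"
  using star_algebra by (auto simp: hopf_star_algebra_def)

lemma star_zero: "star H \<zero> = \<zero>"
  using star_simps(3)[of \<zero> 0] by simp

lemma star_one: "star H \<one> = \<one>"
  using star_simps(2)[of "star H \<one>" \<one>] star_simps(4)[of \<one>] by simp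

lemma star_finsum: "f \<in> A \<rightarrow> carrier H \<Longrightarrow> star H (\<Oplus>i\<in>A. f i) = (\<Oplus>i\<in>A. star H (f i))"
  by (induction A rule: infinite_finite_induct) (auto simp: star_zero star_simps Pi_iff)

lemma star_lin_ext:
  assumes "\<phi> \<in> keys t \<rightarrow> carrier H"
  shows "star H (lin_ext H \<phi> t) = lin_ext H (\<lambda>x. star H (\<phi> x)) (Poly_Mapping.map cnj t)"
  unfolding lin_ext_def keys_map_cnj using assms
  by (subst star_finsum; (intro finsum_cong' refl)?) (auto simp: star_simps Pi_iff)

lemma one_not_zero: "\<one> \<noteq> \<zero>" using one_grouplike by (auto simp: grouplike_def)

text \<open>The counit axiom expands u_kj as the sum of the \<epsilon>(u_lj) u_kl. Multiplying by
  u_ki leaves u_kj u_ki = \<epsilon>(u_ij) u_ki, and row orthogonality evaluates the left side. The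
  index k is chosen with u_ki nonzero, which is possible because column i sums to 1.\<close>

lemma counit_u: assumes "i \<in> {1..n}" "j \<in> {1..n}" shows "\<epsilon> (u i j) = (if i = j then 1 else 0)"
proof -
  have "\<exists>k\<in>{1..n}. u k i \<noteq> \<zero>"
  proof (rule ccontr)
    assume "\<not> ?thesis"
    then have "(\<Oplus>k\<in>{1..n}. u k i) = \<zero>" by (intro add.finprod_one_eqI) auto
    then show False using col_sum[OF assms(1)] one_not_zero by simp
  qed
  then obtain k where k: "k \<in> {1..n}" "u k i \<noteq> \<zero>" by blast
  have "u k j = row k (\<lambda>l. \<epsilon> (u l j))"
    using act_u[OF k(1) assms(2) counit_dual] act_counit[OF u_closed[OF k(1) assms(2)]] by (simp add: row_def)
  then have e: "\<epsilon> (u i j) \<odot> u k i = u k j \<otimes> u k i"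
    using row_mult_u[OF k(1) assms(1), of "\<lambda>l. \<epsilon> (u l j)"] by simp
  show ?thesis
  proof (cases "i = j")
    case True
    have "(\<epsilon> (u i j) - 1) \<odot> u k i = \<zero>"
      using e True row_mult[OF assms(1) assms(1) k(1)] u_closed[OF k(1) assms(1)]
        V.scale_left_distrib[of "u k i" "\<epsilon> (u i j)" "-1"]
      by (simp flip: V.minus_eq_scale add: r_neg)
    then show ?thesis
      using V.scale_eq_zero_cancel[OF u_closed[OF k(1) assms(1)], of "\<epsilon> (u i j) - 1"] k(2) True by auto
  next
    case False
    then have "\<epsilon> (u i j) \<odot> u k i = \<zero>" using e row_mult[OF assms(2,1) k(1)] by simp
    then show ?thesis using V.scale_eq_zero_cancel[OF u_closed[OF k(1) assms(1)]] k(2) False by auto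
  qed
qed

lemma antipode_linear: "antipode H \<in> linear_maps H H"
  using hopf by (simp add: hopf_algebra_def)

text \<open>In the antipode axiom the sum over k of S(u_ik) u_kj equals \<epsilon>(u_ij) 1.
  Multiplying by u_lj on the right leaves S(u_il) u_lj by column orthogonality; summing over j turns
  the left side into S(u_il) by the row sum and the right side into u_li.\<close>

lemma antipode_u: assumes i: "i \<in> {1..n}" and l: "l \<in> {1..n}" shows "antipode H (u i l) = u l i"
proof -
  note S = antipode_linear
  note Sc = linear_mapsD(1)[OF S]
  have bil: "bilinear_map H H H (\<lambda>(y, z). antipode H y \<otimes> z)"
    using linear_maps_comp[OF S mult_linear_right[OF unital]] mult_linear_left[OF unital] Sc
    by (intro bilinear_mapI) auto
  have *: "antipode H (u i l) \<otimes> u l j = (if i = j then u l j else \<zero>)" if j: "j \<in> {1..n}" for j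
  proof -
    have "\<epsilon> (u i j) \<odot> \<one> = induced H (\<lambda>(y, z). antipode H y \<otimes> z) (\<Delta> (u i j))"
      using hopf u_closed[OF i j] by (simp add: hopf_algebra_def)
    also have "\<dots> = (\<Oplus>k\<in>{1..n}. induced H (\<lambda>(y, z). antipode H y \<otimes> z) (pure_tensor H H (u i k) (u k j)))"
      unfolding comult_u[OF i j]
      by (rule linear_maps_finsum[OF vsp_T vsp induced_linear[OF vsp vsp vsp bil]])
        (use i j u_closed pure_tensor_closed[OF vsp vsp] in auto)
    also have "\<dots> = (\<Oplus>k\<in>{1..n}. antipode H (u i k) \<otimes> u k j)"
      using i j u_closed Sc by (intro finsum_cong' refl) (auto simp: induced_pure[OF vsp vsp vsp bil])
    finally have "(\<epsilon> (u i j) \<odot> \<one>) \<otimes> u l j = (\<Oplus>k\<in>{1..n}. antipode H (u i k) \<otimes> u k j) \<otimes> u l j" by simp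
    also have "\<dots> = (\<Oplus>k\<in>{1..n}. (antipode H (u i k) \<otimes> u k j) \<otimes> u l j)"
      using i j l u_closed Sc by (intro finsum_ldistr) auto
    also have "\<dots> = (\<Oplus>k\<in>{1..n}. if k = l then antipode H (u i k) \<otimes> u k j else \<zero>)"
      using i j l u_closed Sc by (intro finsum_cong' refl) (auto simp: m_assoc col_mult)
    also have "\<dots> = antipode H (u i l) \<otimes> u l j"
      using i j l u_closed Sc by (intro V.finsum_delta) auto
    finally show ?thesis
      using u_closed[OF l j] by (simp add: counit_u[OF i j] unital_algebra_simps(3)[OF unital] split: if_splits)
  qed
  have "antipode H (u i l) = antipode H (u i l) \<otimes> (\<Oplus>j\<in>{1..n}. u l j)"
    using i l u_closed Sc by (simp add: row_sum del: One_nat_def)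
  also have "\<dots> = (\<Oplus>j\<in>{1..n}. antipode H (u i l) \<otimes> u l j)"
    using i l u_closed Sc by (intro finsum_rdistr) auto
  also have "\<dots> = (\<Oplus>j\<in>{1..n}. if j = i then u l j else \<zero>)"
    using i l u_closed * by (intro finsum_cong' refl) auto
  also have "\<dots> = u l i" using i l u_closed by (intro V.finsum_delta) auto
  finally show ?thesis .
qed

text \<open>The standard involution on the dual of a Hopf *-algebra. On the matrices (f(u_ij)) it is
  the conjugate transpose, by \<open>dual_star_u\<close>.\<close>

definition dual_star :: "('a \<Rightarrow> complex) \<Rightarrow> 'a \<Rightarrow> complex" where
  "dual_star f x = cnj (f (star H (antipode H x)))"

lemma dual_star: assumes f: "f \<in> dual H" shows "dual_star f \<in> dual H"
  unfolding dual_star_def[abs_def]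
  using linear_mapsD[OF antipode_linear] dual_simps[OF f] by (intro linear_mapsI) (auto simp: star_simps)

lemma dual_star_u: "i \<in> {1..n} \<Longrightarrow> j \<in> {1..n} \<Longrightarrow> dual_star f (u i j) = cnj (f (u j i))"
  by (simp add: dual_star_def antipode_u star_u)

subsection \<open>The dual algebra acts on \<open>\<complex>\<^sup>n\<close> by commuting normal matrices\<close>

text \<open>With this index set \<open>monoid_algebra\<close> becomes the coordinate space C^n, to
  which the linear algebra for carrier sets applies.\<close>

abbreviation index_monoid :: "nat monoid" where
  "index_monoid \<equiv> \<lparr>carrier = {1..n}, monoid.mult = (\<lambda>x y. x), one = 1\<rparr>"

abbreviation "Cn \<equiv> monoid_algebra index_monoid :: (complex, nat \<Rightarrow>\<^sub>0 complex) module"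

definition mat_op :: "('a \<Rightarrow> complex) \<Rightarrow> (nat \<Rightarrow>\<^sub>0 complex) \<Rightarrow> nat \<Rightarrow>\<^sub>0 complex" where
  "mat_op f v = (\<Sum>k\<in>{1..n}. single k (\<Sum>j\<in>{1..n}. f (u k j) * lookup v j))"

definition herm :: "(nat \<Rightarrow>\<^sub>0 complex) \<Rightarrow> (nat \<Rightarrow>\<^sub>0 complex) \<Rightarrow> complex" where
  "herm v w = (\<Sum>j\<in>{1..n}. cnj (lookup v j) * lookup w j)"

lemma lookup_sum_single:
  "finite A \<Longrightarrow> lookup (\<Sum>k\<in>A. single k (c k)) l = (if l \<in> A then c l else 0)"
proof -
  assume A: "finite A"
  have "lookup (\<Sum>k\<in>A. single k (c k)) l = (\<Sum>k\<in>A. if k = l then c k else 0)"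
    unfolding lookup_sum by (intro sum.cong) (auto simp: lookup_single when_def)
  then show ?thesis using A by simp
qed

lemma lookup_mat_op:
  "lookup (mat_op f v) k = (if k \<in> {1..n} then \<Sum>j\<in>{1..n}. f (u k j) * lookup v j else 0)"
  unfolding mat_op_def by (rule lookup_sum_single) simp

lemma mat_op_closed: "keys (mat_op f v) \<subseteq> {1..n}"
  by (auto simp: in_keys_iff lookup_mat_op split: if_splits)

lemma mat_op_linear: "mat_op f \<in> linear_maps Cn Cn"
  using mat_op_closed[of f]
  by (intro linear_mapsI)
    (auto intro!: poly_mapping_eqI simp: lookup_mat_op lookup_add distrib_left sum.distrib sum_distrib_left mult_ac)

lemma mat_op_mat_op:
  assumes "f \<in> dual H" "g \<in> dual H" shows "mat_op f (mat_op g v) = mat_op (conv f g) v"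
proof (rule poly_mapping_eqI)
  fix k
  show "lookup (mat_op f (mat_op g v)) k = lookup (mat_op (conv f g) v) k"
  proof (cases "k \<in> {1..n}")
    case True
    have "(\<Sum>j\<in>{1..n}. f (u k j) * (\<Sum>l\<in>{1..n}. g (u j l) * lookup v l)) =
       (\<Sum>l\<in>{1..n}. \<Sum>j\<in>{1..n}. f (u k j) * (g (u j l) * lookup v l))"
      unfolding sum_distrib_left by (rule sum.swap)
    also have "\<dots> = (\<Sum>l\<in>{1..n}. conv f g (u k l) * lookup v l)"
      using assms True by (intro sum.cong refl) (simp add: conv_u sum_distrib_right mult.assoc del: atLeastAtMost_iff One_nat_def)
    finally show ?thesis using True by (simp add: lookup_mat_op del: One_nat_def)
  next
    case False
    then show ?thesis by (simp only: lookup_mat_op if_False)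
  qed
qed

lemma mat_op_commute:
  assumes "f \<in> dual H" "g \<in> dual H" shows "mat_op f (mat_op g v) = mat_op g (mat_op f v)"
proof -
  have "mat_op (conv f g) v = mat_op (conv g f) v"
    using assms by (auto intro!: poly_mapping_eqI sum.cong simp: lookup_mat_op conv_commute u_closed)
  then show ?thesis using assms by (simp add: mat_op_mat_op)
qed

lemma herm_mat_op: "herm (mat_op f v) w = herm v (mat_op (dual_star f) w)"
proof -
  have "herm (mat_op f v) w = (\<Sum>k\<in>{1..n}. \<Sum>j\<in>{1..n}. cnj (f (u k j)) * cnj (lookup v j) * lookup w k)"
    unfolding herm_def by (intro sum.cong refl) (simp add: lookup_mat_op sum_distrib_right)
  also have "\<dots> = (\<Sum>j\<in>{1..n}. \<Sum>k\<in>{1..n}. cnj (f (u k j)) * cnj (lookup v j) * lookup w k)"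
    by (rule sum.swap)
  also have "\<dots> = herm v (mat_op (dual_star f) w)"
    unfolding herm_def by (intro sum.cong refl) (auto simp: lookup_mat_op dual_star_u sum_distrib_left mult_ac intro!: sum.cong)
  finally show ?thesis .
qed

lemma herm_zero: assumes "herm v v = 0" "keys v \<subseteq> {1..n}" shows "v = 0"
proof -
  have "complex_of_real (\<Sum>j\<in>{1..n}. (cmod (lookup v j))\<^sup>2) = herm v v"
    unfolding herm_def of_real_sum by (intro sum.cong refl) (metis complex_norm_square mult.commute)
  then have "(\<Sum>j\<in>{1..n}. (cmod (lookup v j))\<^sup>2) = 0"
    using assms(1) by (simp only: of_real_eq_0_iff)
  then have "\<And>j. j \<in> {1..n} \<Longrightarrow> lookup v j = 0"
    by (subst (asm) sum_nonneg_eq_0_iff) auto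
  then show ?thesis
    using assms(2) by (intro poly_mapping_eqI) (metis in_keys_iff lookup_zero subset_iff)
qed

definition joint_eigenvectors :: "(nat \<Rightarrow>\<^sub>0 complex) set" where
  "joint_eigenvectors = {v. keys v \<subseteq> {1..n} \<and>
     (\<forall>f\<in>dual H. \<exists>c. mat_op f v = Poly_Mapping.map ((*) c) v)}"

definition orthogonal :: "(nat \<Rightarrow>\<^sub>0 complex) set" where
  "orthogonal = {w. keys w \<subseteq> {1..n} \<and> (\<forall>v\<in>joint_eigenvectors. herm v w = 0)}"

lemma herm_simps: "herm v (w + w') = herm v w + herm v w'" "herm v (Poly_Mapping.map ((*) c) w) = c * herm v w"
    "herm (Poly_Mapping.map ((*) c) v) w = cnj c * herm v w" "herm v 0 = 0"
  by (simp_all add: herm_def lookup_add distrib_left sum.distrib sum_distrib_left mult_ac)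

text \<open>The orthogonal complement of the simultaneous eigenvectors is invariant, because the algebra of
  matrices is closed under adjoints; if it were nonzero, it would contain an eigenvector.\<close>

lemma orthogonal_trivial: "orthogonal = {0}"
proof (rule ccontr)
  assume ne: "orthogonal \<noteq> {0}"
  note vC = vspace_monoid_algebra[of index_monoid, where ?'k = complex]
  let ?inv = "\<lambda>W. \<forall>f\<in>dual H. \<forall>w\<in>W. mat_op f w \<in> W"
  let ?P = "\<lambda>W. submodule W ring_of_type_algebra Cn \<and> ?inv W \<and> W \<subseteq> orthogonal \<and> W \<noteq> {0}"
  have "submodule orthogonal ring_of_type_algebra Cn"
    using order_trans[OF keys_map_times]
    by (intro monoid_algebra.subspaceI) (auto simp: orthogonal_def herm_simps keys_add_subset)
  moreover have "?inv orthogonal"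
  proof (intro ballI)
    fix f w assume f: "f \<in> dual H" and w: "w \<in> orthogonal"
    have "herm v (mat_op f w) = 0" if v: "v \<in> joint_eigenvectors" for v
    proof -
      \<comment> \<open>Only the values f(u_ij) enter, and on these the double adjoint returns f.
        This lets \<open>herm_mat_op\<close> move f to the other side of the form, where v is an
        eigenvector of the adjoint.\<close>
      have ff: "mat_op f w = mat_op (dual_star (dual_star f)) w"
        by (auto intro!: poly_mapping_eqI sum.cong simp: lookup_mat_op dual_star_u)
      obtain c where "mat_op (dual_star f) v = Poly_Mapping.map ((*) c) v"
        using v dual_star[OF f] by (auto simp: joint_eigenvectors_def)
      then show ?thesis unfolding ff herm_mat_op[symmetric] using w v by (simp add: herm_simps orthogonal_def)
    qed
    then show "mat_op f w \<in> orthogonal" using mat_op_closed by (simp add: orthogonal_def)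
  qed
  ultimately have "?P orthogonal" using ne by blast
  \<comment> \<open>A nonzero invariant subspace of least dimension has no proper nonzero invariant
    subspace. So every operator acts on W by a scalar and its members are joint eigenvectors, which
    would be orthogonal to themselves.\<close>
  then obtain W where W: "?P W" and least: "\<And>W'. ?P W' \<Longrightarrow> poly_mapping.dim W \<le> poly_mapping.dim W'"
    using ex_has_least_nat[of ?P orthogonal poly_mapping.dim] by blast
  have Wsub: "submodule W ring_of_type_algebra Cn" using W by blast
  note W' = monoid_algebra.subspaceD[OF Wsub]
  have "0 \<in> W" using W'(2) by simp
  then obtain w where w: "w \<in> W" "w \<noteq> 0" using W by blast
  let ?E = "(\<lambda>j. single j (1::complex)) ` {1..n}"
  have E: "?E \<subseteq> carrier Cn" by auto
  have span: "v \<in> lspan Cn ?E" if "keys v \<subseteq> {1..n}" for v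
  proof -
    have "v = lin_ext Cn (\<lambda>x. single x 1) v"
      using linear_maps_eq_lin_ext[OF vC linear_maps_id(2), of v] that by simp
    also have "\<dots> \<in> lspan Cn ?E" using that by (intro monoid_algebra.lin_ext_in_lspan[OF _ E]) auto
    finally show ?thesis .
  qed
  have span': "v \<in> poly_mapping.span ?E" if "keys v \<subseteq> {1..n}" for v
    using that
  proof (induction v rule: poly_mapping_induct)
    case (single x c)
    then show ?case using poly_mapping.span_scale[OF poly_mapping.span_base[of "single x 1" ?E], of c] by auto
  qed (auto intro: poly_mapping.span_zero poly_mapping.span_add)
  have wc: "w \<in> carrier Cn" using W'(1) w by auto
  have minimal: "W1 = {\<zero>\<^bsub>Cn\<^esub>} \<or> W1 = W"
    if W1: "submodule W1 ring_of_type_algebra Cn" "W1 \<subseteq> W" "\<And>T x. T \<in> mat_op ` dual H \<Longrightarrow> x \<in> W1 \<Longrightarrow> T x \<in> W1" for W1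
  proof (rule ccontr)
    assume no: "\<not> ?thesis"
    then have "?P W1" using W1 W by auto
    then have le: "poly_mapping.dim W \<le> poly_mapping.dim W1" by (rule least)
    have "poly_mapping.subspace W1"
      using monoid_algebra.subspaceD[OF W1(1)] by (intro poly_mapping.subspaceI) auto
    moreover have "W \<subseteq> poly_mapping.span ?E" using W'(1) span' by auto
    ultimately have "poly_mapping.dim W1 < poly_mapping.dim W"
      using no W1(2) by (intro poly_mapping.dim_strict_mono[of ?E]) auto
    then show False using le by simp
  qed
  have "\<exists>c. mat_op f w = Poly_Mapping.map ((*) c) w" if f: "f \<in> dual H" for f
  proof -
    have "keys ((mat_op f ^^ k) w) \<subseteq> {1..n}" for k
      using wc mat_op_closed by (cases k) auto
    then have "(mat_op f ^^ k) w \<in> lspan Cn ?E" for k by (rule span)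
    from exists_annihilating_poly[OF vC mat_op_linear wc _ E this]
    obtain p where p: "p \<noteq> 0" "poly_op Cn (mat_op f) p w = \<zero>\<^bsub>Cn\<^esub>" by auto
    have "\<exists>c. \<forall>x\<in>W. mat_op f x = c \<odot>\<^bsub>Cn\<^esub> x"
    proof (rule minimal_invariant_scalar[OF vC _ _ Wsub _ minimal w(1) _ _ p, of "mat_op ` dual H"])
      show "T \<in> linear_maps Cn Cn" if "T \<in> mat_op ` dual H" for T using that mat_op_linear by auto
      show "S (T x) = T (S x)" if "S \<in> mat_op ` dual H" "T \<in> mat_op ` dual H" for S T x
        using that mat_op_commute by auto
      show "T x \<in> W" if "T \<in> mat_op ` dual H" "x \<in> W" for T x using that W by auto
    qed (use w f in auto)
    then show ?thesis using w by auto
  qed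
  then have "w \<in> joint_eigenvectors" using wc by (simp add: joint_eigenvectors_def)
  moreover have "w \<in> orthogonal" using W w by blast
  ultimately have "herm w w = 0" by (simp add: orthogonal_def)
  then show False using herm_zero wc w(2) by simp
qed

text \<open>By \<open>act_row\<close> the map from coefficient vectors to the row intertwines the
  matrices with the action on H. A joint eigenvector is thus sent to zero or to a common
  eigenvector, which is a multiple of a group-like element.\<close>

lemma row_eigenvector:
  assumes v: "v \<in> joint_eigenvectors" and k: "k \<in> {1..n}"
  shows "row k (lookup v) \<in> lspan H grouplike"
proof -
  have G: "grouplike \<subseteq> carrier H" using grouplike_carrier by auto
  note L = V.subspaceD[OF V.lspan_subspace[OF G]]
  let ?x = "row k (lookup v)"
  have "\<exists>c. act f ?x = c \<odot> ?x" if f: "f \<in> dual H" for f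
  proof -
    obtain c where c: "mat_op f v = Poly_Mapping.map ((*) c) v"
      using v f by (auto simp: joint_eigenvectors_def)
    have "act f ?x = row k (lookup (mat_op f v))"
      unfolding act_row[OF k f] unfolding row_def using k u_closed
      by (intro finsum_cong' refl) (auto simp: lookup_mat_op)
    also have "lookup (mat_op f v) = (\<lambda>j. c * lookup v j)"
      by (rule ext) (simp add: c)
    also have "row k \<dots> = c \<odot> ?x" using k by (simp add: row_scale)
    finally show ?thesis by blast
  qed
  then have "?x = \<zero> \<or> (\<exists>c. \<exists>g\<in>grouplike. ?x = c \<odot> g)"
    using eigenvector_grouplike[of ?x] k row_closed by blast
  then show ?thesis using L(2,4) V.lspan_base[OF G] by auto
qed

text \<open>The coefficient vectors whose row lies in the span of the group-like elements form a
  subspace U containing all joint eigenvectors. If the j-th basis vector, whose row is u_ij, were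
  outside U, a functional vanishing on U would give a nonzero vector orthogonal to the joint
  eigenvectors.\<close>

lemma star_u_spanned: assumes ij: "i \<in> {1..n}" "j \<in> {1..n}" shows "u i j \<in> lspan H grouplike"
proof -
  have G: "grouplike \<subseteq> carrier H" using grouplike_carrier by auto
  note vC = vspace_monoid_algebra[of index_monoid, where ?'k = complex]
  let ?U = "{v \<in> carrier Cn. row i (lookup v) \<in> lspan H grouplike}"
  have lin: "(\<lambda>v. row i (lookup v)) \<in> linear_maps Cn H"
  proof (rule linear_mapsI)
    have "lookup (Poly_Mapping.map ((*) c) v) = (\<lambda>j. c * lookup v j)" for c and v :: "nat \<Rightarrow>\<^sub>0 complex"
      by (rule ext) simp
    then show "row i (lookup (c \<odot>\<^bsub>Cn\<^esub> v)) = c \<odot> row i (lookup v)" for c v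
      using row_scale[OF ij(1)] by simp
    have "lookup (v + w) = (\<lambda>j. lookup v j + lookup w j)" for v w :: "nat \<Rightarrow>\<^sub>0 complex"
      by (rule ext) (simp add: lookup_add)
    then show "row i (lookup (v \<oplus>\<^bsub>Cn\<^esub> w)) = row i (lookup v) \<oplus> row i (lookup w)" for v w
      using row_add[OF ij(1)] by simp
  qed (use ij in auto)
  have U: "submodule ?U ring_of_type_algebra Cn"
    by (rule kernel_subspace[OF vC vsp lin V.lspan_subspace[OF G]])
  let ?v = "single j (1::complex)"
  have "?v \<in> ?U"
  proof (rule ccontr)
    assume "?v \<notin> ?U"
    from exists_separating_dual[OF vC U _ this] ij obtain f where
      f: "f \<in> dual Cn" "f ?v = 1" "\<And>x. x \<in> ?U \<Longrightarrow> f x = 0" by auto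
    \<comment> \<open>The Riesz vector of f: \<open>herm e\<close> takes on it the value conjugate
      to f(e).\<close>
    let ?w = "\<Sum>k\<in>{1..n}. single k (cnj (f (single k 1)))"
    have lw: "lookup ?w k = (if k \<in> {1..n} then cnj (f (single k 1)) else 0)" for k
      by (rule lookup_sum_single) simp
    have "herm e ?w = 0" if e: "e \<in> joint_eigenvectors" for e
    proof -
      have ke: "keys e \<subseteq> {1..n}" using e by (simp add: joint_eigenvectors_def)
      have "f e = lin_ext scalars (\<lambda>k. f (single k 1)) e"
        using linear_maps_eq_lin_ext[OF vspace_scalars f(1), of e] ke by simp
      also have "\<dots> = (\<Sum>k\<in>{1..n}. lookup e k * f (single k 1))"
        unfolding lin_ext_def finsum_scalars using ke by (auto simp: in_keys_iff intro!: sum.mono_neutral_left)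
      finally have "cnj (f e) = herm e ?w" unfolding herm_def lw by simp
      moreover have "f e = 0" using f(3)[of e] row_eigenvector[OF e ij(1)] ke by simp
      ultimately show ?thesis by simp
    qed
    moreover have "keys ?w \<subseteq> {1..n}" by (auto simp: in_keys_iff lw simp del: One_nat_def split: if_splits)
    ultimately have "?w \<in> orthogonal" by (simp add: orthogonal_def)
    then have "?w = 0" using orthogonal_trivial by blast
    then have "lookup ?w j = 0" by simp
    then show False using f(2) ij unfolding lw by simp
  qed
  moreover have "row i (lookup ?v) = u i j"
  proof -
    have "lookup ?v = (\<lambda>l. if l = j then 1 else 0)"
      by (rule ext) (auto simp: lookup_single when_def)
    then show ?thesis using row_single[OF ij] by simp
  qed
  ultimately show ?thesis by simp
qed

sublocale magic_grouplike H n u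
  by unfold_locales (rule star_u_spanned)

text \<open>The coordinates of \<open>g\<close> with respect to the projections of a row are roots of unity.\<close>

lemma star_row_grouplike:
  assumes i: "i \<in> {1..n}" and g: "g \<in> row_grouplike i"
  shows "star H g \<otimes> g = \<one>"
proof -
  obtain c where c: "g = row i c" using g by (auto simp: row_grouplike_def)
  have pw: "row i (\<lambda>j. c j ^ k) \<in> row_grouplike i" for k
  proof (induction k)
    case 0 then show ?case using row_one[OF i] one_row_grouplike[OF i] by simp
  next
    case (Suc k) then show ?case
      using mult_row_grouplike[OF i g, of "row i (\<lambda>j. c j ^ k)"] i by (simp add: c row_times)
  qed
  \<comment> \<open>Only finitely many group-like elements lie in the row, so two different powers
    of g coincide.\<close>
  have "\<not> inj (\<lambda>k. row i (\<lambda>j. c j ^ k))"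
    using finite_row_grouplike[OF i] pw range_inj_infinite finite_subset by (metis image_subsetI)
  then obtain a b where ab: "a < b" "row i (\<lambda>j. c j ^ a) = row i (\<lambda>j. c j ^ b)"
    unfolding inj_def by (metis linorder_neqE_nat)
  obtain h where h: "h \<in> row_grouplike i" "g \<otimes> h = \<one>" using row_grouplike_inverse[OF i g] by blast
  obtain d where d: "h = row i d" using h(1) by (auto simp: row_grouplike_def)
  \<comment> \<open>The coordinate c_j is determined by g only where u_ij is nonzero. There it is
    invertible, the inverse coming from h, so equality of the a-th and b-th powers gives c_j^(b-a) =
    1 and hence modulus one.\<close>
  have cj: "cnj (c j) * c j = 1" if j: "j \<in> {1..n}" and u: "u i j \<noteq> \<zero>" for j
  proof -
    have uc: "u i j \<in> carrier H" using u_closed[OF i j] .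
    have cancel: "x = y" if "x \<odot> u i j = y \<odot> u i j" for x y
    proof -
      have "(x - y) \<odot> u i j = \<zero>"
        using V.scale_left_distrib[OF uc, of x "-y"] V.scale_left_distrib[OF uc, of y "-y"] that uc by simp
      then show ?thesis using V.scale_eq_zero_cancel[OF uc, of "x - y"] u by auto
    qed
    have "c j ^ a \<odot> u i j = c j ^ b \<odot> u i j"
      using row_mult_u[OF i j, of "\<lambda>j. c j ^ a"] row_mult_u[OF i j, of "\<lambda>j. c j ^ b"] ab(2) by simp
    then have p: "c j ^ a = c j ^ b" by (rule cancel)
    have "(c j * d j) \<odot> u i j = 1 \<odot> u i j"
      using row_mult_u[OF i j, of "\<lambda>j. c j * d j"] h(2) row_times[OF i, of c d] c d uc by simp
    then have "c j * d j = 1" by (rule cancel)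
    then have "c j \<noteq> 0" by auto
    then have "c j ^ (b - a) = 1" using p ab(1) by (metis (no_types) le_add_diff_inverse less_imp_le mult_cancel_left1 power_add power_not_zero)
    then have "cmod (c j) ^ (b - a) = 1 ^ (b - a)" by (metis norm_one norm_power power_one)
    then have "cmod (c j) = 1" using ab(1) power_eq_iff_eq_base[of "b - a" "cmod (c j)" 1] by simp
    then show ?thesis by (metis complex_norm_square mult.commute of_real_1 one_power2)
  qed
  have "star H g = row i (\<lambda>j. cnj (c j))"
    unfolding c row_def using i u_closed
    by (subst star_finsum; (intro finsum_cong' refl)?) (auto simp: star_simps star_u)
  then have "star H g \<otimes> g = row i (\<lambda>j. cnj (c j) * c j)" using row_times[OF i] c by simp
  also have "\<dots> = row i (\<lambda>j. 1)"
    unfolding row_def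
  proof (intro finsum_cong' refl)
    fix j assume j: "j \<in> {1..n}"
    then show "(cnj (c j) * c j) \<odot> u i j = 1 \<odot> u i j"
      using cj[OF j] by (cases "u i j = \<zero>") auto
  qed (use i u_closed in auto)
  finally show ?thesis using row_one[OF i] by simp
qed

text \<open>Write g as a word in the row groups. The star reverses products, so in (star of ax)(ax)
  the inner factors cancel by \<open>star_row_grouplike\<close> and the claim reduces to the shorter
  word x.\<close>

lemma star_grouplike: assumes "g \<in> grouplike" shows "star H g = inv\<^bsub>group_of\<^esub> g"
proof -
  from assms obtain ws where ws: "set ws \<subseteq> (\<Union>i\<in>{1..n}. row_grouplike i)" "g = foldr (\<otimes>) ws \<one>"
    using grouplike_eq_words by (auto simp: grouplike_words_def)
  have "star H (foldr (\<otimes>) ws \<one>) \<otimes> foldr (\<otimes>) ws \<one> = \<one>" using ws(1)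
  proof (induction ws)
    case Nil then show ?case by (simp add: star_one)
  next
    case (Cons a ws)
    then obtain i where i: "i \<in> {1..n}" "a \<in> row_grouplike i" by auto
    then have a: "a \<in> carrier H" using grouplike_carrier by (auto simp: row_grouplike_def)
    have "set ws \<subseteq> grouplike" using Cons.prems by (auto simp: row_grouplike_def)
    then have x: "foldr (\<otimes>) ws \<one> \<in> carrier H" using foldr_grouplike grouplike_carrier by blast
    let ?x = "foldr (\<otimes>) ws \<one>"
    have "star H (a \<otimes> ?x) \<otimes> (a \<otimes> ?x) = star H ?x \<otimes> ((star H a \<otimes> a) \<otimes> ?x)"
      using a x by (simp add: star_simps m_assoc)
    also have "\<dots> = \<one>" using star_row_grouplike[OF i] Cons x by simp
    finally show ?case by simp
  qed
  then have "star H g \<otimes> g = \<one>" using ws by simp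
  then have "star H g = antipode H g"
    using antipode_grouplike[OF assms] grouplike_carrier[OF assms] by (metis l_one m_assoc r_one star_closed)
  then show ?thesis using group_of_inv[OF assms] by simp
qed

lemma hopf_star_iso_group_hopf: "hopf_star_iso H (group_hopf_star group_of)"
proof -
  let ?L = "group_hopf_star group_of :: ('a \<Rightarrow>\<^sub>0 complex) hopf_star"
  have "module.truncate ?L = KG" "comult ?L = lin_ext (tensor KG KG) (\<lambda>g. pure_tensor KG KG (single g 1) (single g 1))"
    "counit ?L = lin_ext scalars (\<lambda>g. 1)" "antipode ?L = lin_ext KG (\<lambda>g. single (inv\<^bsub>group_of\<^esub> g) 1)"
    by (simp_all add: group_hopf_star_def group_hopf_def Let_def module.defs hopf.defs hopf_star.defs)
  note hom = coordinates_hopf_hom[OF this]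
  have "coordinates (star H x) = star ?L (coordinates x)" if x: "x \<in> carrier H" for x
  proof -
    interpret G: group group_of by (rule group_group_of)
    have inv: "inv\<^bsub>group_of\<^esub> g \<in> grouplike" if "g \<in> grouplike" for g using G.inv_closed[of g] that by simp
    let ?t = "coordinates x"
    have t: "keys ?t \<subseteq> grouplike" by (rule coordinates[OF x])
    have tc: "keys ?t \<subseteq> carrier H" using t grouplike_carrier by auto
    \<comment> \<open>The star conjugates the coordinates and replaces each group-like element by
      its inverse, as the star of the group algebra does.\<close>
    have "star H x = lin_ext H (\<lambda>g. star H g) (Poly_Mapping.map cnj ?t)"
      using star_lin_ext[of "\<lambda>x. x" ?t] tc coordinates(2)[OF x] by auto
    moreover have star_c: "star H \<in> keys (Poly_Mapping.map cnj ?t) \<rightarrow> carrier H" using tc by auto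
    ultimately have "coordinates (star H x) = lin_ext KG (\<lambda>g. coordinates (star H g)) (Poly_Mapping.map cnj ?t)"
      using linear_maps_lin_ext[OF vsp vspace_monoid_algebra coordinates_linear star_c] by simp
    also have "\<dots> = lin_ext KG (\<lambda>g. single (inv\<^bsub>group_of\<^esub> g) 1) (Poly_Mapping.map cnj ?t)"
      using t inv by (intro monoid_algebra.lin_ext_cong) (auto simp: star_grouplike coordinates_grouplike subset_iff)
    finally show ?thesis
      by (simp add: group_hopf_star_def hopf.defs hopf_star.defs)
  qed
  with hom show ?thesis unfolding hopf_star_iso_def hopf_star_homs_def by blast
qed

end

lemma magic_star_quotient:
  fixes H :: "('a, 'm) hopf_star_scheme"
  assumes "hopf_star_quotient (As_star n) H" "cocommutative H"
  shows "\<exists>u. magic_star H n u"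
proof -
  from assms(1) obtain \<pi> where \<pi>: "\<pi> \<in> hopf_star_homs (As_star n) H" "\<pi> ` carrier (As_star n) = carrier H"
    and H: "hopf_star_algebra H" unfolding hopf_star_quotient_def by blast
  have fields: "carrier (As_star n) = carrier (As n)" by (simp add: As_star_def hopf.defs)
  have "hopf_homs (As_star n) H = hopf_homs (As n) H"
    by (simp add: hopf_homs_def algebra_homs_def ring_hom_def linear_maps_def As_star_def hopf.defs)
  then have \<pi>': "\<pi> \<in> hopf_homs (As n) H" using \<pi>(1) by (simp add: hopf_star_homs_def)
  have ha: "hopf_algebra H" using H by (simp add: hopf_star_algebra_def)
  have "magic_hopf H n (\<lambda>i j. \<pi> (As_gen n i j))"
    by (rule magic_hopf_quotient[OF ha \<pi>']) (use \<pi>(2) fields in simp)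
  moreover have "star H (\<pi> (As_gen n i j)) = \<pi> (As_gen n i j)" if ij: "i \<in> {1..n}" "j \<in> {1..n}" for i j
  proof -
    have "As_gen n i j \<in> carrier (As_star n)"
      using magic_matrix.u_closed[OF magic_As ij] by (simp add: fields As_fields)
    then have "star H (\<pi> (As_gen n i j)) = \<pi> (star (As_star n) (As_gen n i j))"
      using \<pi>(1) by (simp add: hopf_star_homs_def)
    then show ?thesis using star_As_gen[OF ij] by simp
  qed
  ultimately have "magic_star H n (\<lambda>i j. \<pi> (As_gen n i j))"
    using H ha assms(2)
    by (simp add: magic_star_def magic_star_axioms_def cocommutative_hopf_def cocommutative_hopf_axioms_def hopf_alg_def)
  then show ?thesis by blast
qed

lemma magic_grouplike_quotient:
  fixes H :: "('k::alg_closed_field, 'a, 'm) hopf_scheme"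
  assumes "hopf_quotient (As n) H" "cocommutative H" "cosemisimple H"
  shows "\<exists>u. magic_grouplike H n u"
proof -
  from assms(1) obtain \<pi> where \<pi>: "\<pi> \<in> hopf_homs (As n) H" "\<pi> ` carrier (As n) = carrier H"
    and H: "hopf_algebra H" unfolding hopf_quotient_def by blast
  interpret magic_hopf H n "\<lambda>i j. \<pi> (As_gen n i j)" by (rule magic_hopf_quotient[OF H \<pi>])
  have "magic_grouplike H n (\<lambda>i j. \<pi> (As_gen n i j))"
    using cosemisimple_spanned_by_grouplike[OF H assms(2,3)] u_closed by unfold_locales auto
  then show ?thesis by blast
qed

section \<open>Free products of transitive abelian groups\<close>

text \<open>Cayley's theorem: A acts on itself by translations, transported to {1..m} by an
  enumeration e. The action is faithful and transitive, so T is the image of A and h the inverse of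
  the embedding.\<close>

lemma regular_representation:
  fixes A :: "('g, 'm) monoid_scheme" (structure)
  assumes A: "comm_group A" and fin: "finite (carrier A)"
  shows "\<exists>T. \<exists>h. transitive_abelian (card (carrier A)) T \<and>
     h \<in> hom (sym_group (card (carrier A)) \<lparr>carrier := T\<rparr>) A \<and> h ` T = carrier A"
proof -
  interpret comm_group A by fact
  let ?m = "card (carrier A)"
  interpret S: group "sym_group ?m" by (rule sym_group_is_group)
  obtain e where e: "bij_betw e {1..?m} (carrier A)" using ex_bij_betw_nat_finite_1[OF fin] by blast
  define e' where "e' = inv_into {1..?m} e"
  have e': "bij_betw e' (carrier A) {1..?m}" unfolding e'_def using e by (rule bij_betw_inv_into)
  have ee': "e (e' a) = a" if "a \<in> carrier A" for a
    unfolding e'_def using bij_betw_inv_into_right[OF e that] .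
  have e'e: "e' (e k) = k" if "k \<in> {1..?m}" for k
    unfolding e'_def using bij_betw_inv_into_left[OF e that] .
  have ec: "e k \<in> carrier A" if "k \<in> {1..?m}" for k using bij_betwE[OF e] that by blast
  have e'c: "e' a \<in> {1..?m}" if "a \<in> carrier A" for a using bij_betwE[OF e'] that by blast
  \<comment> \<open>Outside {1..m} the permutation is the identity, as \<open>permutes\<close>
    demands.\<close>
  define p where "p a k = (if k \<in> {1..?m} then e' (a \<otimes> e k) else k)" for a k
  have p_mult: "p (a \<otimes> b) = p a \<circ> p b" if "a \<in> carrier A" "b \<in> carrier A" for a b
  proof
    fix k show "p (a \<otimes> b) k = (p a \<circ> p b) k"
      using that e'c[of "b \<otimes> e k"] ee'[of "b \<otimes> e k"] ec[of k]
      by (auto simp: p_def m_assoc simp del: atLeastAtMost_iff)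
  qed
  have p_one: "p \<one> = id"
    by (rule ext) (use e'e ec in \<open>auto simp: p_def simp del: atLeastAtMost_iff\<close>)
  have p_closed: "p a permutes {1..?m}" if a: "a \<in> carrier A" for a
  proof -
    have "p a \<circ> p (inv a) = id" "p (inv a) \<circ> p a = id"
      using p_mult[of a "inv a"] p_mult[of "inv a" a] a p_one by (simp_all add: r_inv l_inv)
    then have "bij (p a)" using o_bij by blast
    then show ?thesis by (auto simp: permutes_def p_def bij_iff)
  qed
  have hom: "group_hom A (sym_group ?m) p"
    using p_closed p_mult by unfold_locales (auto simp: hom_def sym_group_def)
  let ?T = "p ` carrier A"
  have sub: "subgroup ?T (sym_group ?m)" by (rule group_hom.img_is_subgroup[OF hom])
  have inj: "a = b" if "a \<in> carrier A" "b \<in> carrier A" "p a = p b" for a b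
  proof -
    have 1: "e' \<one> \<in> {1..?m}" by (rule e'c) simp
    have "p a (e' \<one>) = p b (e' \<one>)" using that by simp
    then have "e' a = e' b" using 1 that(1,2) by (simp add: p_def ee' del: atLeastAtMost_iff)
    then show ?thesis using ee' that by metis
  qed
  have "comm_group (sym_group ?m \<lparr>carrier := ?T\<rparr>)"
  proof (rule group.group_comm_groupI)
    show "group (sym_group ?m \<lparr>carrier := ?T\<rparr>)" by (rule S.subgroup_imp_group[OF sub])
    fix x y assume "x \<in> carrier (sym_group ?m \<lparr>carrier := ?T\<rparr>)" "y \<in> carrier (sym_group ?m \<lparr>carrier := ?T\<rparr>)"
    then show "x \<otimes>\<^bsub>sym_group ?m \<lparr>carrier := ?T\<rparr>\<^esub> y = y \<otimes>\<^bsub>sym_group ?m \<lparr>carrier := ?T\<rparr>\<^esub> x"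
      by (auto simp: sym_group_def simp flip: p_mult) (simp add: m_comm)
  qed
  \<comment> \<open>Translation by e(j) e(i)^-1 takes e(i) to e(j).\<close>
  moreover have "\<exists>q\<in>?T. q i = j" if "i \<in> {1..?m}" "j \<in> {1..?m}" for i j
    using that ec e'e by (intro bexI[of _ "p (e j \<otimes> inv (e i))"]) (auto simp: p_def m_assoc simp del: atLeastAtMost_iff)
  moreover have "?m > 0" using fin one_closed card_gt_0_iff by blast
  ultimately have trans: "transitive_abelian ?m ?T"
    unfolding transitive_abelian_def using sub by simp
  define h where "h = inv_into (carrier A) p"
  have hp: "h (p a) = a" if "a \<in> carrier A" for a
    unfolding h_def using inj that by (intro inv_into_f_f) (auto simp: inj_on_def)
  have "h \<in> hom (sym_group ?m \<lparr>carrier := ?T\<rparr>) A"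
    by (rule homI) (auto simp: sym_group_def hp simp flip: p_mult)
  moreover have "h ` ?T = carrier A" using hp by (auto simp: image_image)
  ultimately show ?thesis using trans by blast
qed

section \<open>Free products of groups and their quotients\<close>

locale free_product_groups =
  fixes I :: "'i set" and G :: "'i \<Rightarrow> ('g, 'm) monoid_scheme"
  assumes groups: "\<And>i. i \<in> I \<Longrightarrow> group (G i)"
begin

abbreviation "W \<equiv> fp_words I G"
abbreviation "E \<equiv> fp_rel I G"

lemma words_simps [simp]: "[] \<in> W" "u @ v \<in> W \<longleftrightarrow> u \<in> W \<and> v \<in> W"
    "(i, a) # u \<in> W \<longleftrightarrow> i \<in> I \<and> a \<in> carrier (G i) \<and> u \<in> W"
  by (auto simp: fp_words_def)

lemma step_words: "fp_step I G u v \<Longrightarrow> u \<in> W \<and> v \<in> W"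
proof (induction rule: fp_step.induct)
  case (1 u v i)
  interpret group "G i" using 1 groups by blast
  show ?case using 1 by simp
next
  case (2 u v i a b)
  interpret group "G i" using 2 groups by blast
  show ?case using 2 by simp
qed

lemma step_context: "fp_step I G u v \<Longrightarrow> a \<in> W \<Longrightarrow> b \<in> W \<Longrightarrow> fp_step I G (a @ u @ b) (a @ v @ b)"
proof (induction rule: fp_step.induct)
  case (1 u v i)
  then show ?case using fp_step.intros(1)[of "a @ u" I G "v @ b" i] by simp
next
  case (2 u v i x y)
  then show ?case using fp_step.intros(2)[of "a @ u" I G "v @ b" i x y] by simp
qed

lemma equiv_context: "equivclp (fp_step I G) u v \<Longrightarrow> a \<in> W \<Longrightarrow> b \<in> W \<Longrightarrow> equivclp (fp_step I G) (a @ u @ b) (a @ v @ b)"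
proof (induction rule: equivclp_induct)
  case (step y z)
  then have "fp_step I G (a @ y @ b) (a @ z @ b) \<or> fp_step I G (a @ z @ b) (a @ y @ b)"
    using step_context by auto
  with step.IH[OF step.prems] show ?case by (rule equivclp_into_equivclp)
qed simp

lemma equiv_E: "equiv W E"
proof (rule equivI)
  show "refl_on W E" by (rule refl_onI) (auto simp: fp_rel_def)
  show "sym E" by (rule symI) (auto simp: fp_rel_def intro: equivclp_sym)
  show "trans E" by (rule transI) (auto simp: fp_rel_def intro: equivclp_trans)
qed (auto simp: fp_rel_def)

lemma trans_E: "trans E" using equiv_E by (simp add: equiv_def)

lemma E_append: "(u, u') \<in> E \<Longrightarrow> (v, v') \<in> E \<Longrightarrow> (u @ v, u' @ v') \<in> E"
  using equiv_context[of u u' "[]" v] equiv_context[of v v' u' "[]"]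
  by (auto simp: fp_rel_def intro: equivclp_trans)

lemma E_step: "fp_step I G u v \<Longrightarrow> (u, v) \<in> E"
  using step_words by (auto simp: fp_rel_def)

abbreviation cls where "cls u \<equiv> E `` {u}"
abbreviation "F \<equiv> free_product I G"

lemma cls_eq_iff: "u \<in> W \<Longrightarrow> v \<in> W \<Longrightarrow> cls u = cls v \<longleftrightarrow> (u, v) \<in> E"
  using equiv_E by (rule eq_equiv_class_iff)

text \<open>Equivalence of words is a congruence for concatenation, so all representatives
  contribute the same class to the defining union.\<close>

lemma cls_mult: assumes "u \<in> W" "v \<in> W" shows "cls u \<otimes>\<^bsub>F\<^esub> cls v = cls (u @ v)"
proof -
  have "cls (x @ y) = cls (u @ v)" if "x \<in> cls u" "y \<in> cls v" for x y
  proof -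
    have "(u @ v, x @ y) \<in> E" using that by (intro E_append) simp_all
    from equiv_class_eq[OF equiv_E this] show ?thesis by simp
  qed
  then have "(\<Union>x\<in>cls u. \<Union>y\<in>cls v. cls (x @ y)) = (\<Union>x\<in>cls u. \<Union>y\<in>cls v. cls (u @ v))"
    by (intro SUP_cong refl)
  moreover have "u \<in> cls u" "v \<in> cls v" using assms equiv_class_self[OF equiv_E] by auto
  then have "cls u \<noteq> {}" "cls v \<noteq> {}" by force+
  ultimately show ?thesis by (simp add: free_product_def)
qed

lemma F_simps: "carrier F = W // E" "\<one>\<^bsub>F\<^esub> = cls []"
  by (simp_all add: free_product_def)

lemma F_cases: assumes "x \<in> carrier F" obtains u where "u \<in> W" "x = cls u"
  using assms by (auto simp: F_simps elim: quotientE)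

lemma cls_closed [simp]: "u \<in> W \<Longrightarrow> cls u \<in> carrier F"
  by (auto simp: F_simps intro: quotientI)

text \<open>The inverse of the first letter is appended at the end of an inverse of the remaining
  word. The two adjacent letters multiply to an identity letter, which is deleted, and the induction
  hypothesis applies.\<close>

lemma exists_inverse_word: "u \<in> W \<Longrightarrow> \<exists>v\<in>W. (v @ u, []) \<in> E"
proof (induction u)
  case Nil then show ?case using equiv_E by (intro bexI[of _ "[]"]) (auto simp: equiv_def refl_on_def)
next
  case (Cons p u)
  obtain i a where p: "p = (i, a)" by (cases p)
  with Cons.prems have i: "i \<in> I" "a \<in> carrier (G i)" "u \<in> W" by auto
  from Cons.IH[OF i(3)] obtain v where v: "v \<in> W" "(v @ u, []) \<in> E" by blast
  interpret group "G i" using i groups by blast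
  have s1: "fp_step I G (v @ [(i, inv\<^bsub>G i\<^esub> a), (i, a)] @ u) (v @ [(i, inv\<^bsub>G i\<^esub> a \<otimes>\<^bsub>G i\<^esub> a)] @ u)"
    using i v by (intro fp_step.intros) auto
  have s2: "fp_step I G (v @ [(i, inv\<^bsub>G i\<^esub> a \<otimes>\<^bsub>G i\<^esub> a)] @ u) (v @ u)"
    using i v fp_step.intros(1)[of v I G u i] by simp
  have "((v @ [(i, inv\<^bsub>G i\<^esub> a)]) @ p # u, []) \<in> E"
    using transD[OF trans_E transD[OF trans_E E_step[OF s1] E_step[OF s2]] v(2)] by (simp add: p)
  then show ?case using v i by (intro bexI[of _ "v @ [(i, inv\<^bsub>G i\<^esub> a)]"]) auto
qed

lemma group_F: "group F"
proof (rule groupI)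
  fix x assume "x \<in> carrier F"
  then obtain u where u: "u \<in> W" "x = cls u" by (rule F_cases)
  then obtain v where v: "v \<in> W" "(v @ u, []) \<in> E" using exists_inverse_word by blast
  then show "\<exists>y\<in>carrier F. y \<otimes>\<^bsub>F\<^esub> x = \<one>\<^bsub>F\<^esub>"
    using u by (intro bexI[of _ "cls v"]) (simp_all add: cls_mult F_simps(2) cls_eq_iff)
next
  fix x assume "x \<in> carrier F"
  then show "\<one>\<^bsub>F\<^esub> \<otimes>\<^bsub>F\<^esub> x = x" by (elim F_cases) (simp add: F_simps(2) cls_mult)
next
  fix x y assume "x \<in> carrier F" "y \<in> carrier F"
  then show "x \<otimes>\<^bsub>F\<^esub> y \<in> carrier F" by (elim F_cases) (simp add: cls_mult)
next
  fix x y z assume "x \<in> carrier F" "y \<in> carrier F" "z \<in> carrier F"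
  then show "x \<otimes>\<^bsub>F\<^esub> y \<otimes>\<^bsub>F\<^esub> z = x \<otimes>\<^bsub>F\<^esub> (y \<otimes>\<^bsub>F\<^esub> z)" by (elim F_cases) (simp add: cls_mult)
qed (simp add: F_simps(2))

text \<open>Universal property of the free product: multiplying out the images of the letters in K
  is invariant under both kinds of steps and defines a homomorphism on classes. It is onto because
  the images of the factors generate K, and N is its kernel.\<close>

lemma quotient_iso:
  fixes K :: "('k, 'n) monoid_scheme"
  assumes K: "group K" and \<theta>: "\<And>i. i \<in> I \<Longrightarrow> \<theta> i \<in> hom (G i) K"
    and gen: "\<And>g. g \<in> carrier K \<Longrightarrow> \<exists>w. set w \<subseteq> (\<Union>i\<in>I. \<theta> i ` carrier (G i)) \<and> g = foldr (\<otimes>\<^bsub>K\<^esub>) w \<one>\<^bsub>K\<^esub>"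
  shows "\<exists>N. N \<lhd> F \<and> F Mod N \<cong> K"
proof -
  interpret K: group K by fact
  define val where "val w = foldr (\<lambda>(i, a) x. \<theta> i a \<otimes>\<^bsub>K\<^esub> x) w \<one>\<^bsub>K\<^esub>" for w
  have val_simps: "val [] = \<one>\<^bsub>K\<^esub>" "val ((i, a) # w) = \<theta> i a \<otimes>\<^bsub>K\<^esub> val w" for i a w by (simp_all add: val_def)
  have \<theta>c: "\<theta> i a \<in> carrier K" if "i \<in> I" "a \<in> carrier (G i)" for i a using \<theta>[OF that(1)] that(2) by (auto simp: hom_def)
  have valc: "val w \<in> carrier K" if "w \<in> W" for w
    using that by (induction w) (auto simp: val_simps \<theta>c)
  have val_append: "val (v @ w) = val v \<otimes>\<^bsub>K\<^esub> val w" if "v \<in> W" "w \<in> W" for v w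
    using that by (induction v) (auto simp: val_simps valc \<theta>c K.m_assoc)
  have val_step: "val u = val v" if "fp_step I G u v" for u v
    using that
  proof (induction rule: fp_step.induct)
    case (1 u v i)
    interpret Gi: group "G i" using 1 groups by blast
    have "\<theta> i \<one>\<^bsub>G i\<^esub> = \<one>\<^bsub>K\<^esub>" using hom_one[OF \<theta>[OF 1(3)] Gi.group_axioms K] .
    then show ?case using 1 by (simp add: val_append val_simps valc)
  next
    case (2 u v i a b)
    interpret Gi: group "G i" using 2 groups by blast
    have "\<theta> i (a \<otimes>\<^bsub>G i\<^esub> b) = \<theta> i a \<otimes>\<^bsub>K\<^esub> \<theta> i b" using \<theta>[OF 2(3)] 2(4,5) by (auto simp: hom_def)
    then show ?case using 2 by (simp add: val_append val_simps valc \<theta>c K.m_assoc)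
  qed
  have val_equiv: "val u = val v" if "equivclp (fp_step I G) u v" for u v
    using that by (induction rule: equivclp_induct) (auto simp: val_step)
  define \<Phi> where "\<Phi> C = the_elem (val ` C)" for C
  have \<Phi>: "\<Phi> (cls u) = val u" if "u \<in> W" for u
    unfolding \<Phi>_def using equiv_class_self[OF equiv_E that] val_equiv
    by (intro the_elem_image_constant) (auto simp: fp_rel_def)
  have hom: "group_hom F K \<Phi>"
  proof (rule group_hom.intro[OF group_F K group_hom_axioms.intro], rule homI)
    fix x assume "x \<in> carrier F"
    then show "\<Phi> x \<in> carrier K" by (elim F_cases) (simp add: \<Phi> valc)
  next
    fix x y assume "x \<in> carrier F" "y \<in> carrier F"
    then show "\<Phi> (x \<otimes>\<^bsub>F\<^esub> y) = \<Phi> x \<otimes>\<^bsub>K\<^esub> \<Phi> y" by (elim F_cases) (simp add: \<Phi> cls_mult val_append)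
  qed
  have lift: "\<exists>u\<in>W. val u = foldr (\<otimes>\<^bsub>K\<^esub>) w \<one>\<^bsub>K\<^esub>" if "set w \<subseteq> (\<Union>i\<in>I. \<theta> i ` carrier (G i))" for w
    using that
  proof (induction w)
    case Nil then show ?case by (intro bexI[of _ "[]"]) (auto simp: val_simps)
  next
    case (Cons g w)
    then obtain u where u: "u \<in> W" "val u = foldr (\<otimes>\<^bsub>K\<^esub>) w \<one>\<^bsub>K\<^esub>" by auto
    from Cons.prems obtain i a where "i \<in> I" "a \<in> carrier (G i)" "g = \<theta> i a" by auto
    then show ?case using u by (intro bexI[of _ "(i, a) # u"]) (auto simp: val_simps)
  qed
  then have "carrier K \<subseteq> \<Phi> ` carrier F"
  proof (intro subsetI)
    fix g assume "g \<in> carrier K"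
    then obtain w where "set w \<subseteq> (\<Union>i\<in>I. \<theta> i ` carrier (G i))" "g = foldr (\<otimes>\<^bsub>K\<^esub>) w \<one>\<^bsub>K\<^esub>" using gen by blast
    moreover from calculation lift obtain u where "u \<in> W" "val u = g" by metis
    ultimately show "g \<in> \<Phi> ` carrier F" using \<Phi>[of u] cls_closed[of u] by (metis image_eqI)
  qed
  then have "\<Phi> ` carrier F = carrier K" using group_hom.hom_closed[OF hom] by blast
  then have "F Mod kernel F K \<Phi> \<cong> K" by (rule group_hom.FactGroup_iso[OF hom])
  moreover have "kernel F K \<Phi> \<lhd> F" by (rule group_hom.normal_kernel[OF hom])
  ultimately show ?thesis by blast
qed

end

text \<open>Each S i is replaced by its regular permutation group on \<open>card (S i)\<close>
  points; the maps back to S i are the homomorphisms from the factors into K.\<close>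

lemma generated_by_finite_abelian_subgroups:
  fixes K :: "('g, 'm) monoid_scheme" (structure)
  assumes K: "group K"
    and S: "\<And>i. i \<in> {1..r::nat} \<Longrightarrow> comm_group (K\<lparr>carrier := S i\<rparr>)" "\<And>i. i \<in> {1..r} \<Longrightarrow> finite (S i)"
      "\<And>i. i \<in> {1..r} \<Longrightarrow> S i \<subseteq> carrier K"
    and gen: "\<And>g. g \<in> carrier K \<Longrightarrow> \<exists>w. set w \<subseteq> (\<Union>i\<in>{1..r}. S i) \<and> g = foldr (\<otimes>) w \<one>"
  shows "quotient_of_free_product_of_transitive_abelian K"
proof -
  have "\<forall>i. \<exists>T h. i \<in> {1..r} \<longrightarrow> transitive_abelian (card (S i)) T \<and>
     h \<in> hom (sym_group (card (S i)) \<lparr>carrier := T\<rparr>) (K\<lparr>carrier := S i\<rparr>) \<and> h ` T = S i"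
    using regular_representation[OF S(1)] S(2) by fastforce
  then obtain T h where Th: "\<And>i. i \<in> {1..r} \<Longrightarrow> transitive_abelian (card (S i)) (T i)"
    "\<And>i. i \<in> {1..r} \<Longrightarrow> h i \<in> hom (sym_group (card (S i)) \<lparr>carrier := T i\<rparr>) (K\<lparr>carrier := S i\<rparr>)"
    "\<And>i. i \<in> {1..r} \<Longrightarrow> h i ` T i = S i" by metis
  let ?G = "\<lambda>i. sym_group (card (S i)) \<lparr>carrier := T i\<rparr>"
  interpret free_product_groups "{1..r}" ?G
    by (rule free_product_groups.intro) (use Th(1) in \<open>simp add: transitive_abelian_def comm_group_def\<close>)
  have "\<exists>N. N \<lhd> free_product {1..r} ?G \<and> free_product {1..r} ?G Mod N \<cong> K"
  proof (rule quotient_iso[OF K])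
    show "h i \<in> hom (?G i) K" if "i \<in> {1..r}" for i
      using Th(2)[OF that] S(3)[OF that] by (auto simp: hom_def)
    show "\<exists>w. set w \<subseteq> (\<Union>i\<in>{1..r}. h i ` carrier (?G i)) \<and> g = foldr (\<otimes>) w \<one>" if "g \<in> carrier K" for g
      using gen[OF that] Th(3) by simp
  qed
  then show ?thesis
    unfolding quotient_of_free_product_of_transitive_abelian_def Let_def
    using Th(1) by (intro exI[of _ r] exI[of _ "\<lambda>i. card (S i)"] exI[of _ T]) auto
qed

text \<open>One factor for each row: r = n, with the finite abelian groups
  \<open>row_grouplike i\<close>, which generate by \<open>grouplike_eq_words\<close>.\<close>

lemma (in magic_grouplike) quotient_group_of: "quotient_of_free_product_of_transitive_abelian group_of"
proof (rule generated_by_finite_abelian_subgroups[where S = row_grouplike, OF group_group_of])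
  fix i assume i: "i \<in> {1..n}"
  have sub: "x \<in> grouplike" "x \<in> carrier H" if "x \<in> row_grouplike i" for x
    using that grouplike_carrier by (auto simp: row_grouplike_def)
  show "comm_group (group_of\<lparr>carrier := row_grouplike i\<rparr>)"
  proof (rule comm_groupI)
    show "\<exists>y\<in>carrier (group_of\<lparr>carrier := row_grouplike i\<rparr>).
        y \<otimes>\<^bsub>group_of\<lparr>carrier := row_grouplike i\<rparr>\<^esub> x = \<one>\<^bsub>group_of\<lparr>carrier := row_grouplike i\<rparr>\<^esub>"
      if "x \<in> carrier (group_of\<lparr>carrier := row_grouplike i\<rparr>)" for x
      using row_grouplike_inverse[OF i, of x] that by auto
    fix x y z
    assume "x \<in> carrier (group_of\<lparr>carrier := row_grouplike i\<rparr>)" "y \<in> carrier (group_of\<lparr>carrier := row_grouplike i\<rparr>)"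
      "z \<in> carrier (group_of\<lparr>carrier := row_grouplike i\<rparr>)"
    then show "x \<otimes>\<^bsub>group_of\<lparr>carrier := row_grouplike i\<rparr>\<^esub> y \<otimes>\<^bsub>group_of\<lparr>carrier := row_grouplike i\<rparr>\<^esub> z =
        x \<otimes>\<^bsub>group_of\<lparr>carrier := row_grouplike i\<rparr>\<^esub> (y \<otimes>\<^bsub>group_of\<lparr>carrier := row_grouplike i\<rparr>\<^esub> z)"
      using sub by (simp add: m_assoc)
  qed (use sub one_row_grouplike[OF i] mult_row_grouplike[OF i] row_grouplike_commute[OF i] in auto)
  show "finite (row_grouplike i)" by (rule finite_row_grouplike[OF i])
  show "row_grouplike i \<subseteq> carrier group_of" using sub by auto
next
  fix g assume "g \<in> carrier group_of"
  then have "g \<in> grouplike_words" using grouplike_eq_words by simp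
  moreover have "(\<otimes>\<^bsub>group_of\<^esub>) = (\<otimes>)" by (simp add: group_of_def)
  ultimately show "\<exists>w. set w \<subseteq> (\<Union>i\<in>{1..n}. row_grouplike i) \<and> g = foldr (\<otimes>\<^bsub>group_of\<^esub>) w \<one>\<^bsub>group_of\<^esub>"
    by (auto simp: grouplike_words_def)
qed

theorem corollary5p3:
  fixes n :: nat
  assumes "n \<ge> 1"
  shows
    "(\<forall>H :: ('k::{alg_closed_field, field_char_0}, 'h) hopf.
        hopf_quotient (As n) H \<and> cocommutative H \<and> cosemisimple H \<longrightarrow>
        (\<exists>G :: 'h monoid. group G \<and>
           quotient_of_free_product_of_transitive_abelian G \<and>
           hopf_iso H (group_hopf G))) \<and>
     (\<forall>H :: 'c hopf_star.
        hopf_star_quotient (As_star n) H \<and> cocommutative H \<longrightarrow>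
        (\<exists>G :: 'c monoid. group G \<and>
           quotient_of_free_product_of_transitive_abelian G \<and>
           hopf_star_iso H (group_hopf_star G)))"
proof (intro conjI allI impI; elim conjE)
  fix H :: "('k, 'h) hopf"
  assume "hopf_quotient (As n) H" "cocommutative H" "cosemisimple H"
  then obtain u where "magic_grouplike H n u" using magic_grouplike_quotient by blast
  then interpret magic_grouplike H n u .
  show "\<exists>G :: 'h monoid. group G \<and> quotient_of_free_product_of_transitive_abelian G \<and> hopf_iso H (group_hopf G)"
    using group_group_of quotient_group_of hopf_iso_group_hopf by blast
next
  fix H :: "'c hopf_star"
  assume "hopf_star_quotient (As_star n) H" "cocommutative H"
  then obtain u where "magic_star H n u" using magic_star_quotient by blast
  then interpret magic_star H n u .
  show "\<exists>G :: 'c monoid. group G \<and> quotient_of_free_product_of_transitive_abelian G \<and> hopf_star_iso H (group_hopf_star G)"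
    using group_group_of quotient_group_of hopf_star_iso_group_hopf by blast
qed

end
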